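(* Let $K$ be a mesh cell. For $F_K=(F_{K,\sigma})_{\sigma\in\mathcal E_K}\in\mathcal F_K=\mathbf{R}^{\mathcal E_K}$ let $\widehat F_K:K\to\mathbf{R}^d$ be the function defined by $$\widehat F_K(x)=-\Lambda_K\mathbf v_K(F_K)+T_{K,\sigma}(F_K)\,\frac{x-x_K}{d_{K,\sigma}}\qquad\text{for all }\sigma\in\mathcal E_K\text{ and a.e. }x\in\triangle_{K,\sigma}.$$ Then the operator $F_K\in\mathcal F_K\mapsto\widehat F_K\in L^2(K)^d$ satisfies the following properties: (i) for all $F_K\in\mathcal F_K$, all $\sigma\in\mathcal E_K$ and all $x\in\sigma$: $\widehat F_K(x)\cdot\mathbf n_{K,\sigma}=F_{K,\sigma}$; (ii) for all $F_K\in\mathcal F_K$, all affine functions $q$, and any weight function $w_K:K\to\mathbf{R}$ satisfying $\int_Kw_K(x)\,dx=|K|$ and $\int_Kx\,w_K(x)\,dx=|K|x_K$: $$\int_Kq(x)\,\mathrm{div}(\widehat F_K)(x)\,dx=\int_Kq(x)\,\mathcal{DIV}^h(F_K)\,w_K(x)\,dx;$$ (iii) for all $F\in\mathbf{R}^d$, defining $F_K=(F\cdot\mathbf n_{K,\sigma})_{\sigma\in\mathcal E_K}$: $\widehat F_K=F$ on $K$.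
   Context: $K\subset\mathbf{R}^d$ is an open bounded polytope, $\mathcal E_K$ its set of faces (each face $\sigma$ is a relatively open subset of a hyperplane; faces are disjoint and their closures cover $\partial K$), $|K|$ and $|\sigma|$ the $d$- and $(d-1)$-dimensional measures, $\mathbf n_{K,\sigma}$ the unit normal to $\sigma$ outward to $K$, $\bar x_\sigma$ the center of gravity of $\sigma$. $x_K\in K$ is a point with respect to which $K$ is star-shaped, $d_{K,\sigma}>0$ is the distance from $x_K$ to the hyperplane containing $\sigma$, and $\triangle_{K,\sigma}$ is the cone with vertex $x_K$ and basis $\sigma$ (so that the cones $\triangle_{K,\sigma}$, $\sigma\in\mathcal E_K$, partition $K$ up to a null set). $\Lambda_K$ is a symmetric positive definite $d\times d$ matrix (the mean on $K$ of the diffusion tensor). For $F_K\in\mathcal F_K$: - $\mathbf v_K(F_K)\in\mathbf{R}^d$ is defined by $|K|\Lambda_K\mathbf v_K(F_K)=-\sum_{\sigma\in\mathcal E_K}|\sigma|F_{K,\sigma}(\bar x_\sigma-x_K)$; - $T_{K,\sigma}(F_K)=F_{K,\sigma}+\Lambda_K\mathbf v_K(F_K)\cdot\mathbf n_{K,\sigma}$; - $\mathcal{DIV}^h(F_K)=\frac1{|K|}\sum_{\sigma\in\mathcal E_K}|\sigma|F_{K,\sigma}$ (a real number). For $x\in\sigma$, $\widehat F_K(x)$ is the value at $x$ of the affine expression defining $\widehat F_K$ on $\triangle_{K,\sigma}$. $\mathrm{div}(\widehat F_K)$ is the distributional divergence on $K$, which is an $L^2$ function because $\widehat F_K\in H_{\mathrm{div}}(K)$.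 *)

theory Defs
  imports "HOL-Analysis.Analysis"
begin

section \<open>Lebesgue measure on an affine subspace\<close>

text \<open>Lebesgue measure on an affine subspace \<open>H\<close> is transported from the coordinate space of an
  orthonormal basis of its direction space; the result does not depend on the choices of origin
  and basis. If \<open>H\<close> is a single point, this is the unit point mass, so that faces in
  dimension one have measure one.\<close>

definition orthonormal_frame :: "'a::euclidean_space set \<Rightarrow> 'a set \<Rightarrow> bool" where
  "orthonormal_frame H B \<longleftrightarrow>
     pairwise orthogonal B \<and> (\<forall>b\<in>B. norm b = 1) \<and> span B = {x - y |x y. x \<in> H \<and> y \<in> H}"

definition affine_lborel :: "'a::euclidean_space set \<Rightarrow> 'a measure" where
  "affine_lborel H =
     (let p = (SOME p. p \<in> H); B = (SOME B. orthonormal_frame H B)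
      in distr (Pi\<^sub>M B (\<lambda>_. lborel)) borel (\<lambda>t. p + (\<Sum>b\<in>B. t b *\<^sub>R b)))"

definition face_measure :: "'a::euclidean_space set \<Rightarrow> real" where
  "face_measure \<sigma> = measure (affine_lborel (affine hull \<sigma>)) \<sigma>"

definition face_center :: "'a::euclidean_space set \<Rightarrow> 'a" where
  "face_center \<sigma> =
     (1 / face_measure \<sigma>) *\<^sub>R (LINT y:\<sigma>|affine_lborel (affine hull \<sigma>). y)"


section \<open>Polytopal cells\<close>

text \<open>The cell need not be convex. Since the frontier lies in finitely many hyperplanes, a
  bounded open set of this kind is polytopal.\<close>

definition polytopal_cell :: "'a::euclidean_space set \<Rightarrow> 'a set set \<Rightarrow> bool" where
  "polytopal_cell K \<E> \<longleftrightarrow>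
     open K \<and> bounded K \<and> K \<noteq> {} \<and> finite \<E> \<and>
     (\<forall>\<sigma>\<in>\<E>. \<sigma> \<noteq> {} \<and>
        (\<exists>a b. a \<noteq> 0 \<and> openin (top_of_set {x. a \<bullet> x = b}) \<sigma>)) \<and>
     pairwise disjnt \<E> \<and>
     frontier K = (\<Union>\<sigma>\<in>\<E>. closure \<sigma>)"

definition outward_unit_normal :: "'a::euclidean_space set \<Rightarrow> 'a set \<Rightarrow> 'a \<Rightarrow> bool" where
  "outward_unit_normal K \<sigma> n \<longleftrightarrow>
     norm n = 1 \<and>
     (\<forall>x\<in>\<sigma>. \<forall>y\<in>\<sigma>. n \<bullet> (x - y) = 0) \<and>
     (\<forall>x\<in>\<sigma>. \<exists>\<epsilon>>0. \<forall>t. 0 < t \<and> t < \<epsilon> \<longrightarrow> x - t *\<^sub>R n \<in> K \<and> x + t *\<^sub>R n \<notin> K)"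

definition star_shaped_wrt :: "'a::euclidean_space \<Rightarrow> 'a set \<Rightarrow> bool" where
  "star_shaped_wrt p K \<longleftrightarrow> p \<in> K \<and> (\<forall>x\<in>K. closed_segment p x \<subseteq> K)"

text \<open>The affine hull of a nonempty relatively open subset of a hyperplane is that hyperplane.\<close>

definition face_dist :: "'a::euclidean_space \<Rightarrow> 'a set \<Rightarrow> real" where
  "face_dist p \<sigma> = infdist p (affine hull \<sigma>)"

definition open_cone :: "'a::euclidean_space \<Rightarrow> 'a set \<Rightarrow> 'a set" where
  "open_cone p \<sigma> = {p + t *\<^sub>R (y - p) |t y. 0 < t \<and> t < 1 \<and> y \<in> \<sigma>}"


section \<open>Square integrable functions and distributional divergence\<close>

definition L2_on :: "'a::euclidean_space set \<Rightarrow> ('a \<Rightarrow> 'b::euclidean_space) \<Rightarrow> bool" where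
  "L2_on K f \<longleftrightarrow>
     set_borel_measurable lebesgue K f \<and> set_integrable lebesgue K (\<lambda>x. (norm (f x))\<^sup>2)"

definition partial_deriv :: "'d::finite \<Rightarrow> (real^'d \<Rightarrow> real) \<Rightarrow> real^'d \<Rightarrow> real" where
  "partial_deriv i \<phi> x = frechet_derivative \<phi> (at x) (axis i 1)"

definition gradient :: "(real^'d::finite \<Rightarrow> real) \<Rightarrow> real^'d \<Rightarrow> real^'d" where
  "gradient \<phi> x = (\<chi> i. partial_deriv i \<phi> x)"

primrec C_k :: "nat \<Rightarrow> (real^'d::finite \<Rightarrow> real) \<Rightarrow> bool" where
  "C_k 0 \<phi> \<longleftrightarrow> continuous_on UNIV \<phi>"
| "C_k (Suc k) \<phi> \<longleftrightarrow> (\<forall>x. \<phi> differentiable (at x)) \<and> (\<forall>i. C_k k (partial_deriv i \<phi>))"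

definition test_function :: "(real^'d::finite) set \<Rightarrow> (real^'d \<Rightarrow> real) \<Rightarrow> bool" where
  "test_function K \<phi> \<longleftrightarrow>
     (\<forall>k. C_k k \<phi>) \<and> compact (closure {x. \<phi> x \<noteq> 0}) \<and> closure {x. \<phi> x \<noteq> 0} \<subseteq> K"

text \<open>\<open>has_L2_divergence K f g\<close>: the function \<open>f\<close> belongs to \<open>H\<^sub>d\<^sub>i\<^sub>v(K)\<close> and \<open>g\<close> is a
  representative of its distributional divergence.\<close>

definition has_L2_divergence ::
    "(real^'d::finite) set \<Rightarrow> (real^'d \<Rightarrow> real^'d) \<Rightarrow> (real^'d \<Rightarrow> real) \<Rightarrow> bool" where
  "has_L2_divergence K f g \<longleftrightarrow>
     L2_on K f \<and> L2_on K g \<and>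
     (\<forall>\<phi>. test_function K \<phi> \<longrightarrow>
        (LINT x:K|lebesgue. g x * \<phi> x) = - (LINT x:K|lebesgue. f x \<bullet> gradient \<phi> x))"


section \<open>Discrete fluxes and their reconstruction\<close>

text \<open>A family of fluxes indexed by the faces is a function on sets, of which only the values
  on \<open>\<E>\<close> are used.\<close>

definition flux_gradient :: "(real^'d::finite) set \<Rightarrow> (real^'d) set set \<Rightarrow> real^'d \<Rightarrow>
    real^'d^'d \<Rightarrow> ((real^'d) set \<Rightarrow> real) \<Rightarrow> real^'d" where
  "flux_gradient K \<E> p \<Lambda> F =
     (THE v. measure lebesgue K *\<^sub>R (\<Lambda> *v v)
              = - (\<Sum>\<sigma>\<in>\<E>. (face_measure \<sigma> * F \<sigma>) *\<^sub>R (face_center \<sigma> - p)))"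

definition flux_residual :: "(real^'d::finite) set \<Rightarrow> (real^'d) set set \<Rightarrow> real^'d \<Rightarrow>
    real^'d^'d \<Rightarrow> ((real^'d) set \<Rightarrow> real^'d) \<Rightarrow> ((real^'d) set \<Rightarrow> real) \<Rightarrow> (real^'d) set \<Rightarrow> real" where
  "flux_residual K \<E> p \<Lambda> n F \<sigma> = F \<sigma> + (\<Lambda> *v flux_gradient K \<E> p \<Lambda> F) \<bullet> n \<sigma>"

definition discrete_div ::
    "(real^'d::finite) set \<Rightarrow> (real^'d) set set \<Rightarrow> ((real^'d) set \<Rightarrow> real) \<Rightarrow> real" where
  "discrete_div K \<E> F = (1 / measure lebesgue K) * (\<Sum>\<sigma>\<in>\<E>. face_measure \<sigma> * F \<sigma>)"

definition flux_affine :: "(real^'d::finite) set \<Rightarrow> (real^'d) set set \<Rightarrow> real^'d \<Rightarrow>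
    real^'d^'d \<Rightarrow> ((real^'d) set \<Rightarrow> real^'d) \<Rightarrow> ((real^'d) set \<Rightarrow> real) \<Rightarrow> (real^'d) set \<Rightarrow>
    real^'d \<Rightarrow> real^'d" where
  "flux_affine K \<E> p \<Lambda> n F \<sigma> x =
     - (\<Lambda> *v flux_gradient K \<E> p \<Lambda> F)
     + flux_residual K \<E> p \<Lambda> n F \<sigma> *\<^sub>R ((1 / face_dist p \<sigma>) *\<^sub>R (x - p))"

text \<open>The reconstructed field is determined almost everywhere only; the predicate holds of
  all its representatives.\<close>

definition is_flux_reconstruction :: "(real^'d::finite) set \<Rightarrow> (real^'d) set set \<Rightarrow> real^'d \<Rightarrow>
    real^'d^'d \<Rightarrow> ((real^'d) set \<Rightarrow> real^'d) \<Rightarrow> ((real^'d) set \<Rightarrow> real) \<Rightarrow>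
    (real^'d \<Rightarrow> real^'d) \<Rightarrow> bool" where
  "is_flux_reconstruction K \<E> p \<Lambda> n F f \<longleftrightarrow>
     (\<forall>\<sigma>\<in>\<E>. AE x in lebesgue. x \<in> open_cone p \<sigma> \<longrightarrow> f x = flux_affine K \<E> p \<Lambda> n F \<sigma> x)"

end

theory Submission
  imports Defs "HOL-Computational_Algebra.Polynomial"
begin

text \<open>On the cone over a face, the field is a constant plus a multiple of \<open>x - p\<close>. The multiple is constant
  along rays from \<open>p\<close>, so differentiating \<open>\<integral> G(x) \<phi>(p + s (x - p)) dx\<close> at \<open>s = 1\<close> yields the distributional
  divergence without any trace or surface integral. The only geometric input is
  \<open>\<Sum> |\<sigma>| n = 0\<close> and \<open>\<Sum> |\<sigma>| (n \<bullet> e) (a \<bullet> (center - p)) = |K| (a \<bullet> e)\<close>. Both come from the Lipschitz function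
  \<open>max 0 (1 - gauge)\<close>, whose gradient is \<open>- n / d\<close> on each cone: integrate its difference quotients against
  affine functions and turn cone integrals into face integrals by homogeneity.\<close>

subsection \<open>Lebesgue measure in orthonormal coordinates\<close>

text \<open>Faces are mere relatively open pieces of hyperplanes and \<open>K\<close> may be
  nonconvex, so a divergence theorem on \<open>K\<close> would need traces on sets without boundary
  regularity. The multiple of \<open>x - p\<close> jumps across the lateral sides of the cones, but
  \<open>x - p\<close> is tangent to them; dilations about \<open>p\<close> see no jump, and
  differentiating their Jacobian \<open>s^(-N)\<close>, with \<open>N\<close> the dimension, gives
  the divergence \<open>N * T / d\<close> on each cone, where \<open>T\<close> is the residual. The
  constant part \<open>- V F\<close> is handled by translations. Statement (ii) rests on the choice
  of \<open>V\<close>: the second face identity makes the first moments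
  \<open>\<Sum> |\<sigma>| T (center - p)\<close> vanish, and the first one makes
  \<open>\<Sum> |\<sigma>| T\<close> equal to \<open>\<Sum> |\<sigma>| F\<close>. So the divergence
  sees an affine \<open>q\<close> only through \<open>q p\<close>, as \<open>w\<close> does by its
  moment conditions. In (iii) the second identity gives \<open>V = - G\<close>, and all residuals
  vanish. The gauge need not be convex, so its Lipschitz bound comes from piecewise linearity along
  segments. Face measures involve an arbitrary choice of orthonormal frame, hence the need for
  rotation invariance of Lebesgue measure.\<close>

interpretation lborel_product: product_sigma_finite "\<lambda>_::'i. lborel :: real measure"
  by (simp add: product_sigma_finite_def lborel.sigma_finite_measure_axioms)

text \<open>Both measures agree on rectangles, where each coordinate contributes one factor
  \<open>|c|\<close>. In frame coordinates, slices of a cone at different heights are related by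
  exactly such maps: one common scale and a shift per coordinate.\<close>

lemma PiM_lborel_affine:
  fixes c :: real and \<tau> :: "'i \<Rightarrow> real"
  assumes "finite B" and c: "c \<noteq> 0"
  shows "density (distr (Pi\<^sub>M B (\<lambda>_. lborel)) (Pi\<^sub>M B (\<lambda>_. lborel)) (\<lambda>t. \<lambda>b\<in>B. \<tau> b + c * t b))
           (\<lambda>_. \<bar>c\<bar> ^ card B) = Pi\<^sub>M B (\<lambda>_. lborel)" (is "density (distr _ _ ?T) _ = _")
proof (rule lborel_product.PiM_eqI)
  have T[measurable]: "?T \<in> Pi\<^sub>M B (\<lambda>_. lborel) \<rightarrow>\<^sub>M Pi\<^sub>M B (\<lambda>_. lborel)"
    by measurable
  fix A :: "'i \<Rightarrow> real set" assume "\<And>i. i \<in> B \<Longrightarrow> A i \<in> sets lborel"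
  then have A[measurable]: "i \<in> B \<Longrightarrow> A i \<in> sets borel" for i by simp
  have PA: "Pi\<^sub>E B A \<in> sets (Pi\<^sub>M B (\<lambda>_. lborel))"
    using \<open>finite B\<close> by (auto intro!: sets_PiM_I_finite A)
  have pre: "?T -` Pi\<^sub>E B A \<inter> space (Pi\<^sub>M B (\<lambda>_. lborel)) = Pi\<^sub>E B (\<lambda>b. (\<lambda>x. \<tau> b + c * x) -` A b)"
    by (auto simp: space_PiM PiE_def Pi_def extensional_def)
  have vm: "(\<lambda>x. \<tau> b + c * x) -` A b \<in> sets lborel" if "b \<in> B" for b
  proof -
    have "(\<lambda>x. \<tau> b + c * x) \<in> borel_measurable borel" by simp
    from measurable_sets[OF this A[OF that]] show ?thesis by simp
  qed
  have one: "ennreal \<bar>c\<bar> * emeasure lborel ((\<lambda>x. \<tau> b + c * x) -` A b) = emeasure lborel (A b)" if "b \<in> B" for b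
    using A[OF that] 
    by (subst (2) lborel_real_affine[OF c, of "\<tau> b"])
       (simp add: emeasure_density nn_integral_cmult_indicator emeasure_distr)
  have "emeasure (density (distr (Pi\<^sub>M B (\<lambda>_. lborel)) (Pi\<^sub>M B (\<lambda>_. lborel)) ?T) (\<lambda>_. \<bar>c\<bar> ^ card B)) (Pi\<^sub>E B A)
     = ennreal (\<bar>c\<bar> ^ card B) * emeasure (Pi\<^sub>M B (\<lambda>_. lborel)) (Pi\<^sub>E B (\<lambda>b. (\<lambda>x. \<tau> b + c * x) -` A b))"
    using PA by (simp add: emeasure_density nn_integral_cmult_indicator emeasure_distr pre)
  also have "\<dots> = ennreal (\<bar>c\<bar> ^ card B) * (\<Prod>b\<in>B. emeasure lborel ((\<lambda>x. \<tau> b + c * x) -` A b))"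
    using \<open>finite B\<close> vm by (subst lborel_product.emeasure_PiM) auto
  also have "\<dots> = (\<Prod>b\<in>B. ennreal \<bar>c\<bar> * emeasure lborel ((\<lambda>x. \<tau> b + c * x) -` A b))"
    by (simp add: prod.distrib ennreal_power)
  also have "\<dots> = (\<Prod>b\<in>B. emeasure lborel (A b))"
    by (intro prod.cong one refl)
  finally show "emeasure (density (distr (Pi\<^sub>M B (\<lambda>_. lborel)) (Pi\<^sub>M B (\<lambda>_. lborel)) ?T) (\<lambda>_. \<bar>c\<bar> ^ card B)) (Pi\<^sub>E B A)
    = (\<Prod>b\<in>B. emeasure lborel (A b))" .
qed (use assms in simp_all)

lemma nn_integral_PiM_lborel_affine:
  fixes c :: real and \<tau> :: "'i \<Rightarrow> real"
  assumes "finite B" and c: "c \<noteq> 0" and g: "g \<in> borel_measurable (Pi\<^sub>M B (\<lambda>_. lborel))"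
  shows "(\<integral>\<^sup>+t. g t \<partial>Pi\<^sub>M B (\<lambda>_. lborel))
    = ennreal (\<bar>c\<bar> ^ card B) * (\<integral>\<^sup>+t. g (\<lambda>b\<in>B. \<tau> b + c * t b) \<partial>Pi\<^sub>M B (\<lambda>_. lborel))"
proof -
  have T[measurable]: "(\<lambda>t. \<lambda>b\<in>B. \<tau> b + c * t b) \<in> Pi\<^sub>M B (\<lambda>_. lborel) \<rightarrow>\<^sub>M Pi\<^sub>M B (\<lambda>_. lborel)"
    by measurable
  show ?thesis
    using g by (subst PiM_lborel_affine[OF assms(1,2), of \<tau>, symmetric])
      (simp add: nn_integral_density nn_integral_distr nn_integral_cmult)
qed

text \<open>Besides translations (\<open>c = 1\<close>), the reflected variable \<open>t - x\<close>
  (\<open>c = -1\<close>) occurs in the Fubini argument for orthogonal maps.\<close>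

lemma nn_integral_lborel_shift:
  fixes t :: "'a::euclidean_space"
  assumes "f \<in> borel_measurable borel" "\<bar>c\<bar> = 1"
  shows "(\<integral>\<^sup>+x. f (t + c *\<^sub>R x) \<partial>lborel) = (\<integral>\<^sup>+x. f x \<partial>lborel)"
proof -
  have "c \<noteq> 0" using assms by auto
  then show ?thesis
    using assms by (subst (2) lborel_affine[of c t])
      (simp_all add: nn_integral_density nn_integral_distr)
qed

text \<open>The Fubini argument for uniqueness of Haar measure, normalised on the unit ball, which \<open>T\<close> preserves.\<close>

lemma distr_orthogonal_lborel:
  fixes T :: "'a::euclidean_space \<Rightarrow> 'a"
  assumes T: "orthogonal_transformation T"
  shows "distr lborel borel T = lborel"
proof (rule measure_eqI)
  have lin: "linear T" using T orthogonal_transformation_linear by blast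
  then have [measurable]: "T \<in> borel_measurable borel"
    by (simp add: linear_continuous_on linear_linear borel_measurable_continuous_onI)
  have inv: "T (inv T y) = y" for y
    using T by (simp add: orthogonal_transformation_surj surj_f_inv_f)
  have shift: "(\<integral>\<^sup>+x. f (T x + y) \<partial>lborel) = (\<integral>\<^sup>+x. f (T x) \<partial>lborel)"
    if [measurable]: "f \<in> borel_measurable borel" for f :: "'a \<Rightarrow> ennreal" and y
  proof -
    have "T x + y = T (inv T y + 1 *\<^sub>R x)" for x
      by (simp add: linear_add[OF lin] inv)
    then show ?thesis
      using nn_integral_lborel_shift[of "\<lambda>x. f (T x)" 1 "inv T y"] by simp
  qed
  let ?C = "ball 0 1 :: 'a set"
  have [measurable]: "?C \<in> sets borel" by simp
  fix A assume "A \<in> sets (distr lborel borel T)"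
  then have [measurable]: "A \<in> sets borel" by simp
  have "emeasure (distr lborel borel T) A * emeasure lborel ?C
      = (\<integral>\<^sup>+x. indicator A (T x) * (\<integral>\<^sup>+y. indicator ?C y \<partial>lborel) \<partial>lborel)"
    by (simp add: nn_integral_multc emeasure_distr nn_integral_distr flip: nn_integral_indicator)
  also have "\<dots> = (\<integral>\<^sup>+x. indicator A (T x) * (\<integral>\<^sup>+y. indicator ?C (T x + 1 *\<^sub>R y) \<partial>lborel) \<partial>lborel)"
    by (subst nn_integral_lborel_shift) simp_all
  also have "\<dots> = (\<integral>\<^sup>+x. \<integral>\<^sup>+y. indicator A (T x) * indicator ?C (T x + y) \<partial>lborel \<partial>lborel)"
    by (subst nn_integral_cmult) simp_all
  also have "\<dots> = (\<integral>\<^sup>+y. \<integral>\<^sup>+x. indicator A (T x) * indicator ?C (T x + y) \<partial>lborel \<partial>lborel)"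
    by (rule lborel_pair.Fubini') measurable
  \<comment> \<open>For fixed \<open>y\<close>, replacing \<open>x\<close> by its translate by
    \<open>- inv T y\<close> turns \<open>T x\<close> into \<open>T x - y\<close>; this moves
    \<open>y\<close> from the ball to \<open>A\<close>.\<close>
  also have "\<dots> = (\<integral>\<^sup>+y. \<integral>\<^sup>+x. indicator A (T x - y) * indicator ?C (T x) \<partial>lborel \<partial>lborel)"
  proof (rule nn_integral_cong)
    fix y
    show "(\<integral>\<^sup>+x. indicator A (T x) * indicator ?C (T x + y) \<partial>lborel)
        = (\<integral>\<^sup>+x. indicator A (T x - y) * indicator ?C (T x) \<partial>lborel)"
      using shift[of "\<lambda>z. indicator A (z - y) * indicator ?C z" y] by simp
  qed
  also have "\<dots> = (\<integral>\<^sup>+x. \<integral>\<^sup>+y. indicator A (T x - y) * indicator ?C (T x) \<partial>lborel \<partial>lborel)"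
    by (rule lborel_pair.Fubini') measurable
  also have "\<dots> = (\<integral>\<^sup>+x. (\<integral>\<^sup>+y. indicator A (T x + (-1) *\<^sub>R y) \<partial>lborel) * indicator ?C (T x) \<partial>lborel)"
    by (simp add: nn_integral_multc)
  also have "\<dots> = (\<integral>\<^sup>+x. (\<integral>\<^sup>+y. indicator A y \<partial>lborel) * indicator ?C (T x) \<partial>lborel)"
    by (subst nn_integral_lborel_shift) simp_all
  also have "\<dots> = emeasure lborel A * (\<integral>\<^sup>+x. indicator ?C (T x) \<partial>lborel)"
    by (simp add: nn_integral_cmult)
  also have "(\<integral>\<^sup>+x. indicator ?C (T x) \<partial>lborel) = emeasure lborel ?C"
    using T by (simp add: indicator_def orthogonal_transformation_norm flip: nn_integral_indicator)
  finally have eq: "emeasure (distr lborel borel T) A * emeasure lborel ?C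
     = emeasure lborel A * emeasure lborel ?C" .
  have "emeasure lborel ?C \<noteq> 0"
    using open_not_negligible[of ?C] by (auto simp: negligible_iff_emeasure0)
  moreover have "emeasure lborel ?C \<noteq> \<infinity>"
    using emeasure_bounded_finite[of ?C] by simp
  ultimately show "emeasure (distr lborel borel T) A = emeasure lborel A"
    using eq by (metis ennreal_mult_cancel_left infinity_ennreal_def mult.commute)
qed simp

lemma distr_PiM_reindex_lborel:
  assumes "finite I" and g: "bij_betw g I J"
  shows "distr (Pi\<^sub>M J (\<lambda>_. lborel)) (Pi\<^sub>M I (\<lambda>_. lborel)) (\<lambda>t. \<lambda>i\<in>I. t (g i))
    = Pi\<^sub>M I (\<lambda>_. lborel :: real measure)" (is "distr _ _ ?T = _")
proof (rule lborel_product.PiM_eqI)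
  have fJ: "finite J" using assms bij_betw_finite by blast
  have gJ: "i \<in> I \<Longrightarrow> g i \<in> J" for i using g by (auto simp: bij_betw_def)
  have [measurable]: "?T \<in> Pi\<^sub>M J (\<lambda>_. lborel) \<rightarrow>\<^sub>M Pi\<^sub>M I (\<lambda>_. lborel)"
    using gJ by measurable
  fix A :: "_ \<Rightarrow> real set" assume A: "\<And>i. i \<in> I \<Longrightarrow> A i \<in> sets lborel"
  let ?h = "the_inv_into I g"
  have h: "?h (g i) = i" if "i \<in> I" for i
    using g that by (simp add: bij_betw_def the_inv_into_f_f)
  have hI: "?h j \<in> I" "g (?h j) = j" if "j \<in> J" for j
    using g that by (auto simp: bij_betw_def f_the_inv_into_f the_inv_into_into)
  have pre: "?T -` Pi\<^sub>E I A \<inter> space (Pi\<^sub>M J (\<lambda>_. lborel)) = Pi\<^sub>E J (\<lambda>j. A (?h j))"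
  proof (intro set_eqI iffI)
    fix t assume t: "t \<in> ?T -` Pi\<^sub>E I A \<inter> space (Pi\<^sub>M J (\<lambda>_. lborel))"
    have "t j \<in> A (?h j)" if "j \<in> J" for j
    proof -
      have "?T t \<in> Pi\<^sub>E I A" using t by simp
      from PiE_mem[OF this hI(1)[OF that]] show ?thesis using hI[OF that] by simp
    qed
    then show "t \<in> Pi\<^sub>E J (\<lambda>j. A (?h j))"
      using t by (auto simp: space_PiM PiE_def)
  next
    fix t assume t: "t \<in> Pi\<^sub>E J (\<lambda>j. A (?h j))"
    have "t (g i) \<in> A i" if "i \<in> I" for i
      using PiE_mem[OF t gJ[OF that]] h[OF that] by simp
    then show "t \<in> ?T -` Pi\<^sub>E I A \<inter> space (Pi\<^sub>M J (\<lambda>_. lborel))"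
      using t by (auto simp: space_PiM PiE_def)
  qed
  have "emeasure (distr (Pi\<^sub>M J (\<lambda>_. lborel)) (Pi\<^sub>M I (\<lambda>_. lborel)) ?T) (Pi\<^sub>E I A)
      = emeasure (Pi\<^sub>M J (\<lambda>_. lborel)) (Pi\<^sub>E J (\<lambda>j. A (?h j)))"
    using A \<open>finite I\<close> by (simp add: emeasure_distr sets_PiM_I_finite pre)
  also have "\<dots> = (\<Prod>j\<in>J. emeasure lborel (A (?h j)))"
    using A hI fJ by (subst lborel_product.emeasure_PiM) auto
  also have "\<dots> = (\<Prod>i\<in>I. emeasure lborel (A i))"
    by (rule prod.reindex_bij_betw[OF g, symmetric, THEN trans]) (auto intro!: prod.cong simp: h)
  finally show "emeasure (distr (Pi\<^sub>M J (\<lambda>_. lborel)) (Pi\<^sub>M I (\<lambda>_. lborel)) ?T) (Pi\<^sub>E I A)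
     = (\<Prod>i\<in>I. emeasure lborel (A i))" .
qed (use assms in simp_all)

text \<open>A bijection from the standard basis to \<open>B\<close> extends to an orthogonal map,
  which preserves \<open>lborel\<close> and carries standard coordinates to coordinates in
  \<open>B\<close>. This makes an arbitrarily chosen frame as good as the standard one.\<close>

lemma lborel_eq_distr_orthonormal:
  fixes B :: "'a::euclidean_space set"
  assumes orth: "pairwise orthogonal B" and nrm: "\<And>b. b \<in> B \<Longrightarrow> norm b = 1" and span: "span B = UNIV"
  shows "distr (Pi\<^sub>M B (\<lambda>_. lborel)) borel (\<lambda>t. \<Sum>b\<in>B. t b *\<^sub>R b) = (lborel :: ('a) measure)"
proof -
  have ind: "independent B"
    using orth nrm by (intro pairwise_orthogonal_independent) force+
  have fB: "finite B" and cB: "card B = DIM('a)"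
    using ind span by (simp_all add: independent_imp_finite flip: dim_UNIV dim_eq_card[of B UNIV])
  obtain g where g: "bij_betw g (Basis::('a) set) B"
    using fB cB by (metis finite_Basis finite_same_card_bij)
  define T where "T x = (\<Sum>b\<in>Basis. (x \<bullet> b) *\<^sub>R g b)" for x :: "'a"
  have gB: "b \<in> Basis \<Longrightarrow> g b \<in> B" for b using g by (auto simp: bij_betw_def)
  have gin: "g b \<bullet> g b' = (if b = b' then 1 else 0)" if "b \<in> Basis" "b' \<in> Basis" for b b'
  proof (cases "b = b'")
    case False
    then have "g b \<noteq> g b'" using g that by (auto simp: bij_betw_def inj_on_def)
    then show ?thesis
      using False orth gB[OF that(1)] gB[OF that(2)] by (auto simp: pairwise_def orthogonal_def)
  qed (use nrm[OF gB[OF that(1)]] in \<open>simp add: norm_eq_1\<close>)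
  have linT: "linear T"
    unfolding T_def by (intro linearI) (simp_all add: inner_simps algebra_simps sum.distrib scaleR_sum_right)
  have oT: "orthogonal_transformation T"
    unfolding orthogonal_transformation_def
  proof (intro conjI linT allI)
    fix v w
    have "T v \<bullet> T w = (\<Sum>b\<in>Basis. \<Sum>b'\<in>Basis. (v \<bullet> b) * (w \<bullet> b') * (g b \<bullet> g b'))"
      unfolding T_def inner_sum_left inner_sum_right
      by (subst sum.swap) (simp add: mult_ac)
    also have "\<dots> = (\<Sum>b\<in>Basis. \<Sum>b'\<in>Basis. if b = b' then (v \<bullet> b) * (w \<bullet> b') else 0)"
      by (intro sum.cong refl) (simp add: gin)
    also have "\<dots> = v \<bullet> w" by (simp add: euclidean_inner[of v w])
    finally show "T v \<bullet> T w = v \<bullet> w" .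
  qed
  have [measurable]: "T \<in> borel_measurable borel"
    using linT by (simp add: linear_continuous_on linear_linear borel_measurable_continuous_onI)
  have [measurable]: "(\<lambda>t. \<lambda>i\<in>Basis. t (g i)) \<in> Pi\<^sub>M B (\<lambda>_. lborel) \<rightarrow>\<^sub>M Pi\<^sub>M (Basis::('a) set) (\<lambda>_. lborel::real measure)"
    using gB by measurable
  have "(lborel :: ('a) measure) = distr lborel borel T"
    by (simp add: distr_orthogonal_lborel[OF oT])
  also have "\<dots> = distr (distr (distr (Pi\<^sub>M B (\<lambda>_. lborel)) (Pi\<^sub>M Basis (\<lambda>_. lborel)) (\<lambda>t. \<lambda>i\<in>Basis. t (g i)))
      borel (\<lambda>f. \<Sum>b\<in>Basis. f b *\<^sub>R b)) borel T"
    by (simp add: distr_PiM_reindex_lborel[OF _ g] lborel_eq[symmetric])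
  also have "\<dots> = distr (Pi\<^sub>M B (\<lambda>_. lborel)) borel (\<lambda>t. T (\<Sum>b\<in>Basis. (\<lambda>i\<in>Basis. t (g i)) b *\<^sub>R b))"
    by (subst distr_distr, measurable)+ (simp add: comp_def)
  also have "(\<lambda>t. T (\<Sum>b\<in>Basis. (\<lambda>i\<in>Basis. t (g i)) b *\<^sub>R b)) = (\<lambda>t. \<Sum>b\<in>B. t b *\<^sub>R b)"
  proof
    fix t :: "'a \<Rightarrow> real"
    have "T (\<Sum>b\<in>Basis. (\<lambda>i\<in>Basis. t (g i)) b *\<^sub>R b) = (\<Sum>b\<in>Basis. t (g b) *\<^sub>R g b)"
      unfolding T_def by (intro sum.cong refl) (simp add: inner_sum_left inner_Basis if_distrib cong: if_cong)
    also have "\<dots> = (\<Sum>b\<in>B. t b *\<^sub>R b)" by (rule sum.reindex_bij_betw[OF g])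
    finally show "T (\<Sum>b\<in>Basis. (\<lambda>i\<in>Basis. t (g i)) b *\<^sub>R b) = (\<Sum>b\<in>B. t b *\<^sub>R b)" .
  qed
  finally show ?thesis ..
qed

subsection \<open>Integrals over cones\<close>

lemma span_hyperplane_complement:
  fixes \<nu> :: "'a::euclidean_space"
  assumes n1: "norm \<nu> = 1" and S: "span B = {z. \<nu> \<bullet> z = 0}"
  shows "span (insert \<nu> B) = UNIV"
proof -
  have "x \<in> span (insert \<nu> B)" for x
  proof -
    have "x - (\<nu> \<bullet> x) *\<^sub>R \<nu> \<in> span B"
      using n1 by (simp add: S inner_diff_right norm_eq_1)
    then have "x - (\<nu> \<bullet> x) *\<^sub>R \<nu> \<in> span (insert \<nu> B)"
      using span_mono[of B "insert \<nu> B"] by blast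
    moreover have "(\<nu> \<bullet> x) *\<^sub>R \<nu> \<in> span (insert \<nu> B)"
      by (intro span_mul span_base) simp
    ultimately have "x - (\<nu> \<bullet> x) *\<^sub>R \<nu> + (\<nu> \<bullet> x) *\<^sub>R \<nu> \<in> span (insert \<nu> B)"
      by (rule span_add)
    then show ?thesis by simp
  qed
  then show ?thesis by blast
qed

lemma hyperplane_differences:
  fixes \<nu> :: "'a::euclidean_space"
  assumes n1: "norm \<nu> = 1"
  shows "{x - y |x y. x \<in> {x. \<nu> \<bullet> (x - p) = d} \<and> y \<in> {x. \<nu> \<bullet> (x - p) = d}} = {z. \<nu> \<bullet> z = 0}"
proof (intro set_eqI iffI)
  fix z assume "z \<in> {z. \<nu> \<bullet> z = 0}"
  then have "z = (p + d *\<^sub>R \<nu> + z) - (p + d *\<^sub>R \<nu>)" "\<nu> \<bullet> ((p + d *\<^sub>R \<nu> + z) - p) = d"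
      "\<nu> \<bullet> ((p + d *\<^sub>R \<nu>) - p) = d"
    using n1 by (auto simp: inner_simps norm_eq_1)
  then show "z \<in> {x - y |x y. x \<in> {x. \<nu> \<bullet> (x - p) = d} \<and> y \<in> {x. \<nu> \<bullet> (x - p) = d}}"
    by blast
qed (auto simp: inner_simps)

lemma orthonormal_frame_hyperplane:
  fixes \<nu> :: "'a::euclidean_space"
  assumes n1: "norm \<nu> = 1" and B: "orthonormal_frame {x. \<nu> \<bullet> (x - p) = d} B"
  shows "span B = {z. \<nu> \<bullet> z = 0}" "finite B" "\<And>b. b \<in> B \<Longrightarrow> \<nu> \<bullet> b = 0" "\<nu> \<notin> B"
    "pairwise orthogonal (insert \<nu> B)" "\<And>b. b \<in> insert \<nu> B \<Longrightarrow> norm b = 1"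
    "card B = DIM('a) - 1"
proof -
  show S: "span B = {z. \<nu> \<bullet> z = 0}"
    using B unfolding orthonormal_frame_def hyperplane_differences[OF n1] by simp
  have orth: "pairwise orthogonal B" and nrm: "\<And>b. b \<in> B \<Longrightarrow> norm b = 1"
    using B by (auto simp: orthonormal_frame_def)
  show nb: "\<nu> \<bullet> b = 0" if "b \<in> B" for b
    using span_base[OF that] S by auto
  show nB: "\<nu> \<notin> B" using nb[of \<nu>] n1 by (auto simp: norm_eq_1)
  show po: "pairwise orthogonal (insert \<nu> B)"
    using orth nb by (auto simp: pairwise_insert orthogonal_def inner_commute)
  show nr: "norm b = 1" if "b \<in> insert \<nu> B" for b
    using that nrm n1 by auto
  have ind: "independent (insert \<nu> B)"
    using po nr by (intro pairwise_orthogonal_independent) force+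
  then have fi: "finite (insert \<nu> B)" by (rule independent_imp_finite)
  then show "finite B" by simp
  have "card (insert \<nu> B) = DIM('a)"
    using ind span_hyperplane_complement[OF n1 S] by (simp flip: dim_UNIV dim_eq_card[of "insert \<nu> B" UNIV])
  then show "card B = DIM('a) - 1" using nB fi by simp
qed

lemma orthonormal_frame_exists:
  fixes \<nu> :: "'a::euclidean_space"
  assumes n1: "norm \<nu> = 1"
  shows "\<exists>B. orthonormal_frame {x. \<nu> \<bullet> (x - p) = d} B"
proof -
  obtain B where "B \<subseteq> {z. \<nu> \<bullet> z = 0}" "pairwise orthogonal B" "\<And>x. x \<in> B \<Longrightarrow> norm x = 1"
     "independent B" "card B = dim {z. \<nu> \<bullet> z = 0}" and S: "span B = {z. \<nu> \<bullet> z = 0}"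
    using orthonormal_basis_subspace[OF subspace_hyperplane[of \<nu>]] by blast
  then show ?thesis unfolding orthonormal_frame_def hyperplane_differences[OF n1] by (intro exI[of _ B]) auto
qed

text \<open>The choices hidden in the definition of the face measure are opened here once;
  afterwards only the membership of \<open>q\<close> and the frame property of \<open>B\<close> are
  used.\<close>

lemma affine_lborel_hyperplane:
  fixes \<nu> p :: "'a::euclidean_space" and d :: real
  assumes n1: "norm \<nu> = 1"
  defines "H \<equiv> {x. \<nu> \<bullet> (x - p) = d}"
  obtains q B where "q \<in> H" "orthonormal_frame H B"
    "affine_lborel H = distr (Pi\<^sub>M B (\<lambda>_. lborel)) borel (\<lambda>t. q + (\<Sum>b\<in>B. t b *\<^sub>R b))"
proof -
  have "p + d *\<^sub>R \<nu> \<in> H" using n1 by (simp add: H_def norm_eq_1)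
  then have "(SOME q. q \<in> H) \<in> H" by (rule someI)
  moreover have "orthonormal_frame H (SOME B. orthonormal_frame H B)"
    using someI_ex[OF orthonormal_frame_exists[OF n1]] unfolding H_def .
  ultimately show ?thesis using that by (simp add: affine_lborel_def Let_def)
qed

text \<open>Fubini in the orthonormal basis \<open>insert \<nu> B\<close> with origin
  \<open>p\<close>, splitting off the coordinate along \<open>\<nu>\<close>, so that
  \<open>r\<close> is the height above \<open>p\<close>.\<close>

lemma nn_integral_lborel_hyperplane_slices:
  fixes \<nu> p :: "'a::euclidean_space"
  assumes n1: "norm \<nu> = 1" and B: "orthonormal_frame {x. \<nu> \<bullet> (x - p) = d} B"
    and h[measurable]: "h \<in> borel_measurable borel"
  shows "(\<integral>\<^sup>+x. h x \<partial>lborel)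
    = (\<integral>\<^sup>+r. (\<integral>\<^sup>+t. h (p + r *\<^sub>R \<nu> + (\<Sum>b\<in>B. t b *\<^sub>R b)) \<partial>Pi\<^sub>M B (\<lambda>_. lborel)) \<partial>lborel)"
proof -
  note fr = orthonormal_frame_hyperplane[OF n1 B]
  have "(\<integral>\<^sup>+x. h x \<partial>lborel) = (\<integral>\<^sup>+x. h (p + x) \<partial>lborel)"
    using nn_integral_lborel_shift[OF h, of 1 p] by simp
  also have "\<dots> = (\<integral>\<^sup>+x. h (p + x) \<partial>distr (Pi\<^sub>M (insert \<nu> B) (\<lambda>_. lborel)) borel (\<lambda>t. \<Sum>b\<in>insert \<nu> B. t b *\<^sub>R b))"
    using lborel_eq_distr_orthonormal[OF fr(5) fr(6) span_hyperplane_complement[OF n1 fr(1)]] by simp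
  also have "\<dots> = (\<integral>\<^sup>+t. h (p + (\<Sum>b\<in>insert \<nu> B. t b *\<^sub>R b)) \<partial>Pi\<^sub>M (insert \<nu> B) (\<lambda>_. lborel))"
    by (subst nn_integral_distr) simp_all
  also have "\<dots> = (\<integral>\<^sup>+r. (\<integral>\<^sup>+t. h (p + (\<Sum>b\<in>insert \<nu> B. (t(\<nu> := r)) b *\<^sub>R b)) \<partial>Pi\<^sub>M B (\<lambda>_. lborel)) \<partial>lborel)"
    using fr by (subst lborel_product.product_nn_integral_insert_rev) simp_all
  also have "(\<lambda>t r. p + (\<Sum>b\<in>insert \<nu> B. (t(\<nu> := r)) b *\<^sub>R b)) = (\<lambda>t r. p + r *\<^sub>R \<nu> + (\<Sum>b\<in>B. t b *\<^sub>R b))"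
  proof (intro ext)
    fix t :: "'a \<Rightarrow> real" and r
    have "(\<Sum>b\<in>B. (t(\<nu> := r)) b *\<^sub>R b) = (\<Sum>b\<in>B. t b *\<^sub>R b)"
      using fr by (intro sum.cong) auto
    then show "p + (\<Sum>b\<in>insert \<nu> B. (t(\<nu> := r)) b *\<^sub>R b) = p + r *\<^sub>R \<nu> + (\<Sum>b\<in>B. t b *\<^sub>R b)"
      using fr by simp
  qed
  finally show ?thesis by (simp add: fun_eq_iff)
qed

text \<open>The radial integral of the cone formula: \<open>m\<close> will be
  \<open>DIM('a) - 1\<close>, from the scaling of slices, plus the degree \<open>k\<close> of the
  integrand, which yields the factor \<open>d / (DIM('a) + k)\<close>.\<close>

lemma nn_integral_power_Ioo:
  assumes "d > 0"
  shows "(\<integral>\<^sup>+r. indicator {0<..<d} r * ennreal ((r/d)^m) \<partial>lborel) = ennreal (d / real (Suc m))"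
proof -
  have "(\<integral>\<^sup>+r. indicator {0<..<d} r * ennreal ((r/d)^m) \<partial>lborel)
      = (\<integral>\<^sup>+r. ennreal ((r/d)^m) * indicator {0..d} r \<partial>lborel)"
  proof (rule nn_integral_cong_AE)
    show "AE r in lborel. indicator {0<..<d} r * ennreal ((r/d)^m) = ennreal ((r/d)^m) * indicator {0..d} r"
      using AE_lborel_singleton[of 0] AE_lborel_singleton[of d]
      by eventually_elim (auto simp: indicator_def)
  qed
  also have "\<dots> = ennreal (d / real (Suc m) * (d/d)^(Suc m) - d / real (Suc m) * (0/d)^(Suc m))"
  proof (rule nn_integral_FTC_Icc)
    fix x assume "x \<in> {0..d}"
    show "((\<lambda>r. d / real (Suc m) * (r/d)^(Suc m)) has_real_derivative (x/d)^m) (at x)"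
    proof -
      have "((\<lambda>r. d / real (Suc m) * (r/d)^(Suc m)) has_real_derivative
          d / real (Suc m) * (real (Suc m) * (x/d)^m * (1/d))) (at x)"
        using DERIV_power_Suc[where n=m, OF DERIV_cdivide[where c=d, OF DERIV_ident]]
        by (intro DERIV_cmult) (simp add: mult_ac)
      then show ?thesis
        using assms by (simp del: power_Suc)
    qed
  qed (use assms in auto)
  finally show ?thesis using assms by simp
qed

text \<open>Heights above \<open>p\<close> scale linearly along rays, so a point at height
  \<open>r\<close> can only have the ray parameter \<open>r / d\<close>. The existential description
  of the cone thus becomes an explicit formula, from which measurability and the shape of the slices
  are read off.\<close>

lemma open_cone_iff:
  assumes d: "d > 0" and \<sigma>: "\<sigma> \<subseteq> {x. \<nu> \<bullet> (x - p) = d}" and r: "\<nu> \<bullet> (x - p) = r"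
  shows "x \<in> open_cone p \<sigma> \<longleftrightarrow> 0 < r \<and> r < d \<and> p + (d / r) *\<^sub>R (x - p) \<in> \<sigma>"
proof
  assume "x \<in> open_cone p \<sigma>"
  then obtain t y where x: "x = p + t *\<^sub>R (y - p)" "0 < t" "t < 1" "y \<in> \<sigma>"
    by (auto simp: open_cone_def)
  then have "\<nu> \<bullet> (y - p) = d" using \<sigma> by auto
  then have "r = t * d" using x r by auto
  then show "0 < r \<and> r < d \<and> p + (d / r) *\<^sub>R (x - p) \<in> \<sigma>"
    using d x by auto
next
  assume a: "0 < r \<and> r < d \<and> p + (d / r) *\<^sub>R (x - p) \<in> \<sigma>"
  moreover have "x = p + (r/d) *\<^sub>R ((p + (d / r) *\<^sub>R (x - p)) - p)"
    using a d by simp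
  ultimately show "x \<in> open_cone p \<sigma>"
    unfolding open_cone_def using d
    by (intro CollectI exI[of _ "r/d"] exI[of _ "p + (d / r) *\<^sub>R (x - p)"]) auto
qed

lemma borel_open_cone:
  assumes d: "d > 0" and \<sigma>: "\<sigma> \<subseteq> {x. \<nu> \<bullet> (x - p) = d}" and [measurable]: "\<sigma> \<in> sets borel"
  shows "open_cone p \<sigma> \<in> sets borel"
proof -
  have "open_cone p \<sigma> = {x \<in> space borel. 0 < \<nu> \<bullet> (x - p) \<and> \<nu> \<bullet> (x - p) < d \<and>
      p + (d / (\<nu> \<bullet> (x - p))) *\<^sub>R (x - p) \<in> \<sigma>}"
    using open_cone_iff[OF d \<sigma> refl] by auto
  also have "\<dots> \<in> sets borel" by measurable
  finally show ?thesis .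
qed

text \<open>The slice at height \<open>r\<close> is the face dilated by \<open>r / d\<close>: its
  area scales with the power \<open>DIM('a) - 1\<close> and the integrand with the power
  \<open>k\<close>, and the heights are then integrated over \<open>(0, d)\<close>. With nonnegative
  integrals no finiteness of the face measure has to be known beforehand.\<close>

lemma nn_integral_open_cone:
  fixes \<nu> p :: "'a::euclidean_space"
  assumes n1: "norm \<nu> = 1" and d: "d > 0" and \<sigma>: "\<sigma> \<subseteq> {x. \<nu> \<bullet> (x - p) = d}"
    and \<sigma>_borel[measurable]: "\<sigma> \<in> sets borel"
    and f[measurable]: "f \<in> borel_measurable borel"
    and hom: "\<And>y t. 0 < t \<Longrightarrow> t < 1 \<Longrightarrow> f (p + t *\<^sub>R (y - p)) = ennreal (t ^ k) * f y"
  shows "(\<integral>\<^sup>+x. indicator (open_cone p \<sigma>) x * f x \<partial>lborel)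
    = ennreal (d / real (DIM('a) + k)) *
      (\<integral>\<^sup>+y. indicator \<sigma> y * f y \<partial>affine_lborel {x. \<nu> \<bullet> (x - p) = d})"
proof -
  let ?H = "{x. \<nu> \<bullet> (x - p) = d}" and ?C = "open_cone p \<sigma>"
  obtain q B where q: "q \<in> ?H" and B: "orthonormal_frame ?H B"
    and M: "affine_lborel ?H = distr (Pi\<^sub>M B (\<lambda>_. lborel)) borel (\<lambda>t. q + (\<Sum>b\<in>B. t b *\<^sub>R b))"
    using affine_lborel_hyperplane[OF n1] by blast
  note fr = orthonormal_frame_hyperplane[OF n1 B]
  have C[measurable]: "?C \<in> sets borel" by (rule borel_open_cone[OF d \<sigma>]) fact
  let ?P = "Pi\<^sub>M B (\<lambda>_. lborel :: real measure)" and ?S = "\<lambda>t. \<Sum>b\<in>B. t b *\<^sub>R b"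
  let ?I = "\<integral>\<^sup>+y. indicator \<sigma> y * f y \<partial>affine_lborel ?H"
  have I: "?I = (\<integral>\<^sup>+t. indicator \<sigma> (q + ?S t) * f (q + ?S t) \<partial>?P)"
    unfolding M by (subst nn_integral_distr) simp_all
  have nS: "\<nu> \<bullet> ?S t = 0" for t
    using fr(3) by (simp add: inner_sum_right)
  \<comment> \<open>The origin \<open>q\<close> underlying the face measure need not be the foot
    \<open>p + d *\<^sub>R \<nu>\<close> of the perpendicular; \<open>w\<close> is the offset inside
    the hyperplane and causes the shift \<open>c * (w \<bullet> b)\<close> in the substitution
    below.\<close>
  define w where "w = q - p - d *\<^sub>R \<nu>"
  have wB: "w \<in> span B"
    using q n1 by (simp add: fr(1) w_def inner_diff_right norm_eq_1)
  have w: "(\<Sum>b\<in>B. (w \<bullet> b) *\<^sub>R b) = w"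
    using fr by (intro orthonormal_basis_expand wB) (auto simp: pairwise_insert)
  have slice: "(\<integral>\<^sup>+t. indicator ?C (p + r *\<^sub>R \<nu> + ?S t) * f (p + r *\<^sub>R \<nu> + ?S t) \<partial>?P)
      = indicator {0<..<d} r * ennreal ((r/d) ^ (DIM('a) - 1 + k)) * ?I" for r
  proof (cases "0 < r \<and> r < d")
    case False
    have "p + r *\<^sub>R \<nu> + ?S t \<notin> ?C" for t
      using open_cone_iff[OF d \<sigma>, of "p + r *\<^sub>R \<nu> + ?S t" r] False n1 nS
      by (auto simp: inner_simps norm_eq_1)
    then show ?thesis using False by auto
  next
    case True
    define c where "c = r / d"
    have c: "0 < c" "c < 1" "c \<noteq> 0" using True d by (auto simp: c_def)
    have sub: "p + r *\<^sub>R \<nu> + ?S (\<lambda>b\<in>B. c * (w \<bullet> b) + c * t b) = p + c *\<^sub>R (q + ?S t - p)" for t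
    proof -
      have "?S (\<lambda>b\<in>B. c * (w \<bullet> b) + c * t b) = (\<Sum>b\<in>B. c *\<^sub>R ((w \<bullet> b) *\<^sub>R b) + c *\<^sub>R (t b *\<^sub>R b))"
        by (intro sum.cong) (auto simp: scaleR_add_left)
      also have "\<dots> = c *\<^sub>R (w + ?S t)"
        by (simp only: sum.distrib scaleR_sum_right[symmetric] w scaleR_add_right)
      finally show ?thesis using d by (simp add: c_def w_def algebra_simps)
    qed
    have mem: "p + c *\<^sub>R (q + ?S t - p) \<in> ?C \<longleftrightarrow> q + ?S t \<in> \<sigma>" for t
    proof -
      have qd: "\<nu> \<bullet> (q + ?S t - p) = d" using q nS[of t] by (simp add: inner_simps)
      have "\<nu> \<bullet> ((p + c *\<^sub>R (q + ?S t - p)) - p) = r"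
        using d by (simp add: qd) (simp add: c_def)
      from open_cone_iff[OF d \<sigma> this] show ?thesis
        using True d by (simp add: c_def)
    qed
    have "(\<integral>\<^sup>+t. indicator ?C (p + r *\<^sub>R \<nu> + ?S t) * f (p + r *\<^sub>R \<nu> + ?S t) \<partial>?P)
      = ennreal (\<bar>c\<bar> ^ card B) * (\<integral>\<^sup>+t. indicator ?C (p + c *\<^sub>R (q + ?S t - p)) * f (p + c *\<^sub>R (q + ?S t - p)) \<partial>?P)"
      by (subst nn_integral_PiM_lborel_affine[OF fr(2) c(3), where \<tau> = "\<lambda>b. c * (w \<bullet> b)"])
         (simp_all only: sub, measurable)
    also have "\<dots> = ennreal (c ^ card B) * (\<integral>\<^sup>+t. ennreal (c ^ k) * (indicator \<sigma> (q + ?S t) * f (q + ?S t)) \<partial>?P)"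
    proof -
      have "indicator ?C (p + c *\<^sub>R (q + ?S t - p)) * f (p + c *\<^sub>R (q + ?S t - p))
        = ennreal (c ^ k) * (indicator \<sigma> (q + ?S t) * f (q + ?S t))" for t
        using c by (simp add: hom indicator_def mem)
      then show ?thesis using c by simp
    qed
    also have "\<dots> = ennreal (c ^ (DIM('a) - 1 + k)) * ?I"
      using c by (simp add: nn_integral_cmult I fr(7) ennreal_mult mult.assoc power_add del: add_Suc_right add_Suc diff_Suc_1 Nat.add_diff_assoc2)
    finally show ?thesis using True by (simp add: c_def)
  qed
  have "(\<integral>\<^sup>+x. indicator ?C x * f x \<partial>lborel) =
     (\<integral>\<^sup>+r. indicator {0<..<d} r * ennreal ((r/d) ^ (DIM('a) - 1 + k)) * ?I \<partial>lborel)"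
    by (subst nn_integral_lborel_hyperplane_slices[OF n1 B]) (simp_all add: slice)
  also have "\<dots> = ennreal (d / real (DIM('a) + k)) * ?I"
    using nn_integral_power_Ioo[OF d, of "DIM('a) - 1 + k"] DIM_positive[where 'a='a]
    by (simp add: nn_integral_multc)
  finally show ?thesis .
qed

lemma sets_affine_lborel [simp, measurable_cong]: "sets (affine_lborel H) = sets borel"
  by (simp add: affine_lborel_def Let_def)

text \<open>Positive and negative parts are homogeneous of the same degree, so the nonnegative
  formula applies to each. As its factor is positive and finite, integrability passes from the cone,
  where it is easy to check, to the face.\<close>

lemma integral_open_cone:
  fixes \<nu> p :: "'a::euclidean_space" and f :: "'a \<Rightarrow> real"
  assumes n1: "norm \<nu> = 1" and d: "d > 0" and \<sigma>: "\<sigma> \<subseteq> {x. \<nu> \<bullet> (x - p) = d}"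
    and \<sigma>_borel[measurable]: "\<sigma> \<in> sets borel"
    and f[measurable]: "f \<in> borel_measurable borel"
    and hom: "\<And>y t. 0 < t \<Longrightarrow> t < 1 \<Longrightarrow> f (p + t *\<^sub>R (y - p)) = t ^ k * f y"
    and int: "set_integrable lborel (open_cone p \<sigma>) f"
  shows "set_integrable (affine_lborel {x. \<nu> \<bullet> (x - p) = d}) \<sigma> f"
    and "(LINT x:open_cone p \<sigma>|lborel. f x)
      = d / real (DIM('a) + k) * (LINT y:\<sigma>|affine_lborel {x. \<nu> \<bullet> (x - p) = d}. f y)"
proof -
  let ?M = "affine_lborel {x. \<nu> \<bullet> (x - p) = d}" and ?C = "open_cone p \<sigma>"
  let ?c = "d / real (DIM('a) + k)"
  have c: "?c > 0" using d DIM_positive[where 'a='a] by (simp add: add_pos_nonneg)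
  have C[measurable]: "?C \<in> sets borel" by (rule borel_open_cone[OF d \<sigma>]) fact
  have ind: "ennreal (indicator A x * a) = indicator A x * ennreal a" for A and x :: 'a and a
    by (auto simp: indicator_def)
  have pos: "(\<integral>\<^sup>+x. ennreal (indicator ?C x * f x) \<partial>lborel) = ennreal ?c * (\<integral>\<^sup>+y. ennreal (indicator \<sigma> y * f y) \<partial>?M)"
    unfolding ind using hom by (intro nn_integral_open_cone[OF n1 d \<sigma>]) (simp_all add: ennreal_mult')
  have neg: "(\<integral>\<^sup>+x. ennreal (- (indicator ?C x * f x)) \<partial>lborel) = ennreal ?c * (\<integral>\<^sup>+y. ennreal (- (indicator \<sigma> y * f y)) \<partial>?M)"
    unfolding mult_minus_right[symmetric] ind
    by (rule nn_integral_open_cone[OF n1 d \<sigma>]) (simp_all add: hom ennreal_mult'[symmetric])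
  have iC: "integrable lborel (\<lambda>x. indicator ?C x * f x)"
    using int by (simp add: set_integrable_def)
  have i\<sigma>: "integrable ?M (\<lambda>x. indicator \<sigma> x * f x)"
    using iC c by (auto simp: real_integrable_def pos neg ennreal_mult_eq_top_iff)
  then show "set_integrable ?M \<sigma> f" by (simp add: set_integrable_def)
  show "(LINT x:?C|lborel. f x) = ?c * (LINT y:\<sigma>|?M. f y)"
    unfolding set_lebesgue_integral_def real_scaleR_def
      real_lebesgue_integral_def[OF iC] real_lebesgue_integral_def[OF i\<sigma>] pos neg
    using c by (simp add: enn2real_mult right_diff_distrib)
qed

subsection \<open>Star-shaped cells\<close>

lemma infdist_hyperplane_ge:
  fixes \<nu> p :: "'a::euclidean_space"
  assumes "norm \<nu> = 1" "c \<ge> 0"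
  shows "infdist p {x. \<nu> \<bullet> (x - p) = c} = c"
proof (rule antisym)
  have "p + c *\<^sub>R \<nu> \<in> {x. \<nu> \<bullet> (x - p) = c}" using assms by (simp add: norm_eq_1)
  from infdist_le[OF this, of p] show "infdist p {x. \<nu> \<bullet> (x - p) = c} \<le> c"
    using assms by (simp add: dist_norm)
  have "{x. \<nu> \<bullet> (x - p) = c} \<noteq> {}" using \<open>p + c *\<^sub>R \<nu> \<in> _\<close> by blast
  moreover have "c \<le> dist p x" if "x \<in> {x. \<nu> \<bullet> (x - p) = c}" for x
    using norm_cauchy_schwarz[of \<nu> "x - p"] that assms by (simp add: dist_norm norm_minus_commute)
  ultimately show "c \<le> infdist p {x. \<nu> \<bullet> (x - p) = c}"
    by (auto simp: infdist_notempty intro!: cINF_greatest)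
qed

locale star_cell =
  fixes K :: "'a::euclidean_space set" and \<E> :: "'a set set" and n :: "'a set \<Rightarrow> 'a" and p :: 'a
  assumes cell: "polytopal_cell K \<E>"
    and normals: "\<forall>\<sigma>\<in>\<E>. outward_unit_normal K \<sigma> (n \<sigma>)"
    and star: "star_shaped_wrt p K"
    and dist_pos: "\<forall>\<sigma>\<in>\<E>. face_dist p \<sigma> > 0"
    and cones: "negligible (K - (\<Union>\<sigma>\<in>\<E>. open_cone p \<sigma>))"
begin

lemma open_K: "open K" and bounded_K: "bounded K" and K_ne: "K \<noteq> {}" and finite_E: "finite \<E>"
  and frontier_K: "frontier K = (\<Union>\<sigma>\<in>\<E>. closure \<sigma>)"
  and disjoint_E: "pairwise disjnt \<E>"
  using cell by (auto simp: polytopal_cell_def)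

lemma p_in_K: "p \<in> K"
  using star by (simp add: star_shaped_wrt_def)

lemma star_contract:
  assumes "x \<in> K" "0 \<le> s" "s \<le> 1"
  shows "p + s *\<^sub>R (x - p) \<in> K"
proof -
  have "p + s *\<^sub>R (x - p) \<in> closed_segment p x"
    using assms by (auto simp: in_segment algebra_simps intro!: exI[of _ s])
  then show ?thesis using star assms by (auto simp: star_shaped_wrt_def)
qed

lemma face_subset_frontier: "\<sigma> \<in> \<E> \<Longrightarrow> \<sigma> \<subseteq> frontier K"
  unfolding frontier_K using closure_subset by blast

lemma face_disjoint: "\<sigma> \<in> \<E> \<Longrightarrow> y \<in> \<sigma> \<Longrightarrow> y \<notin> K"
  using face_subset_frontier[of \<sigma>] open_K by (auto simp: frontier_def interior_open)

lemma norm_normal: "\<sigma> \<in> \<E> \<Longrightarrow> norm (n \<sigma>) = 1"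
  using normals by (auto simp: outward_unit_normal_def)

lemma normal_orthogonal:
  assumes "\<sigma> \<in> \<E>" "x \<in> \<sigma>" "y \<in> \<sigma>" shows "n \<sigma> \<bullet> (x - y) = 0"
proof -
  have "\<forall>x\<in>\<sigma>. \<forall>y\<in>\<sigma>. n \<sigma> \<bullet> (x - y) = 0"
    using bspec[OF normals assms(1)] unfolding outward_unit_normal_def by (elim conjE)
  then show ?thesis using assms by blast
qed

lemma inward_points:
  assumes "\<sigma> \<in> \<E>" "x \<in> \<sigma>" shows "\<exists>\<epsilon>>0. \<forall>t. 0 < t \<and> t < \<epsilon> \<longrightarrow> x - t *\<^sub>R n \<sigma> \<in> K"
proof -
  have "\<forall>x\<in>\<sigma>. \<exists>\<epsilon>>0. \<forall>t. 0 < t \<and> t < \<epsilon> \<longrightarrow> x - t *\<^sub>R n \<sigma> \<in> K \<and> x + t *\<^sub>R n \<sigma> \<notin> K"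
    using bspec[OF normals assms(1)] unfolding outward_unit_normal_def by (elim conjE)
  from bspec[OF this assms(2)] show ?thesis by meson
qed

text \<open>A nonempty relatively open part of a hyperplane spans it affinely. The hyperplane
  through \<open>y0\<close> with normal \<open>n \<sigma>\<close> contains the face, hence its
  affine hull, and the two have equal dimension.\<close>

lemma face_hyperplane_aux:
  assumes \<sigma>: "\<sigma> \<in> \<E>" and y0: "y0 \<in> \<sigma>"
  shows "affine hull \<sigma> = {x. n \<sigma> \<bullet> x = n \<sigma> \<bullet> y0}"
    and "openin (top_of_set {x. n \<sigma> \<bullet> x = n \<sigma> \<bullet> y0}) \<sigma>"
proof -
  obtain a b where ab: "a \<noteq> 0" "openin (top_of_set {x. a \<bullet> x = b}) \<sigma>"
    using cell \<sigma> unfolding polytopal_cell_def by blast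
  have aH: "affine hull {x. a \<bullet> x = b} = {x. a \<bullet> x = b}"
    by (simp add: affine_hyperplane affine_hull_eq)
  have H: "affine hull \<sigma> = {x. a \<bullet> x = b}"
    using affine_hull_openin[of "{x. a \<bullet> x = b}" \<sigma>] ab y0 unfolding aH by auto
  have n: "n \<sigma> \<noteq> 0" using norm_normal[OF \<sigma>] by auto
  have "\<sigma> \<subseteq> {x. n \<sigma> \<bullet> x = n \<sigma> \<bullet> y0}"
    using normal_orthogonal[OF \<sigma> _ y0] by (auto simp: inner_diff_right)
  then have "affine hull \<sigma> \<subseteq> {x. n \<sigma> \<bullet> x = n \<sigma> \<bullet> y0}"
    by (intro hull_minimal affine_hyperplane)
  then have sub: "{x. a \<bullet> x = b} \<subseteq> {x. n \<sigma> \<bullet> x = n \<sigma> \<bullet> y0}" by (simp add: H)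
  have "y0 \<in> {x. a \<bullet> x = b}" using y0 H hull_inc[of y0 \<sigma> affine] by simp
  then have ne: "{x. a \<bullet> x = b} \<noteq> {}" by blast
  have "{x. a \<bullet> x = b} = {x. n \<sigma> \<bullet> x = n \<sigma> \<bullet> y0}"
    using ab n by (intro affine_dim_equal[OF affine_hyperplane affine_hyperplane ne sub]) (simp add: aff_dim_hyperplane)
  then show eq: "affine hull \<sigma> = {x. n \<sigma> \<bullet> x = n \<sigma> \<bullet> y0}"
    using H by simp
  show "openin (top_of_set {x. n \<sigma> \<bullet> x = n \<sigma> \<bullet> y0}) \<sigma>"
    using ab(2) eq H by simp
qed

text \<open>If the height \<open>c\<close> of the face over \<open>p\<close> were negative, an
  interior point just inside \<open>y0\<close> would have height \<open>c - t\<close>, farther from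
  \<open>p\<close> than the face. Contracting it towards \<open>p\<close> until its height is
  \<open>c\<close> would reach a point of the face near \<open>y0\<close> that lies in
  \<open>K\<close> by star-shapedness, whereas faces are disjoint from \<open>K\<close>. The case
  \<open>c = 0\<close> is excluded by the positive distance.\<close>

lemma normal_pos:
  assumes \<sigma>: "\<sigma> \<in> \<E>" and y0: "y0 \<in> \<sigma>"
  shows "n \<sigma> \<bullet> (y0 - p) > 0"
proof (rule ccontr)
  define c where "c = n \<sigma> \<bullet> (y0 - p)"
  assume "\<not> n \<sigma> \<bullet> (y0 - p) > 0"
  moreover have "c \<noteq> 0"
  proof
    assume "c = 0"
    then have "p \<in> affine hull \<sigma>"
      using face_hyperplane_aux(1)[OF assms] by (simp add: c_def inner_diff_right)
    then show False using dist_pos \<sigma> by (auto simp: face_dist_def)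
  qed
  ultimately have c: "c < 0" by (simp add: c_def)
  have nn: "n \<sigma> \<bullet> n \<sigma> = 1" using norm_normal[OF \<sigma>] by (simp add: norm_eq_1)
  have "\<exists>e>0. \<forall>x\<in>{x. n \<sigma> \<bullet> x = n \<sigma> \<bullet> y0}. dist x y0 < e \<longrightarrow> x \<in> \<sigma>"
    using face_hyperplane_aux(2)[OF assms] y0 by (simp add: openin_euclidean_subtopology_iff)
  then obtain e where e: "e > 0" "\<And>x. dist x y0 < e \<Longrightarrow> n \<sigma> \<bullet> x = n \<sigma> \<bullet> y0 \<Longrightarrow> x \<in> \<sigma>"
    by auto
  obtain \<epsilon> where \<epsilon>: "\<epsilon> > 0" "\<And>t. 0 < t \<Longrightarrow> t < \<epsilon> \<Longrightarrow> y0 - t *\<^sub>R n \<sigma> \<in> K"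
    using inward_points[OF assms] by blast
  \<comment> \<open>The factor equals \<open>c / (c - t)\<close>, which lies in
    \<open>(0, 1)\<close> and brings the height \<open>c - t\<close> back to
    \<open>c\<close>.\<close>
  define z where "z t = p + (1 - t / (t - c)) *\<^sub>R (y0 - t *\<^sub>R n \<sigma> - p)" for t
  have "(z \<longlongrightarrow> p + (1 - 0 / (0 - c)) *\<^sub>R (y0 - 0 *\<^sub>R n \<sigma> - p)) (at_right 0)"
    unfolding z_def using c by (intro tendsto_intros) auto
  then have "(z \<longlongrightarrow> y0) (at_right 0)" by simp
  then have "eventually (\<lambda>t. dist (z t) y0 < e) (at_right 0)"
    using e(1) by (rule tendstoD)
  moreover have "eventually (\<lambda>t. 0 < t \<and> t < \<epsilon>) (at_right 0)"
    using \<epsilon>(1) by (auto simp: eventually_at_right_field)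
  ultimately have "eventually (\<lambda>t. 0 < t \<and> t < \<epsilon> \<and> dist (z t) y0 < e) (at_right 0)"
    by eventually_elim auto
  then obtain t where t: "0 < t" "t < \<epsilon>" "dist (z t) y0 < e"
    using eventually_happens'[of "at_right (0::real)"] by auto
  have "n \<sigma> \<bullet> (z t - p) = (1 - t / (t - c)) * (c - t)"
    by (simp add: z_def c_def inner_diff_right nn)
  also have "\<dots> = c" using t c by (simp add: field_simps)
  finally have "n \<sigma> \<bullet> z t = n \<sigma> \<bullet> y0" by (simp add: c_def inner_diff_right)
  then have "z t \<in> \<sigma>" using e t by blast
  moreover have "z t \<in> K"
    unfolding z_def using t c \<epsilon> by (intro star_contract) (auto simp: field_simps)
  ultimately show False using face_disjoint \<sigma> by blast
qed

lemma face_dist_eq: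
  assumes \<sigma>: "\<sigma> \<in> \<E>" and y: "y \<in> \<sigma>"
  shows "n \<sigma> \<bullet> (y - p) = face_dist p \<sigma>"
proof -
  have "affine hull \<sigma> = {x. n \<sigma> \<bullet> (x - p) = n \<sigma> \<bullet> (y - p)}"
    using face_hyperplane_aux(1)[OF assms] by (simp add: inner_diff_right)
  then show ?thesis
    using infdist_hyperplane_ge[OF norm_normal[OF \<sigma>], of "n \<sigma> \<bullet> (y - p)"] normal_pos[OF assms]
    by (simp add: face_dist_def)
qed

abbreviation d where "d \<equiv> face_dist p"

lemma d_pos: "\<sigma> \<in> \<E> \<Longrightarrow> d \<sigma> > 0" using dist_pos by simp

lemma face_hyperplane:
  assumes \<sigma>: "\<sigma> \<in> \<E>"
  shows "affine hull \<sigma> = {x. n \<sigma> \<bullet> (x - p) = d \<sigma>}"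
    and "openin (top_of_set {x. n \<sigma> \<bullet> (x - p) = d \<sigma>}) \<sigma>"
    and "closure \<sigma> \<subseteq> {x. n \<sigma> \<bullet> (x - p) = d \<sigma>}"
    and "\<sigma> \<subseteq> {x. n \<sigma> \<bullet> (x - p) = d \<sigma>}"
    and "\<sigma> \<in> sets borel"
proof -
  have "\<sigma> \<noteq> {}" using cell \<sigma> unfolding polytopal_cell_def by blast
  then obtain y where y: "y \<in> \<sigma>" by blast
  have eq: "{x. n \<sigma> \<bullet> x = n \<sigma> \<bullet> y} = {x. n \<sigma> \<bullet> (x - p) = d \<sigma>}"
    using face_dist_eq[OF \<sigma> y] by (auto simp: inner_diff_right)
  show 1: "affine hull \<sigma> = {x. n \<sigma> \<bullet> (x - p) = d \<sigma>}"
    and 2: "openin (top_of_set {x. n \<sigma> \<bullet> (x - p) = d \<sigma>}) \<sigma>"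
    using face_hyperplane_aux[OF \<sigma> y] eq by simp_all
  show 3: "\<sigma> \<subseteq> {x. n \<sigma> \<bullet> (x - p) = d \<sigma>}" using 1 hull_subset by metis
  have cl: "closed {x. n \<sigma> \<bullet> (x - p) = d \<sigma>}"
    by (intro closed_Collect_eq continuous_intros)
  then show "closure \<sigma> \<subseteq> {x. n \<sigma> \<bullet> (x - p) = d \<sigma>}" using 3 by (rule closure_minimal[rotated])
  from 2 obtain U where U: "open U" and eq: "\<sigma> = {x. n \<sigma> \<bullet> (x - p) = d \<sigma>} \<inter> U"
    by (auto simp: openin_open)
  show "\<sigma> \<in> sets borel"
    by (subst eq) (intro sets.Int borel_closed borel_open cl U)
qed

lemma closure_contract:
  assumes z: "z \<in> closure K" and s: "0 \<le> s" "s \<le> 1"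
  shows "p + s *\<^sub>R (z - p) \<in> closure K"
proof -
  have "(\<lambda>z. p + s *\<^sub>R (z - p)) ` closure K \<subseteq> closure K"
  proof (intro image_closure_subset continuous_intros closed_closure)
    show "(\<lambda>z. p + s *\<^sub>R (z - p)) ` K \<subseteq> closure K"
      using star_contract[OF _ s] closure_subset[of K] by blast
  qed
  then show ?thesis using z by blast
qed

text \<open>A ray from \<open>p\<close> meets each face hyperplane at most once, so a segment of it cannot lie in the
  frontier.\<close>

lemma closure_strict_contract:
  assumes z: "z \<in> closure K" and s: "0 \<le> s" "s < 1"
  shows "p + s *\<^sub>R (z - p) \<in> K"
proof (rule ccontr)
  assume nK: "p + s *\<^sub>R (z - p) \<notin> K"
  have "{s..1} \<subseteq> (\<lambda>\<sigma>. d \<sigma> / (n \<sigma> \<bullet> (z - p))) ` \<E>"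
  proof
    fix r assume r: "r \<in> {s..1}"
    have "p + r *\<^sub>R (z - p) \<notin> K"
    proof
      assume a: "p + r *\<^sub>R (z - p) \<in> K"
      show False
      proof (cases "r = 0")
        case True then show False using r s a nK by auto
      next
        case False
        have "p + (s / r) *\<^sub>R ((p + r *\<^sub>R (z - p)) - p) \<in> K"
          using r s False by (intro star_contract[OF a]) auto
        then show False using nK False by simp
      qed
    qed
    moreover have "p + r *\<^sub>R (z - p) \<in> closure K"
      using r s by (intro closure_contract[OF z]) auto
    ultimately have "p + r *\<^sub>R (z - p) \<in> frontier K"
      using open_K by (simp add: frontier_def interior_open)
    then obtain \<sigma> where \<sigma>: "\<sigma> \<in> \<E>" "p + r *\<^sub>R (z - p) \<in> closure \<sigma>" by (auto simp: frontier_K)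
    then have "r * (n \<sigma> \<bullet> (z - p)) = d \<sigma>" using face_hyperplane(3)[OF \<sigma>(1)] by auto
    moreover have "d \<sigma> \<noteq> 0" using d_pos \<sigma> by force
    ultimately have "r = d \<sigma> / (n \<sigma> \<bullet> (z - p))" by (metis mult_zero_right nonzero_mult_div_cancel_right)
    then show "r \<in> (\<lambda>\<sigma>. d \<sigma> / (n \<sigma> \<bullet> (z - p))) ` \<E>" using \<sigma> by blast
  qed
  then have "finite {s..1}" using finite_E finite_subset by blast
  then show False using s by (simp add: infinite_Icc)
qed

subsection \<open>The gauge of the cell\<close>

text \<open>The Minkowski functional of \<open>K\<close> centred at \<open>p\<close>. For a set that
  is only star-shaped it need not be subadditive, so its continuity and its Lipschitz bound need
  arguments other than convexity.\<close>

definition gauge_K :: "'a \<Rightarrow> real" where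
  "gauge_K x = Inf {t. 0 < t \<and> p + (1 / t) *\<^sub>R (x - p) \<in> K}"

lemma gauge_set_nonempty: "\<exists>t>0. p + (1 / t) *\<^sub>R (x - p) \<in> K"
proof -
  have "((\<lambda>t. p + (1 / t) *\<^sub>R (x - p)) \<longlongrightarrow> p + 0 *\<^sub>R (x - p)) at_top"
    by (intro tendsto_intros tendsto_divide_0[OF tendsto_const] filterlim_at_top_imp_at_infinity filterlim_ident)
  then have "eventually (\<lambda>t. p + (1 / t) *\<^sub>R (x - p) \<in> K) at_top"
    using open_K p_in_K by (auto dest: topological_tendstoD)
  then have "eventually (\<lambda>t. 0 < t \<and> p + (1 / t) *\<^sub>R (x - p) \<in> K) at_top"
    using eventually_gt_at_top[of 0] by eventually_elim auto
  then show ?thesis by (auto dest: eventually_happens)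
qed

lemma gauge_nonneg: "gauge_K x \<ge> 0"
  unfolding gauge_K_def using gauge_set_nonempty[of x] by (intro cInf_greatest) auto

lemma gauge_bdd: "bdd_below {t. 0 < t \<and> p + (1 / t) *\<^sub>R (x - p) \<in> K}"
  by (rule bdd_belowI[of _ 0]) auto

text \<open>Openness of \<open>K\<close> allows the parameter to be lowered slightly, so strict
  sublevel sets are exactly the dilates of \<open>K\<close>.\<close>

lemma gauge_less_iff:
  assumes t: "t > 0"
  shows "gauge_K x < t \<longleftrightarrow> p + (1 / t) *\<^sub>R (x - p) \<in> K"
proof
  assume "gauge_K x < t"
  then obtain s where s: "0 < s" "p + (1 / s) *\<^sub>R (x - p) \<in> K" "s < t"
    unfolding gauge_K_def using gauge_set_nonempty[of x] by (subst (asm) cInf_less_iff[OF _ gauge_bdd]) auto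
  have "p + (s / t) *\<^sub>R ((p + (1 / s) *\<^sub>R (x - p)) - p) \<in> K"
    using s t by (intro star_contract s) auto
  then show "p + (1 / t) *\<^sub>R (x - p) \<in> K" using s by simp
next
  assume K: "p + (1 / t) *\<^sub>R (x - p) \<in> K"
  have "((\<lambda>s. p + (1 / s) *\<^sub>R (x - p)) \<longlongrightarrow> p + (1 / t) *\<^sub>R (x - p)) (at_left t)"
    using t by (intro tendsto_intros) auto
  then have "eventually (\<lambda>s. p + (1 / s) *\<^sub>R (x - p) \<in> K) (at_left t)"
    using open_K K by (auto dest: topological_tendstoD)
  moreover have "eventually (\<lambda>s. s \<in> {0<..<t}) (at_left t)"
    using t by (intro eventually_at_left_real)
  ultimately have "eventually (\<lambda>s. 0 < s \<and> s < t \<and> p + (1 / s) *\<^sub>R (x - p) \<in> K) (at_left t)"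
    by eventually_elim auto
  then obtain s where "0 < s \<and> s < t \<and> p + (1 / s) *\<^sub>R (x - p) \<in> K"
    using eventually_happens'[of "at_left t"] by auto
  then show "gauge_K x < t"
    unfolding gauge_K_def by (intro le_less_trans[OF cInf_lower[OF _ gauge_bdd]]) auto
qed

text \<open>Any parameter larger than \<open>t\<close> contracts a point of \<open>closure K\<close>
  strictly, hence into \<open>K\<close>. Together with the strict version this identifies positive
  level sets with dilates of the frontier, so that face equations determine the gauge.\<close>

lemma gauge_le_iff:
  assumes t: "t > 0"
  shows "gauge_K x \<le> t \<longleftrightarrow> p + (1 / t) *\<^sub>R (x - p) \<in> closure K"
proof
  assume le: "gauge_K x \<le> t"
  have "((\<lambda>s. p + (1 / s) *\<^sub>R (x - p)) \<longlongrightarrow> p + (1 / t) *\<^sub>R (x - p)) (at_right t)"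
    using t by (intro tendsto_intros) auto
  moreover have "eventually (\<lambda>s. p + (1 / s) *\<^sub>R (x - p) \<in> closure K) (at_right t)"
    using eventually_at_right_less[of t]
  proof eventually_elim
    case (elim s)
    then show ?case using gauge_less_iff[of s x] le t closure_subset by fastforce
  qed
  ultimately show "p + (1 / t) *\<^sub>R (x - p) \<in> closure K"
    by (intro Lim_in_closed_set[OF closed_closure]) auto
next
  assume c: "p + (1 / t) *\<^sub>R (x - p) \<in> closure K"
  show "gauge_K x \<le> t"
  proof (rule dense_ge)
    fix s assume s: "t < s"
    have "p + (t / s) *\<^sub>R ((p + (1 / t) *\<^sub>R (x - p)) - p) \<in> K"
      using s t by (intro closure_strict_contract c) auto
    then show "gauge_K x \<le> s" using gauge_less_iff[of s x] s t by simp
  qed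
qed

lemma E_nonempty: "\<E> \<noteq> {}"
proof
  assume "\<E> = {}"
  then have "frontier K = {}" by (simp add: frontier_K)
  then show False
    using K_ne bounded_K frontier_eq_empty not_bounded_UNIV by metis
qed

lemma gauge_eq_0_imp:
  assumes "gauge_K x = 0" shows "x = p"
proof -
  obtain b where b: "\<And>y. y \<in> K \<Longrightarrow> norm (y - p) \<le> b"
    using bounded_K unfolding bounded_any_center[where a=p] by (auto simp: dist_norm norm_minus_commute)
  have "norm (x - p) \<le> b * t" if "t > 0" for t
  proof -
    have "norm ((p + (1 / t) *\<^sub>R (x - p)) - p) \<le> b"
      using gauge_less_iff[OF that, of x] that assms by (intro b) simp
    then have "norm (x - p) / t \<le> b" using that by simp
    then show ?thesis using that by (simp add: field_simps)
  qed
  moreover have "b \<ge> 0" using b[OF p_in_K] by simp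
  ultimately have "norm (x - p) \<le> 0 + e" if "e > 0" for e
    using that mult_left_mono[of "e / (b + 1)" _ b]
    by (smt (verit, best) divide_pos_pos frac_le mult.commute nonzero_mult_div_cancel_left times_divide_eq_left times_divide_eq_right)
  then have "norm (x - p) \<le> 0" by (rule field_le_epsilon)
  then show ?thesis by simp
qed

text \<open>Scaling \<open>x\<close> by the inverse of its gauge lands on the frontier, hence in the
  closure of some face, whose hyperplane equation gives the value. This holds at every point, not
  merely on the cones, as the segment argument below requires.\<close>

lemma gauge_piecewise_linear: "\<exists>\<sigma>\<in>\<E>. gauge_K x = n \<sigma> \<bullet> (x - p) / d \<sigma>"
proof (cases "gauge_K x = 0")
  case True
  then have "x = p" by (rule gauge_eq_0_imp)
  then show ?thesis using E_nonempty True by auto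
next
  case False
  define t where "t = gauge_K x"
  have t: "t > 0" using False gauge_nonneg[of x] by (simp add: t_def)
  have "p + (1 / t) *\<^sub>R (x - p) \<in> frontier K"
    using gauge_le_iff[OF t, of x] gauge_less_iff[OF t, of x] open_K
    by (simp add: t_def frontier_def interior_open)
  then obtain \<sigma> where \<sigma>: "\<sigma> \<in> \<E>" "p + (1 / t) *\<^sub>R (x - p) \<in> closure \<sigma>" by (auto simp: frontier_K)
  then have "n \<sigma> \<bullet> (x - p) / t = d \<sigma>" using face_hyperplane(3)[OF \<sigma>(1)] by auto
  then have "t = n \<sigma> \<bullet> (x - p) / d \<sigma>"
    using t d_pos[OF \<sigma>(1)] by (auto simp: field_simps)
  then show ?thesis using \<sigma> by (auto simp: t_def)
qed

text \<open>Semicontinuity from above comes from openness of \<open>K\<close>, from below from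
  openness of the complement of \<open>closure K\<close>.\<close>

lemma continuous_gauge: "continuous_on UNIV gauge_K"
proof -
  have "(gauge_K \<longlongrightarrow> gauge_K x) (at x)" for x
  proof (rule order_tendstoI)
    fix a assume "gauge_K x < a"
    moreover from this have a: "a > 0" using gauge_nonneg[of x] by linarith
    moreover have "open ((\<lambda>y. p + (1 / a) *\<^sub>R (y - p)) -` K)"
      by (intro open_vimage[OF open_K] continuous_intros)
    ultimately have "open {y. gauge_K y < a}" "x \<in> {y. gauge_K y < a}"
      by (simp_all add: gauge_less_iff vimage_def)
    then show "eventually (\<lambda>y. gauge_K y < a) (at x)"
      by (auto dest: eventually_at_in_open' simp: eventually_at_filter elim: eventually_mono)
  next
    fix a assume a: "a < gauge_K x"
    show "eventually (\<lambda>y. a < gauge_K y) (at x)"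
    proof (cases "a < 0")
      case True
      then show ?thesis using gauge_nonneg less_le_trans by (intro always_eventually) blast
    next
      case False
      \<comment> \<open>\<open>gauge_le_iff\<close> needs a positive level; the midpoint provides
        one even if \<open>a = 0\<close>.\<close>
      define b where "b = (a + gauge_K x) / 2"
      have b: "b > 0" "a < b" "b < gauge_K x" using a False by (auto simp: b_def)
      have "open ((\<lambda>y. p + (1 / b) *\<^sub>R (y - p)) -` (- closure K))"
        by (intro open_vimage continuous_intros open_Compl closed_closure)
      then have "open {y. b < gauge_K y}"
        using gauge_le_iff[OF b(1)] by (simp add: not_le[symmetric] vimage_def)
      moreover have "x \<in> {y. b < gauge_K y}" using b by simp
      ultimately have "eventually (\<lambda>y. y \<in> {y. b < gauge_K y}) (at x)"
        by (rule eventually_at_in_open')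
      then show ?thesis by (rule eventually_mono) (use b in auto)
    qed
  qed
  then show ?thesis by (simp add: continuous_on_def)
qed

text \<open>Along a segment, the sets where the gauge agrees with a given linear piece are closed by
  continuity, finitely many, and cover the segment. A function that is Lipschitz on each of finitely
  many closed sets covering an interval is Lipschitz on the interval.\<close>

lemma gauge_Lipschitz: "\<exists>L\<ge>0. \<forall>x y. \<bar>gauge_K x - gauge_K y\<bar> \<le> L * norm (x - y)"
proof -
  \<comment> \<open>The sum dominates each \<open>1 / d \<sigma>\<close>, the Lipschitz constant of
    a linear piece with unit normal.\<close>
  define L where "L = (\<Sum>\<sigma>\<in>\<E>. 1 / d \<sigma>)"
  have Ls: "1 / d \<sigma> \<le> L" if "\<sigma> \<in> \<E>" for \<sigma>
    unfolding L_def using that finite_E d_pos by (intro member_le_sum) (auto intro: less_imp_le)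
  have L0: "L \<ge> 0" unfolding L_def using d_pos by (intro sum_nonneg) (auto intro: less_imp_le)
  have "\<bar>gauge_K x - gauge_K y\<bar> \<le> L * norm (x - y)" for x y
  proof -
    let ?z = "\<lambda>t. x + t *\<^sub>R (y - x)"
    let ?U = "\<lambda>\<sigma>. {t. gauge_K (?z t) = n \<sigma> \<bullet> (?z t - p) / d \<sigma>}"
    have "(L * norm (x - y))-lipschitz_on {0..1} (\<lambda>t. gauge_K (?z t))"
    proof (rule lipschitz_on_closed_Union[where I=\<E> and U="?U"])
      fix \<sigma> assume \<sigma>: "\<sigma> \<in> \<E>"
      show "closed (?U \<sigma>)"
        using d_pos[OF \<sigma>]
        by (intro closed_Collect_eq continuous_intros continuous_on_compose2[OF continuous_gauge]) auto
      show "(L * norm (x - y))-lipschitz_on (?U \<sigma>) (\<lambda>t. gauge_K (?z t))"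
      proof (rule lipschitz_onI)
        fix s t assume st: "s \<in> ?U \<sigma>" "t \<in> ?U \<sigma>"
        have "gauge_K (?z s) - gauge_K (?z t) = (s - t) * (n \<sigma> \<bullet> (y - x) / d \<sigma>)"
          using st by (simp add: inner_simps diff_divide_distrib[symmetric] algebra_simps)
        then have "dist (gauge_K (?z s)) (gauge_K (?z t)) = \<bar>s - t\<bar> * (\<bar>n \<sigma> \<bullet> (y - x)\<bar> * (1 / d \<sigma>))"
          using d_pos[OF \<sigma>] by (simp add: dist_real_def abs_mult)
        also have "\<dots> \<le> \<bar>s - t\<bar> * (norm (y - x) * L)"
          using Cauchy_Schwarz_ineq2[of "n \<sigma>" "y - x"] norm_normal[OF \<sigma>] d_pos[OF \<sigma>] Ls[OF \<sigma>]
          by (intro mult_left_mono mult_mono) auto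
        finally show "dist (gauge_K (?z s)) (gauge_K (?z t)) \<le> L * norm (x - y) * dist s t"
          by (simp add: dist_real_def norm_minus_commute mult_ac)
      qed (use L0 in auto)
    qed (use finite_E L0 gauge_piecewise_linear in auto)
    from lipschitz_onD[OF this, of 0 1] show ?thesis by (simp add: dist_real_def)
  qed
  then show ?thesis using L0 by blast
qed

section \<open>Cones over the faces\<close>

lemma gauge_on_cone:
  assumes \<sigma>: "\<sigma> \<in> \<E>" and y: "y \<in> \<sigma>" and t: "t > 0"
  shows "gauge_K (p + t *\<^sub>R (y - p)) = t"
proof -
  have yc: "y \<in> closure K" using face_subset_frontier[OF \<sigma>] y by (auto simp: frontier_def)
  have "gauge_K (p + t *\<^sub>R (y - p)) \<le> t"
    using gauge_le_iff[OF t] yc t by simp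
  moreover have "\<not> gauge_K (p + t *\<^sub>R (y - p)) < t"
    using gauge_less_iff[OF t] face_disjoint[OF \<sigma> y] t by simp
  ultimately show ?thesis by simp
qed

lemma gauge_less_1: "gauge_K x < 1 \<longleftrightarrow> x \<in> K"
  using gauge_less_iff[of 1 x] by simp

lemma gauge_open_cone:
  assumes \<sigma>: "\<sigma> \<in> \<E>" and x: "x \<in> open_cone p \<sigma>"
  shows "gauge_K x = n \<sigma> \<bullet> (x - p) / d \<sigma>"
proof -
  obtain t y where "x = p + t *\<^sub>R (y - p)" "0 < t" "t < 1" "y \<in> \<sigma>"
    using x by (auto simp: open_cone_def)
  then show ?thesis using gauge_on_cone[OF \<sigma>] face_dist_eq[OF \<sigma>] d_pos[OF \<sigma>] by simp
qed

lemma open_cone_subset: "\<sigma> \<in> \<E> \<Longrightarrow> open_cone p \<sigma> \<subseteq> K"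
  using gauge_on_cone by (auto simp: open_cone_def simp flip: gauge_less_1)

text \<open>The gauge recovers the ray parameter, so two representations of a point share their base
  point, and distinct faces are disjoint.\<close>

lemma ray_unique:
  assumes "\<sigma> \<in> \<E>" "\<sigma>' \<in> \<E>" "y \<in> \<sigma>" "y' \<in> \<sigma>'" "0 < t" "0 < t'"
    and eq: "p + t *\<^sub>R (y - p) = p + t' *\<^sub>R (y' - p)"
  shows "\<sigma> = \<sigma>'"
proof -
  have "t = t'" using gauge_on_cone assms by metis
  then have "y = y'" using eq assms by simp
  then show ?thesis using disjoint_E assms by (auto simp: pairwise_def disjnt_def)
qed

text \<open>Dilation about \<open>p\<close> preserves the infinite cones, unlike the truncated ones.\<close>

definition full_cone :: "'a set \<Rightarrow> 'a set" where
  "full_cone \<sigma> = {p + t *\<^sub>R (y - p) |t y. 0 < t \<and> y \<in> \<sigma>}"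

lemma full_cone_disjoint: "\<sigma> \<in> \<E> \<Longrightarrow> \<sigma>' \<in> \<E> \<Longrightarrow> x \<in> full_cone \<sigma> \<Longrightarrow> x \<in> full_cone \<sigma>' \<Longrightarrow> \<sigma> = \<sigma>'"
  using ray_unique by (fastforce simp: full_cone_def)

lemma open_cone_eq: "\<sigma> \<in> \<E> \<Longrightarrow> open_cone p \<sigma> = full_cone \<sigma> \<inter> K"
  using gauge_on_cone by (fastforce simp: open_cone_def full_cone_def simp flip: gauge_less_1)

lemma full_cone_scale:
  assumes "s > 0" shows "p + s *\<^sub>R (x - p) \<in> full_cone \<sigma> \<longleftrightarrow> x \<in> full_cone \<sigma>"
proof -
  have *: "p + s *\<^sub>R (x - p) \<in> full_cone \<sigma>" if "x \<in> full_cone \<sigma>" "s > 0" for x and s :: real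
    using that by (force simp: full_cone_def)
  show ?thesis using *[of x s] *[of "p + s *\<^sub>R (x - p)" "1 / s"] assms by auto
qed

lemma full_cone_iff:
  assumes \<sigma>: "\<sigma> \<in> \<E>"
  shows "x \<in> full_cone \<sigma> \<longleftrightarrow> 0 < n \<sigma> \<bullet> (x - p) \<and> p + (d \<sigma> / (n \<sigma> \<bullet> (x - p))) *\<^sub>R (x - p) \<in> \<sigma>"
proof
  assume "x \<in> full_cone \<sigma>"
  then obtain t y where "x = p + t *\<^sub>R (y - p)" "0 < t" "y \<in> \<sigma>" by (auto simp: full_cone_def)
  then show "0 < n \<sigma> \<bullet> (x - p) \<and> p + (d \<sigma> / (n \<sigma> \<bullet> (x - p))) *\<^sub>R (x - p) \<in> \<sigma>"
    using face_dist_eq[OF \<sigma>] d_pos[OF \<sigma>] by simp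
next
  let ?r = "n \<sigma> \<bullet> (x - p)"
  assume a: "0 < ?r \<and> p + (d \<sigma> / ?r) *\<^sub>R (x - p) \<in> \<sigma>"
  have "x = p + (?r / d \<sigma>) *\<^sub>R ((p + (d \<sigma> / ?r) *\<^sub>R (x - p)) - p)"
    using a d_pos[OF \<sigma>] by simp
  then show "x \<in> full_cone \<sigma>" unfolding full_cone_def using a d_pos[OF \<sigma>]
    by (intro CollectI exI[of _ "?r / d \<sigma>"] exI[of _ "p + (d \<sigma> / ?r) *\<^sub>R (x - p)"]) auto
qed

lemma borel_full_cone:
  assumes \<sigma>: "\<sigma> \<in> \<E>" shows "full_cone \<sigma> \<in> sets borel"
proof -
  have [measurable]: "\<sigma> \<in> sets borel" using face_hyperplane[OF \<sigma>] by simp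
  have "full_cone \<sigma> = {x \<in> space borel. 0 < n \<sigma> \<bullet> (x - p) \<and> p + (d \<sigma> / (n \<sigma> \<bullet> (x - p))) *\<^sub>R (x - p) \<in> \<sigma>}"
    using full_cone_iff[OF \<sigma>] by auto
  also have "\<dots> \<in> sets borel" by measurable
  finally show ?thesis .
qed

lemma borel_cone: "\<sigma> \<in> \<E> \<Longrightarrow> open_cone p \<sigma> \<in> sets borel"
  using borel_full_cone open_K by (simp add: open_cone_eq)
end

subsection \<open>Integration by parts by translation\<close>

lemma integrable_lborel_bounded_support:
  fixes g :: "'a::euclidean_space \<Rightarrow> 'b::{banach, second_countable_topology}"
  assumes "g \<in> borel_measurable borel" "bounded S" "\<And>x. x \<notin> S \<Longrightarrow> g x = 0"
    and B: "\<And>x. x \<in> S \<Longrightarrow> norm (g x) \<le> B"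
  shows "integrable lborel g"
proof -
  obtain r where S: "S \<subseteq> cball 0 r"
    using \<open>bounded S\<close> by (meson bounded_iff mem_cball_0 subsetI)
  show ?thesis
  proof (rule integrableI_bounded_set[where A="cball 0 r" and B="max B 0"])
    show "emeasure lborel (cball 0 r) < \<infinity>"
      using emeasure_bounded_finite[OF bounded_cball] by (simp add: less_top)
    have "norm (g x) \<le> max B 0" for x
      using assms(3)[of x] B[of x] by (cases "x \<in> S") auto
    then show "AE x in lborel. x \<in> cball 0 r \<longrightarrow> norm (g x) \<le> max B 0" by simp
    have "g x = 0" if "x \<notin> cball 0 r" for x using assms(3) S that by blast
    then show "AE x in lborel. x \<notin> cball 0 r \<longrightarrow> g x = 0" by (intro AE_I2) blast
  qed (use assms in auto)
qed

lemma set_integrable_lborel_continuous: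
  fixes f :: "'a::euclidean_space \<Rightarrow> real"
  assumes f: "continuous_on UNIV f" and B: "bounded B" "B \<in> sets borel"
  shows "set_integrable lborel B f"
proof -
  have [measurable]: "f \<in> borel_measurable borel" "B \<in> sets borel"
    using f B by (auto intro: borel_measurable_continuous_onI)
  have "compact (closure B)" using B by (simp add: compact_closure)
  then have "bounded (f ` closure B)"
    by (intro compact_imp_bounded compact_continuous_image continuous_on_subset[OF f]) auto
  then obtain b where b: "\<forall>y\<in>f ` closure B. norm y \<le> b" unfolding bounded_iff by blast
  have fb: "norm (f x) \<le> b" if "x \<in> B" for x
    using b that closure_subset[of B] by blast
  show ?thesis unfolding set_integrable_def
  proof (rule integrable_lborel_bounded_support[OF _ B(1), where B=b])
    show "(\<lambda>x. indicator B x *\<^sub>R f x) \<in> borel_measurable borel" by measurable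
  qed (use fb in auto)
qed

lemma integral_lborel_translate:
  fixes f :: "'a::euclidean_space \<Rightarrow> 'b::{banach, second_countable_topology}"
  assumes [measurable]: "f \<in> borel_measurable borel"
  shows "(LINT x|lborel. f (c + x)) = (LINT x|lborel. f x)"
proof -
  have "(LINT x|distr lborel borel ((+) c). f x) = (LINT x|lborel. f (c + x))"
    by (rule integral_distr) auto
  then show ?thesis by (simp add: lborel_distr_plus)
qed

text \<open>Integration by parts for difference quotients: a translation moves the shift from
  \<open>u\<close> to the affine factor. The Lipschitz bound dominates the quotients, so an almost
  everywhere limit along \<open>1 / (m + 1)\<close> is all that is asked of \<open>u'\<close>. It is
  applied to the tent and, with constant weight, to test functions.\<close>

lemma integral_affine_mult_directional_derivative:
  fixes u u' :: "'a::euclidean_space \<Rightarrow> real"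
  assumes Lip: "L-lipschitz_on UNIV u" and S: "bounded S" "\<And>x. x \<notin> S \<Longrightarrow> u x = 0"
    and u'[measurable]: "u' \<in> borel_measurable borel"
    and lim: "AE x in lborel. (\<lambda>m. (u (x + (1 / real (Suc m)) *\<^sub>R e) - u x) * real (Suc m)) \<longlonglongrightarrow> u' x"
  shows "(LINT x|lborel. (c + a \<bullet> (x - p)) * u' x) = - (a \<bullet> e) * (LINT x|lborel. u x)"
proof -
  define h where "h m = 1 / real (Suc m)" for m
  have h: "h m > 0" "h m \<le> 1" for m by (auto simp: h_def)
  define w where "w x = c + a \<bullet> (x - p)" for x
  have cw: "continuous_on UNIV w" unfolding w_def by (intro continuous_intros)
  have cu: "continuous_on UNIV u" using Lip by (rule lipschitz_on_continuous_on)
  have [measurable]: "u \<in> borel_measurable borel" "w \<in> borel_measurable borel"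
    using cw cu by (auto intro: borel_measurable_continuous_onI)
  have L0: "L \<ge> 0" using Lip lipschitz_on_nonneg by blast
  have [measurable]: "cball (0::'a) R \<in> sets borel" for R by simp
  obtain r where r: "S \<subseteq> cball 0 r" using S(1) by (meson bounded_iff mem_cball_0 subsetI)
  \<comment> \<open>All step sizes \<open>h m\<close> are at most \<open>1\<close>, so every shifted
    copy of \<open>u\<close> is supported in \<open>cball 0 R\<close>.\<close>
  define R where "R = r + norm e"
  have u0: "u x = 0" if "x \<notin> cball 0 r" for x using S(2) r that by blast
  have R: "u x = 0" "u (x + h m *\<^sub>R e) = 0" if "x \<notin> cball 0 R" for x m
  proof -
    have "norm (h m *\<^sub>R e) \<le> norm e" using h(1,2)[of m] by (simp add: mult_left_le_one_le)
    then have "norm (x + h m *\<^sub>R e) \<ge> norm x - norm e"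
      using norm_diff_ineq[of x "h m *\<^sub>R e"] by linarith
    moreover have "norm x > r + norm e" using that by (simp add: R_def)
    ultimately have "\<not> norm x \<le> r" "\<not> norm (x + h m *\<^sub>R e) \<le> r"
      using norm_ge_zero[of e] by linarith+
    then show "u x = 0" "u (x + h m *\<^sub>R e) = 0"
      using u0 by simp_all
  qed
  have bw: "bounded (w ` cball 0 R)" and bu: "bounded (u ` cball 0 R)"
    by (intro compact_imp_bounded compact_continuous_image continuous_on_subset[OF cw] continuous_on_subset[OF cu]; simp)+
  from bw obtain W where "\<forall>y\<in>w ` cball 0 R. norm y \<le> W"
    unfolding bounded_iff by blast
  then have W: "\<bar>w x\<bar> \<le> W" if "x \<in> cball 0 R" for x using that by auto
  from bu obtain U where "\<forall>y\<in>u ` cball 0 R. norm y \<le> U"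
    unfolding bounded_iff by blast
  then have U: "\<bar>u x\<bar> \<le> U" if "x \<in> cball 0 R" for x using that by auto
  have iu: "integrable lborel u"
    by (rule integrable_lborel_bounded_support[of _ "cball 0 R" U]) (use R U in auto)
  have iwu: "integrable lborel (\<lambda>x. w x * u x)"
    by (rule integrable_lborel_bounded_support[of _ "cball 0 R" "W * U"])
       (use R in \<open>auto simp: abs_mult intro!: mult_mono W U order_trans[OF abs_ge_zero W]\<close>)
  let ?s = "\<lambda>m x. w x * ((u (x + h m *\<^sub>R e) - u x) * real (Suc m))"
  have "(LINT x|lborel. ?s m x) = - (a \<bullet> e) * (LINT x|lborel. u x)" for m
  proof -
    \<comment> \<open>Shifting an affine function changes it by the constant
      \<open>h m * (a \<bullet> e)\<close>, so the identity holds exactly for every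
      \<open>m\<close>, before any limit is taken.\<close>
    have sh: "w (x - h m *\<^sub>R e) * u x = w x * u x - (h m * (a \<bullet> e)) * u x" for x
      by (simp add: w_def inner_simps algebra_simps)
    have i1: "integrable lborel (\<lambda>x. w x * u (x + h m *\<^sub>R e))"
    proof (rule integrable_lborel_bounded_support[of _ "cball 0 R" "W * (U + L * norm e)"])
      fix x :: 'a assume x: "x \<in> cball 0 R"
      have "\<bar>u (x + h m *\<^sub>R e) - u x\<bar> \<le> L * norm (h m *\<^sub>R e)"
        using lipschitz_onD[OF Lip, of "x + h m *\<^sub>R e" x] by (simp add: dist_norm)
      also have "\<dots> \<le> L * norm e" using h(1,2)[of m] L0 by (intro mult_left_mono) (auto simp: mult_left_le_one_le)
      finally have "\<bar>u (x + h m *\<^sub>R e)\<bar> \<le> U + L * norm e" using U[OF x] by linarith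
      then show "norm (w x * u (x + h m *\<^sub>R e)) \<le> W * (U + L * norm e)"
        using W[OF x] by (auto simp: abs_mult intro!: mult_mono)
    qed (use R in auto)
    have "(LINT x|lborel. w x * u (x + h m *\<^sub>R e)) = (LINT x|lborel. w (x - h m *\<^sub>R e) * u x)"
      using integral_lborel_translate[of "\<lambda>z. w (z - h m *\<^sub>R e) * u z" "h m *\<^sub>R e"] by (simp add: add.commute)
    also have "\<dots> = (LINT x|lborel. w x * u x) - (h m * (a \<bullet> e)) * (LINT x|lborel. u x)"
      unfolding sh using iu iwu by simp
    finally have eq: "(LINT x|lborel. w x * u (x + h m *\<^sub>R e)) - (LINT x|lborel. w x * u x)
        = - (h m * (a \<bullet> e)) * (LINT x|lborel. u x)" by simp
    have "(LINT x|lborel. ?s m x) = (LINT x|lborel. real (Suc m) * (w x * u (x + h m *\<^sub>R e) - w x * u x))"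
      by (intro Bochner_Integration.integral_cong) (auto simp: algebra_simps)
    also have "\<dots> = real (Suc m) * ((LINT x|lborel. w x * u (x + h m *\<^sub>R e)) - (LINT x|lborel. w x * u x))"
      using i1 iwu by simp
    finally show ?thesis unfolding eq by (simp add: h_def del: of_nat_Suc)
  qed
  moreover have "(\<lambda>m. LINT x|lborel. ?s m x) \<longlonglongrightarrow> (LINT x|lborel. w x * u' x)"
  proof (rule integral_dominated_convergence[where w="\<lambda>x. indicator (cball 0 R) x * (W * (L * norm e))"])
    show "AE x in lborel. (\<lambda>m. ?s m x) \<longlonglongrightarrow> w x * u' x"
      using lim by eventually_elim (auto simp: h_def intro!: tendsto_mult_left)
    show "integrable lborel (\<lambda>x::'a. indicator (cball 0 R) x * (W * (L * norm e)))"
      by (rule integrable_lborel_bounded_support[of _ "cball 0 R" "\<bar>W * (L * norm e)\<bar>"]) auto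
    have "norm (?s m x) \<le> indicator (cball 0 R) x * (W * (L * norm e))" for m x
    proof (cases "x \<in> cball 0 R")
      case True
      have "\<bar>u (x + h m *\<^sub>R e) - u x\<bar> \<le> L * norm (h m *\<^sub>R e)"
        using lipschitz_onD[OF Lip, of "x + h m *\<^sub>R e" x] by (simp add: dist_norm)
      then have "\<bar>u (x + h m *\<^sub>R e) - u x\<bar> * real (Suc m) \<le> L * norm (h m *\<^sub>R e) * real (Suc m)"
        by (rule mult_right_mono) simp
      also have "\<dots> = L * norm e" by (simp add: h_def del: of_nat_Suc)
      finally have "\<bar>w x\<bar> * (\<bar>u (x + h m *\<^sub>R e) - u x\<bar> * real (Suc m)) \<le> W * (L * norm e)"
        by (rule mult_mono[OF W[OF True]]) (use W[OF True] in auto)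
      then show ?thesis using True by (simp add: abs_mult del: of_nat_Suc)
    qed (simp add: R)
    then show "AE x in lborel. norm (?s m x) \<le> indicator (cball 0 R) x * (W * (L * norm e))" for m by simp
  qed measurable
  ultimately have "(LINT x|lborel. w x * u' x) = - (a \<bullet> e) * (LINT x|lborel. u x)"
    by (simp add: LIMSEQ_const_iff)
  then show ?thesis by (simp add: w_def)
qed

section \<open>Cone decomposition of the cell and moments of the faces\<close>

context star_cell begin

text \<open>Openness keeps small translates of a point in the same cone, where the tent is
  affine.\<close>

lemma open_full_cone:
  assumes \<sigma>: "\<sigma> \<in> \<E>" shows "open (full_cone \<sigma>)"
proof -
  obtain U where U: "open U" "\<sigma> = {x. n \<sigma> \<bullet> (x - p) = d \<sigma>} \<inter> U"
    using face_hyperplane(2)[OF \<sigma>] by (auto simp: openin_open)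
  let ?f = "\<lambda>x. p + (d \<sigma> / (n \<sigma> \<bullet> (x - p))) *\<^sub>R (x - p)"
  let ?P = "{x. 0 < n \<sigma> \<bullet> (x - p)}"
  have "?f x \<in> \<sigma> \<longleftrightarrow> ?f x \<in> U" if "x \<in> ?P" for x
    using that by (subst U(2)) simp
  then have "full_cone \<sigma> = ?P \<inter> ?f -` U"
    using full_cone_iff[OF \<sigma>] by blast
  also have "open \<dots>"
    by (intro continuous_open_preimage U(1) open_Collect_less continuous_intros) auto
  finally show ?thesis .
qed

lemma open_open_cone: "\<sigma> \<in> \<E> \<Longrightarrow> open (open_cone p \<sigma>)"
  by (simp add: open_cone_eq open_full_cone open_K open_Int)

lemma negligible_frontier_K: "negligible (frontier K)"
proof -
  have "negligible (\<Union>\<sigma>\<in>\<E>. {x. n \<sigma> \<bullet> (x - p) = d \<sigma>})"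
  proof (intro negligible_Union finite_imageI finite_E, clarify)
    fix \<sigma> assume \<sigma>: "\<sigma> \<in> \<E>"
    have "{x. n \<sigma> \<bullet> (x - p) = d \<sigma>} = {x. n \<sigma> \<bullet> x = d \<sigma> + n \<sigma> \<bullet> p}"
      by (auto simp: inner_diff_right)
    moreover have "n \<sigma> \<noteq> 0" using norm_normal[OF \<sigma>] by force
    ultimately show "negligible {x. n \<sigma> \<bullet> (x - p) = d \<sigma>}"
      using norm_normal[OF \<sigma>] negligible_hyperplane[of "n \<sigma>" "d \<sigma> + n \<sigma> \<bullet> p"] by auto
  qed
  then show ?thesis
    by (rule negligible_subset) (use face_hyperplane(3) frontier_K in blast)
qed

text \<open>The second alternative avoids \<open>closure K\<close>, not just \<open>K\<close>, at
  the price of the null frontier: almost every point then has a neighbourhood on which the tent is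
  given by one affine formula.\<close>

lemma AE_cones:
  shows "AE x in lborel. x \<in> (\<Union>\<sigma>\<in>\<E>. open_cone p \<sigma>) \<or> x \<notin> closure K"
proof -
  have "AE x in lebesgue. x \<notin> (K - (\<Union>\<sigma>\<in>\<E>. open_cone p \<sigma>)) \<union> frontier K"
    using negligible_Un[OF cones negligible_frontier_K]
    by (intro AE_not_in) (simp add: negligible_iff_null_sets)
  then have "AE x in lborel. x \<notin> (K - (\<Union>\<sigma>\<in>\<E>. open_cone p \<sigma>)) \<union> frontier K"
    by (simp only: AE_completion_iff)
  then show ?thesis
    by eventually_elim (use open_K in \<open>auto simp: frontier_def interior_open\<close>)
qed

lemma sum_cones_at:
  fixes f :: "'a set \<Rightarrow> 'b::real_vector"
  assumes \<sigma>: "\<sigma> \<in> \<E>" and x: "x \<in> open_cone p \<sigma>"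
  shows "(\<Sum>\<sigma>\<in>\<E>. indicator (open_cone p \<sigma>) x *\<^sub>R f \<sigma>) = f \<sigma>"
proof -
  have "indicator (open_cone p \<sigma>') x *\<^sub>R f \<sigma>' = (if \<sigma>' = \<sigma> then f \<sigma> else 0)" if "\<sigma>' \<in> \<E>" for \<sigma>'
  proof (cases "\<sigma>' = \<sigma>")
    case False
    have "x \<notin> open_cone p \<sigma>'"
      using full_cone_disjoint[OF \<sigma> that, of x] x False open_cone_eq[OF that] open_cone_eq[OF \<sigma>] by blast
    then show ?thesis using False by simp
  qed (use x in simp)
  then have "(\<Sum>\<sigma>\<in>\<E>. indicator (open_cone p \<sigma>) x *\<^sub>R f \<sigma>) = (\<Sum>\<sigma>'\<in>\<E>. if \<sigma>' = \<sigma> then f \<sigma> else 0)"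
    by (intro sum.cong) auto
  then show ?thesis using \<sigma> finite_E by simp
qed

lemma sum_cones_outside:
  fixes f :: "'a set \<Rightarrow> 'b::real_vector"
  assumes x: "x \<notin> K"
  shows "(\<Sum>\<sigma>\<in>\<E>. indicator (open_cone p \<sigma>) x *\<^sub>R f \<sigma>) = 0"
proof (intro sum.neutral ballI)
  fix \<sigma> assume "\<sigma> \<in> \<E>"
  then have "x \<notin> open_cone p \<sigma>" using open_cone_subset x by blast
  then show "indicator (open_cone p \<sigma>) x *\<^sub>R f \<sigma> = 0" by simp
qed

lemma set_integral_K_cones:
  fixes g :: "'a \<Rightarrow> real"
  assumes "set_integrable lborel K g"
  shows "(LINT x:K|lborel. g x) = (\<Sum>\<sigma>\<in>\<E>. LINT x:open_cone p \<sigma>|lborel. g x)"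
    and "\<And>\<sigma>. \<sigma> \<in> \<E> \<Longrightarrow> set_integrable lborel (open_cone p \<sigma>) g"
proof -
  show i: "set_integrable lborel (open_cone p \<sigma>) g" if "\<sigma> \<in> \<E>" for \<sigma>
    using set_integrable_subset[OF assms] borel_cone[OF that] open_cone_subset[OF that] by simp
  have "AE x in lborel. indicator K x *\<^sub>R g x = (\<Sum>\<sigma>\<in>\<E>. indicator (open_cone p \<sigma>) x *\<^sub>R g x)"
    using AE_cones
  proof eventually_elim
    case (elim x)
    then show ?case
    proof
      assume "x \<in> (\<Union>\<sigma>\<in>\<E>. open_cone p \<sigma>)"
      then obtain \<sigma> where \<sigma>: "\<sigma> \<in> \<E>" "x \<in> open_cone p \<sigma>" by blast
      then have "x \<in> K" using open_cone_subset by blast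
      then show ?thesis using sum_cones_at[OF \<sigma>, of "\<lambda>_. g x"] by simp
    next
      assume "x \<notin> closure K"
      then have "x \<notin> K" using closure_subset by blast
      then show ?thesis using sum_cones_outside[of x "\<lambda>_. g x"] by simp
    qed
  qed
  then have "(LINT x|lborel. indicator K x *\<^sub>R g x) = (LINT x|lborel. (\<Sum>\<sigma>\<in>\<E>. indicator (open_cone p \<sigma>) x *\<^sub>R g x))"
  proof (rule integral_cong_AE[rotated 2])
    show "(\<lambda>x. indicator K x *\<^sub>R g x) \<in> borel_measurable lborel"
      using assms unfolding set_integrable_def by (rule borel_measurable_integrable)
    show "(\<lambda>x. \<Sum>\<sigma>\<in>\<E>. indicator (open_cone p \<sigma>) x *\<^sub>R g x) \<in> borel_measurable lborel"
      using i unfolding set_integrable_def by (intro borel_measurable_sum) (rule borel_measurable_integrable)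
  qed
  also have "\<dots> = (\<Sum>\<sigma>\<in>\<E>. LINT x|lborel. indicator (open_cone p \<sigma>) x *\<^sub>R g x)"
    using i unfolding set_integrable_def by (rule Bochner_Integration.integral_sum)
  finally show "(LINT x:K|lborel. g x) = (\<Sum>\<sigma>\<in>\<E>. LINT x:open_cone p \<sigma>|lborel. g x)"
    by (simp add: set_lebesgue_integral_def)
qed

abbreviation face_lborel where "face_lborel \<sigma> \<equiv> affine_lborel (affine hull \<sigma>)"

lemma bounded_cone: "\<sigma> \<in> \<E> \<Longrightarrow> bounded (open_cone p \<sigma>)"
  using bounded_subset[OF bounded_K open_cone_subset] .

lemmas integral_cone = integral_open_cone[OF norm_normal d_pos face_hyperplane(4,5)]

text \<open>Degree zero in the cone formula gives base times height over dimension. Finiteness of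
  the face measure comes along, because the cone is bounded.\<close>

lemma measure_cone:
  assumes \<sigma>: "\<sigma> \<in> \<E>"
  shows "measure lborel (open_cone p \<sigma>) = d \<sigma> / DIM('a) * face_measure \<sigma>"
    and "emeasure (face_lborel \<sigma>) \<sigma> < \<infinity>"
proof -
  have i: "set_integrable lborel (open_cone p \<sigma>) (\<lambda>_. 1::real)"
    by (intro set_integrable_lborel_continuous bounded_cone borel_cone \<sigma> continuous_intros)
  note c = integral_cone[OF \<sigma> \<sigma> \<sigma> \<sigma>, where k=0, OF _ _ i, folded face_hyperplane(1)[OF \<sigma>]]
  have \<sigma>b: "\<sigma> \<in> sets (face_lborel \<sigma>)" using face_hyperplane(5)[OF \<sigma>] by simp
  show "emeasure (face_lborel \<sigma>) \<sigma> < \<infinity>"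
    using c(1) \<sigma>b by (simp add: set_integrable_def integrable_indicator_iff less_top)
  show "measure lborel (open_cone p \<sigma>) = d \<sigma> / DIM('a) * face_measure \<sigma>"
    using c(2) sets.sets_into_space[OF \<sigma>b] by (simp add: set_lebesgue_integral_def face_measure_def Int_absorb2)
qed

lemma set_integrable_face:
  fixes f :: "'a \<Rightarrow> 'b::{banach, second_countable_topology}"
  assumes \<sigma>: "\<sigma> \<in> \<E>" and f[measurable]: "f \<in> borel_measurable borel" and b: "\<And>y. y \<in> \<sigma> \<Longrightarrow> norm (f y) \<le> b"
  shows "set_integrable (face_lborel \<sigma>) \<sigma> f"
proof -
  have [measurable]: "\<sigma> \<in> sets borel" using face_hyperplane(5)[OF \<sigma>] .
  show ?thesis unfolding set_integrable_def
    by (rule integrableI_bounded_set[where A=\<sigma> and B=b]) (use b measure_cone(2)[OF \<sigma>] in auto)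
qed

text \<open>Stated in product form, without dividing by the face measure, so that positivity of that
  measure never has to be shown.\<close>

lemma face_center_moment:
  assumes \<sigma>: "\<sigma> \<in> \<E>"
  shows "(LINT y:\<sigma>|face_lborel \<sigma>. a \<bullet> (y - p)) = face_measure \<sigma> * (a \<bullet> (face_center \<sigma> - p))"
proof -
  have \<sigma>b[measurable]: "\<sigma> \<in> sets borel" using face_hyperplane(5)[OF \<sigma>] .
  have "bounded \<sigma>"
    using bounded_subset[OF bounded_closure[OF bounded_K]] face_subset_frontier[OF \<sigma>] by (auto simp: frontier_def)
  then obtain b where b: "norm y \<le> b" if "y \<in> \<sigma>" for y unfolding bounded_iff by blast
  have iy: "set_integrable (face_lborel \<sigma>) \<sigma> (\<lambda>y. y)"
    by (rule set_integrable_face[OF \<sigma> _ b]) auto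
  have i1: "set_integrable (face_lborel \<sigma>) \<sigma> (\<lambda>y. 1::real)"
    by (rule set_integrable_face[OF \<sigma>, of _ 1]) auto
  have m: "(LINT y:\<sigma>|face_lborel \<sigma>. 1) = face_measure \<sigma>"
    using sets.sets_into_space[of \<sigma> "face_lborel \<sigma>"] \<sigma>b
    by (simp add: set_lebesgue_integral_def face_measure_def Int_absorb2)
  \<comment> \<open>If the measure is zero, the definition of the center divides by zero and returns
    \<open>0\<close>; the equation survives because the integral over a null set vanishes
    too.\<close>
  have c: "face_measure \<sigma> *\<^sub>R face_center \<sigma> = (LINT y:\<sigma>|face_lborel \<sigma>. y)"
  proof (cases "face_measure \<sigma> = 0")
    case True
    then have "emeasure (face_lborel \<sigma>) \<sigma> = 0"
      using measure_cone(2)[OF \<sigma>] by (auto simp: face_measure_def measure_def enn2real_eq_0_iff)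
    then have "AE y in face_lborel \<sigma>. y \<notin> \<sigma>"
      by (intro AE_not_in null_setsI) auto
    then have "AE y in face_lborel \<sigma>. indicator \<sigma> y *\<^sub>R y = 0" by eventually_elim simp
    then have "(LINT y:\<sigma>|face_lborel \<sigma>. y) = 0"
      unfolding set_lebesgue_integral_def by (rule integral_eq_zero_AE)
    then show ?thesis using True by simp
  qed (simp add: face_center_def)
  have ia: "set_integrable (face_lborel \<sigma>) \<sigma> (\<lambda>y. a \<bullet> y)"
  proof -
    have "integrable (face_lborel \<sigma>) (\<lambda>y. a \<bullet> (indicator \<sigma> y *\<^sub>R y))"
      using iy unfolding set_integrable_def by (intro integrable_inner_right)
    then show ?thesis by (simp add: set_integrable_def)
  qed
  have "(LINT y:\<sigma>|face_lborel \<sigma>. a \<bullet> (y - p)) = (LINT y:\<sigma>|face_lborel \<sigma>. a \<bullet> y - (a \<bullet> p) * 1)"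
    by (simp add: inner_diff_right)
  also have "\<dots> = (LINT y:\<sigma>|face_lborel \<sigma>. a \<bullet> y) - (LINT y:\<sigma>|face_lborel \<sigma>. (a \<bullet> p) * 1)"
    using i1 by (intro set_integral_diff ia set_integrable_mult_right)
  also have "(LINT y:\<sigma>|face_lborel \<sigma>. (a \<bullet> p) * 1) = (a \<bullet> p) * face_measure \<sigma>"
    unfolding m[symmetric] by (rule set_integral_mult_right)
  also have "(LINT y:\<sigma>|face_lborel \<sigma>. a \<bullet> y) = a \<bullet> (LINT y:\<sigma>|face_lborel \<sigma>. y)"
    using iy unfolding set_integrable_def set_lebesgue_integral_def
    by (subst integral_inner_right[symmetric]) (auto intro: arg_cong[where f="integral\<^sup>L _"])
  finally show ?thesis by (simp add: c[symmetric] inner_diff_right algebra_simps)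
qed

lemma integral_cone_moment:
  assumes \<sigma>: "\<sigma> \<in> \<E>"
  shows "(LINT x:open_cone p \<sigma>|lborel. a \<bullet> (x - p))
    = d \<sigma> / (DIM('a) + 1) * (face_measure \<sigma> * (a \<bullet> (face_center \<sigma> - p)))"
proof -
  have i: "set_integrable lborel (open_cone p \<sigma>) (\<lambda>x. a \<bullet> (x - p))"
    by (intro set_integrable_lborel_continuous bounded_cone borel_cone \<sigma> continuous_intros)
  show ?thesis
    using integral_cone(2)[OF \<sigma> \<sigma> \<sigma> \<sigma>, where k=1, OF _ _ i, folded face_hyperplane(1)[OF \<sigma>]]
    by (simp add: face_center_moment[OF \<sigma>])
qed

lemma normal_face_center:
  assumes \<sigma>: "\<sigma> \<in> \<E>"
  shows "face_measure \<sigma> * (n \<sigma> \<bullet> (face_center \<sigma> - p)) = face_measure \<sigma> * d \<sigma>"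
proof -
  have \<sigma>b[measurable]: "\<sigma> \<in> sets borel" using face_hyperplane(5)[OF \<sigma>] .
  have "(LINT y:\<sigma>|face_lborel \<sigma>. n \<sigma> \<bullet> (y - p)) = (LINT y:\<sigma>|face_lborel \<sigma>. d \<sigma> * 1)"
    unfolding set_lebesgue_integral_def
    using face_dist_eq[OF \<sigma>] by (intro Bochner_Integration.integral_cong) (auto simp: indicator_def)
  also have "\<dots> = d \<sigma> * face_measure \<sigma>"
    using sets.sets_into_space[of \<sigma> "face_lborel \<sigma>"] \<sigma>b
    by (simp add: set_lebesgue_integral_def face_measure_def Int_absorb2)
  finally show ?thesis by (simp add: face_center_moment[OF \<sigma>])
qed

lemma K_borel [measurable]: "K \<in> sets borel"
  using open_K by simp

lemma measure_K: "measure lborel K = (\<Sum>\<sigma>\<in>\<E>. d \<sigma> / DIM('a) * face_measure \<sigma>)"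
proof -
  have i: "set_integrable lborel K (\<lambda>_. 1::real)"
    by (intro set_integrable_lborel_continuous bounded_K K_borel continuous_intros)
  have "measure lborel K = (LINT x:K|lborel. 1)"
    by (simp add: set_lebesgue_integral_def)
  also have "\<dots> = (\<Sum>\<sigma>\<in>\<E>. LINT x:open_cone p \<sigma>|lborel. 1)"
    by (rule set_integral_K_cones(1)[OF i])
  also have "\<dots> = (\<Sum>\<sigma>\<in>\<E>. measure lborel (open_cone p \<sigma>))"
    using borel_cone by (intro sum.cong refl) (simp add: set_lebesgue_integral_def)
  finally show ?thesis by (simp add: measure_cone)
qed

section \<open>The tent over the cell and the two face identities\<close>

definition tent :: "'a \<Rightarrow> real" where "tent x = max 0 (1 - gauge_K x)"

lemma tent_outside: "x \<notin> K \<Longrightarrow> tent x = 0"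
  using gauge_less_1[of x] by (simp add: tent_def)

lemma tent_cone: "\<sigma> \<in> \<E> \<Longrightarrow> x \<in> open_cone p \<sigma> \<Longrightarrow> tent x = 1 - n \<sigma> \<bullet> (x - p) / d \<sigma>"
  using gauge_open_cone[of \<sigma> x] open_cone_subset[of \<sigma>] gauge_less_1[of x] by (auto simp: tent_def)

lemma tent_Lipschitz: "\<exists>L. L-lipschitz_on UNIV tent"
proof -
  obtain L where L: "L \<ge> 0" "\<And>x y. \<bar>gauge_K x - gauge_K y\<bar> \<le> L * norm (x - y)"
    using gauge_Lipschitz by blast
  have "L-lipschitz_on UNIV tent"
  proof (rule lipschitz_onI)
    fix x y
    have "dist (tent x) (tent y) \<le> \<bar>gauge_K x - gauge_K y\<bar>"
      unfolding tent_def dist_real_def by linarith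
    then show "dist (tent x) (tent y) \<le> L * dist x y"
      using L(2)[of x y] by (simp add: dist_norm)
  qed (rule L)
  then show ?thesis ..
qed

lemma continuous_tent: "continuous_on UNIV tent"
  using tent_Lipschitz lipschitz_on_continuous_on by blast

text \<open>The region under the graph is a cone of height one over \<open>K\<close>, hence the
  factor \<open>1 / (DIM('a) + 1)\<close>. On each cone, \<open>1\<close> and the gauge integrate to
  \<open>d |\<sigma>| / N\<close> and \<open>d |\<sigma>| / (N + 1)\<close> with \<open>N\<close>
  the dimension, and the difference is \<open>d |\<sigma>| / (N (N + 1))\<close>.\<close>

lemma integral_tent: "(LINT x|lborel. tent x) = measure lborel K / (DIM('a) + 1)"
proof -
  have i: "set_integrable lborel K tent"
    by (intro set_integrable_lborel_continuous bounded_K K_borel continuous_tent)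
  have "(LINT x|lborel. tent x) = (LINT x:K|lborel. tent x)"
    unfolding set_lebesgue_integral_def using tent_outside
    by (intro Bochner_Integration.integral_cong) (auto simp: indicator_def)
  also have "\<dots> = (\<Sum>\<sigma>\<in>\<E>. LINT x:open_cone p \<sigma>|lborel. tent x)"
    by (rule set_integral_K_cones(1)[OF i])
  also have "\<dots> = (\<Sum>\<sigma>\<in>\<E>. d \<sigma> / DIM('a) * face_measure \<sigma> / (DIM('a) + 1))"
  proof (intro sum.cong refl)
    fix \<sigma> assume \<sigma>: "\<sigma> \<in> \<E>"
    have i1: "set_integrable lborel (open_cone p \<sigma>) (\<lambda>x. 1::real)"
      and i2: "set_integrable lborel (open_cone p \<sigma>) (\<lambda>x. (1 / d \<sigma>) * (n \<sigma> \<bullet> (x - p)))"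
      by (intro set_integrable_lborel_continuous bounded_cone borel_cone \<sigma> continuous_intros)+
    have "(LINT x:open_cone p \<sigma>|lborel. tent x)
        = (LINT x:open_cone p \<sigma>|lborel. 1 - (1 / d \<sigma>) * (n \<sigma> \<bullet> (x - p)))"
      unfolding set_lebesgue_integral_def using tent_cone[OF \<sigma>]
      by (intro Bochner_Integration.integral_cong) (auto simp: indicator_def)
    also have "\<dots> = (LINT x:open_cone p \<sigma>|lborel. 1) - (LINT x:open_cone p \<sigma>|lborel. (1 / d \<sigma>) * (n \<sigma> \<bullet> (x - p)))"
      by (rule set_integral_diff(2)[OF i1 i2])
    also have "(LINT x:open_cone p \<sigma>|lborel. (1 / d \<sigma>) * (n \<sigma> \<bullet> (x - p))) = face_measure \<sigma> * d \<sigma> / (DIM('a) + 1)"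
      using d_pos[OF \<sigma>]
      by (subst set_integral_mult_right) (simp add: integral_cone_moment[OF \<sigma>] normal_face_center[OF \<sigma>] field_simps)
    also have "(LINT x:open_cone p \<sigma>|lborel. 1) = d \<sigma> / DIM('a) * face_measure \<sigma>"
      using borel_cone[OF \<sigma>] by (simp add: set_lebesgue_integral_def measure_cone[OF \<sigma>])
    finally show "(LINT x:open_cone p \<sigma>|lborel. tent x) = d \<sigma> / DIM('a) * face_measure \<sigma> / (DIM('a) + 1)"
      using DIM_positive[where 'a='a] by (simp add: field_simps)
  qed
  finally show ?thesis by (simp add: measure_K sum_divide_distrib)
qed

text \<open>Almost every point lies in an open cone or in the exterior of \<open>K\<close>, and so
  do its small translates. There the tent is affine, so the quotients are eventually constant and no
  differentiability theorem for Lipschitz functions is involved.\<close>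

lemma tent_directional_derivative:
  "AE x in lborel. (\<lambda>m. (tent (x + (1 / real (Suc m)) *\<^sub>R e) - tent x) * real (Suc m))
     \<longlonglongrightarrow> (\<Sum>\<sigma>\<in>\<E>. indicator (open_cone p \<sigma>) x *\<^sub>R (- (n \<sigma> \<bullet> e) / d \<sigma>))"
  using AE_cones
proof eventually_elim
  case (elim x)
  have "(\<lambda>m. x + (1 / real (Suc m)) *\<^sub>R e) \<longlonglongrightarrow> x + 0 *\<^sub>R e"
    by (intro tendsto_intros LIMSEQ_Suc lim_1_over_n)
  then have lim: "(\<lambda>m. x + (1 / real (Suc m)) *\<^sub>R e) \<longlonglongrightarrow> x" by simp
  from elim show ?case
  proof
    assume "x \<in> (\<Union>\<sigma>\<in>\<E>. open_cone p \<sigma>)"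
    then obtain \<sigma> where \<sigma>: "\<sigma> \<in> \<E>" "x \<in> open_cone p \<sigma>" by blast
    have ev: "\<forall>\<^sub>F m in sequentially. x + (1 / real (Suc m)) *\<^sub>R e \<in> open_cone p \<sigma>"
      by (rule topological_tendstoD[OF lim open_open_cone[OF \<sigma>(1)] \<sigma>(2)])
    have "\<forall>\<^sub>F m in sequentially. (tent (x + (1 / real (Suc m)) *\<^sub>R e) - tent x) * real (Suc m) = - (n \<sigma> \<bullet> e) / d \<sigma>"
      using ev
    proof eventually_elim
      case (elim m)
      then show ?case
        using d_pos[OF \<sigma>(1)]
        by (simp add: tent_cone[OF \<sigma>(1)] \<sigma>(2) inner_simps field_simps del: of_nat_Suc)
    qed
    then show ?thesis
      unfolding sum_cones_at[OF \<sigma>] by (rule tendsto_eventually)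
  next
    assume x: "x \<notin> closure K"
    then have xK: "x \<notin> K" using closure_subset by blast
    have "\<forall>\<^sub>F m in sequentially. x + (1 / real (Suc m)) *\<^sub>R e \<in> - closure K"
      using x by (intro topological_tendstoD[OF lim]) auto
    then have "\<forall>\<^sub>F m in sequentially. (tent (x + (1 / real (Suc m)) *\<^sub>R e) - tent x) * real (Suc m) = 0"
    proof eventually_elim
      case (elim m)
      then have "x + (1 / real (Suc m)) *\<^sub>R e \<notin> K" using closure_subset by blast
      from tent_outside[OF this] tent_outside[OF xK] show ?case by (simp del: of_nat_Suc)
    qed
    then show ?thesis
      unfolding sum_cones_outside[OF xK] by (rule tendsto_eventually)
  qed
qed

text \<open>The tent function is Lipschitz, vanishes outside
  \<open>K\<close> and has constant gradient \<open>- n \<sigma> / d \<sigma>\<close> on each cone, and cone integrals are face integrals.\<close>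

lemma divergence_affine:
  "(\<Sum>\<sigma>\<in>\<E>. (n \<sigma> \<bullet> e) / d \<sigma> * (LINT x:open_cone p \<sigma>|lborel. c + a \<bullet> (x - p)))
     = (a \<bullet> e) * (measure lborel K / (DIM('a) + 1))"
proof -
  let ?D = "\<lambda>x. \<Sum>\<sigma>\<in>\<E>. indicator (open_cone p \<sigma>) x *\<^sub>R (- (n \<sigma> \<bullet> e) / d \<sigma>)"
  obtain L where L: "L-lipschitz_on UNIV tent" using tent_Lipschitz by blast
  have D: "?D \<in> borel_measurable borel"
    using borel_cone by (intro borel_measurable_sum borel_measurable_scaleR borel_measurable_indicator) auto
  have int: "set_integrable lborel (open_cone p \<sigma>) (\<lambda>x. c + a \<bullet> (x - p))" if \<sigma>: "\<sigma> \<in> \<E>" for \<sigma>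
    by (intro set_integrable_lborel_continuous bounded_cone borel_cone \<sigma> continuous_intros)
  have "(LINT x|lborel. (c + a \<bullet> (x - p)) * ?D x)
      = (LINT x|lborel. (\<Sum>\<sigma>\<in>\<E>. (- (n \<sigma> \<bullet> e) / d \<sigma>) * (indicator (open_cone p \<sigma>) x *\<^sub>R (c + a \<bullet> (x - p)))))"
    by (simp add: sum_distrib_left mult_ac)
  also have "\<dots> = (\<Sum>\<sigma>\<in>\<E>. LINT x|lborel. (- (n \<sigma> \<bullet> e) / d \<sigma>) * (indicator (open_cone p \<sigma>) x *\<^sub>R (c + a \<bullet> (x - p))))"
    using int unfolding set_integrable_def by (intro Bochner_Integration.integral_sum integrable_mult_right)
  also have "\<dots> = (\<Sum>\<sigma>\<in>\<E>. (- (n \<sigma> \<bullet> e) / d \<sigma>) * (LINT x:open_cone p \<sigma>|lborel. c + a \<bullet> (x - p)))"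
    unfolding set_lebesgue_integral_def by (intro sum.cong refl integral_mult_right_zero)
  also have "\<dots> = - (\<Sum>\<sigma>\<in>\<E>. (n \<sigma> \<bullet> e) / d \<sigma> * (LINT x:open_cone p \<sigma>|lborel. c + a \<bullet> (x - p)))"
    by (simp add: sum_negf[symmetric])
  finally show ?thesis
    using integral_affine_mult_directional_derivative[where c=c and a=a and p=p and e=e,
      OF L bounded_K tent_outside D tent_directional_derivative]
    by (simp add: integral_tent)
qed

text \<open>Constant weight: the factor \<open>d \<sigma>\<close> in the volume of a cone cancels
  the one in the gradient of the tent.\<close>

lemma sum_normals: "(\<Sum>\<sigma>\<in>\<E>. face_measure \<sigma> * (n \<sigma> \<bullet> e)) = 0"
proof -
  have "(LINT x:open_cone p \<sigma>|lborel. 1 + 0 \<bullet> (x - p)) = d \<sigma> / DIM('a) * face_measure \<sigma>" if "\<sigma> \<in> \<E>" for \<sigma>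
    using borel_cone[OF that] by (simp add: set_lebesgue_integral_def measure_cone[OF that])
  then have "(\<Sum>\<sigma>\<in>\<E>. (n \<sigma> \<bullet> e) / d \<sigma> * (LINT x:open_cone p \<sigma>|lborel. 1 + 0 \<bullet> (x - p)))
      = (\<Sum>\<sigma>\<in>\<E>. (1 / DIM('a)) * (face_measure \<sigma> * (n \<sigma> \<bullet> e)))"
    using d_pos by (intro sum.cong refl) (simp, metis less_irrefl)
  also have "\<dots> = (1 / DIM('a)) * (\<Sum>\<sigma>\<in>\<E>. face_measure \<sigma> * (n \<sigma> \<bullet> e))"
    by (simp add: sum_distrib_left)
  finally show ?thesis
    using divergence_affine[of e 1 0] DIM_positive[where 'a='a] by simp
qed

text \<open>Linear weight vanishing at \<open>p\<close>: the factor \<open>1 / (DIM('a) + 1)\<close>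
  from cone integrals of degree one cancels the same factor in the integral of the tent.\<close>

lemma sum_normals_moment:
  "(\<Sum>\<sigma>\<in>\<E>. face_measure \<sigma> * (n \<sigma> \<bullet> e) * (a \<bullet> (face_center \<sigma> - p))) = (a \<bullet> e) * measure lborel K"
proof -
  have "(\<Sum>\<sigma>\<in>\<E>. (n \<sigma> \<bullet> e) / d \<sigma> * (LINT x:open_cone p \<sigma>|lborel. 0 + a \<bullet> (x - p)))
     = (\<Sum>\<sigma>\<in>\<E>. (1 / (DIM('a) + 1)) * (face_measure \<sigma> * (n \<sigma> \<bullet> e) * (a \<bullet> (face_center \<sigma> - p))))"
  proof (intro sum.cong refl)
    fix \<sigma> assume \<sigma>: "\<sigma> \<in> \<E>"
    show "(n \<sigma> \<bullet> e) / d \<sigma> * (LINT x:open_cone p \<sigma>|lborel. 0 + a \<bullet> (x - p))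
      = (1 / (DIM('a) + 1)) * (face_measure \<sigma> * (n \<sigma> \<bullet> e) * (a \<bullet> (face_center \<sigma> - p)))"
      using d_pos[OF \<sigma>] by (simp add: integral_cone_moment[OF \<sigma>])
  qed
  also have "\<dots> = (1 / (DIM('a) + 1)) * (\<Sum>\<sigma>\<in>\<E>. face_measure \<sigma> * (n \<sigma> \<bullet> e) * (a \<bullet> (face_center \<sigma> - p)))"
    by (simp add: sum_distrib_left)
  finally show ?thesis
    using divergence_affine[of e 0 a] by (simp add: add_pos_nonneg)
qed
end

subsection \<open>Smooth functions\<close>

lemma partial_deriv_eqI:
  assumes "(\<phi> has_derivative D) (at x)"
  shows "partial_deriv i \<phi> x = D (axis i 1)"
  using frechet_derivative_at[OF assms] by (simp add: partial_deriv_def)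

lemma C_k_Suc_D: "C_k (Suc k) \<phi> \<Longrightarrow> C_k k \<phi>"
proof (induction k arbitrary: \<phi>)
  case 0
  then show ?case by (simp add: continuous_on_eq_continuous_at differentiable_imp_continuous_within)
next
  case (Suc k)
  have "C_k k (partial_deriv i \<phi>)" for i
    using Suc.prems by (intro Suc.IH) simp
  then show ?case using Suc.prems by simp
qed

lemma C_k_const: "C_k k (\<lambda>x::real^'d::finite. c)"
proof (induction k arbitrary: c)
  case (Suc k)
  have "partial_deriv i (\<lambda>x::real^'d. c) = (\<lambda>x. 0)" for i
    by (intro ext partial_deriv_eqI has_derivative_const)
  then show ?case using Suc by simp
qed simp

lemma C_k_affine: "C_k k (\<lambda>x::real^'d::finite. a \<bullet> x + b)"
proof (cases k)
  case 0
  then show ?thesis by (auto intro!: continuous_intros)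
next
  case (Suc l)
  have D: "((\<lambda>x::real^'d. a \<bullet> x + b) has_derivative (\<lambda>v. a \<bullet> v)) (at x)" for x
    by (auto intro!: derivative_eq_intros)
  have "partial_deriv i (\<lambda>x::real^'d. a \<bullet> x + b) = (\<lambda>x. a \<bullet> axis i 1)" for i
    by (intro ext partial_deriv_eqI D)
  then show ?thesis using D by (auto simp: Suc differentiable_def C_k_const)
qed

lemma C_k_add:
  "C_k k f \<Longrightarrow> C_k k g \<Longrightarrow> C_k k (\<lambda>x::real^'d::finite. f x + g x)"
proof (induction k arbitrary: f g)
  case 0
  then show ?case by (auto intro!: continuous_intros)
next
  case (Suc k)
  have df: "(f has_derivative frechet_derivative f (at x)) (at x)"
    and dg: "(g has_derivative frechet_derivative g (at x)) (at x)" for x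
    using Suc.prems by (simp_all add: frechet_derivative_works[symmetric])
  note D = has_derivative_add[OF df dg]
  have "partial_deriv i (\<lambda>x. f x + g x) = (\<lambda>x. partial_deriv i f x + partial_deriv i g x)" for i
    by (intro ext, subst partial_deriv_eqI[OF D]) (simp add: partial_deriv_def)
  then show ?case using D Suc by (auto simp: differentiable_def)
qed

lemma C_k_mult:
  "C_k k f \<Longrightarrow> C_k k g \<Longrightarrow> C_k k (\<lambda>x::real^'d::finite. f x * g x)"
proof (induction k arbitrary: f g)
  case 0
  then show ?case by (auto intro!: continuous_intros)
next
  case (Suc k)
  have df: "(f has_derivative frechet_derivative f (at x)) (at x)"
    and dg: "(g has_derivative frechet_derivative g (at x)) (at x)" for x
    using Suc.prems by (simp_all add: frechet_derivative_works[symmetric])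
  note D = has_derivative_mult[OF df dg]
  have eq: "partial_deriv i (\<lambda>x. f x * g x) = (\<lambda>x. f x * partial_deriv i g x + partial_deriv i f x * g x)" for i
    by (intro ext, subst partial_deriv_eqI[OF D]) (simp add: partial_deriv_def)
  \<comment> \<open>The product rule pairs an undifferentiated factor with a derivative of lower
    order, so both factors are first weakened to order \<open>k\<close>.\<close>
  have "C_k k f" "C_k k g" using Suc.prems C_k_Suc_D by blast+
  then have "C_k k (partial_deriv i (\<lambda>x. f x * g x))" for i
    unfolding eq using Suc.prems by (intro C_k_add Suc.IH) simp_all
  then show ?case using D by (auto simp: differentiable_def)
qed

lemma C_k_prod:
  "finite I \<Longrightarrow> (\<And>i. i \<in> I \<Longrightarrow> C_k k (f i)) \<Longrightarrow> C_k k (\<lambda>x::real^'d::finite. \<Prod>i\<in>I. f i x)"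
  by (induction I rule: finite_induct) (auto intro: C_k_const C_k_mult)

text \<open>The classical flat function \<open>exp (- 1 / t)\<close> with a polynomial in
  \<open>1 / t\<close> in front; the polynomial makes the family closed under
  differentiation.\<close>

definition exp_bump :: "real poly \<Rightarrow> real \<Rightarrow> real" where
  "exp_bump P t = (if t > 0 then poly P (1 / t) * exp (- (1 / t)) else 0)"

lemma tendsto_poly_mult_exp_neg: "((\<lambda>y. poly P y * exp (- y)) \<longlongrightarrow> (0::real)) at_top"
proof -
  have "((\<lambda>y. \<Sum>i\<le>degree P. coeff P i * (y ^ i / exp y)) \<longlongrightarrow> (\<Sum>i\<le>degree P. coeff P i * 0)) at_top"
    by (intro tendsto_intros tendsto_power_div_exp_0)
  then show ?thesis
    by (simp add: poly_altdef sum_distrib_right exp_minus divide_inverse mult.assoc)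
qed

text \<open>For \<open>t > 0\<close> the inner derivative of \<open>1 / t\<close> contributes
  \<open>1 / t^2\<close>, the polynomial \<open>[:0, 0, 1:]\<close>, with opposite signs on
  \<open>pderiv P\<close> and on \<open>P\<close>. At \<open>0\<close> the exponential beats every
  polynomial.\<close>

lemma exp_bump_deriv:
  "(exp_bump P has_real_derivative exp_bump ([:0, 0, 1:] * (P - pderiv P)) t) (at t)"
proof (cases t "0::real" rule: linorder_cases)
  case less
  have "((\<lambda>_. 0) has_real_derivative 0) (at t)" by simp
  then have "(exp_bump P has_real_derivative 0) (at t)"
    by (rule has_field_derivative_transform_within_open[where S="{..<0}"])
       (use less in \<open>auto simp: exp_bump_def\<close>)
  then show ?thesis using less by (simp add: exp_bump_def)
next
  case greater
  have "((\<lambda>t. poly P (1 / t) * exp (- (1 / t))) has_real_derivative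
      exp_bump ([:0, 0, 1:] * (P - pderiv P)) t) (at t)"
    using greater
    by (auto intro!: derivative_eq_intros DERIV_chain'[OF _ poly_DERIV]
        simp: exp_bump_def field_simps power2_eq_square)
  then show ?thesis
    by (rule has_field_derivative_transform_within_open[where S="{0<..}"])
       (use greater in \<open>auto simp: exp_bump_def\<close>)
next
  case equal
  have "((\<lambda>h. exp_bump P h / h) \<longlongrightarrow> 0) (at 0)"
  proof (rule filterlim_split_at)
    show "((\<lambda>h. exp_bump P h / h) \<longlongrightarrow> 0) (at_left 0)"
      by (rule tendsto_eventually)
         (auto simp: exp_bump_def eventually_at_filter intro!: always_eventually)
    \<comment> \<open>Dividing by \<open>h\<close> multiplies a polynomial in \<open>1 / h\<close>
      by its variable, hence the factor \<open>[:0, 1:]\<close>.\<close>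
    have "((\<lambda>h. poly ([:0, 1:] * P) (inverse h) * exp (- inverse h)) \<longlongrightarrow> 0) (at_right (0::real))"
      by (rule filterlim_compose[OF tendsto_poly_mult_exp_neg filterlim_inverse_at_top_right])
    moreover have "\<forall>\<^sub>F h in at_right 0. poly ([:0, 1:] * P) (inverse h) * exp (- inverse h) = exp_bump P h / h"
      by (auto simp: eventually_at_filter exp_bump_def divide_inverse mult_ac intro!: always_eventually)
    ultimately show "((\<lambda>h. exp_bump P h / h) \<longlongrightarrow> 0) (at_right 0)"
      by (rule Lim_transform_eventually)
  qed
  then show ?thesis using equal by (simp add: DERIV_def exp_bump_def)
qed

lemma C_k_exp_bump: "C_k k (\<lambda>x::real^'d::finite. exp_bump P (a \<bullet> x + b))"
proof (induction k arbitrary: P)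
  case 0
  have "continuous_on UNIV (exp_bump P)"
    by (rule DERIV_continuous_on[OF has_field_derivative_at_within[OF exp_bump_deriv]])
  then show ?case
    by (auto intro!: continuous_intros continuous_on_compose2[of UNIV "exp_bump P"])
next
  case (Suc k)
  let ?P' = "[:0, 0, 1:] * (P - pderiv P)"
  have D: "((\<lambda>x::real^'d. exp_bump P (a \<bullet> x + b)) has_derivative (\<lambda>v. exp_bump ?P' (a \<bullet> x + b) * (a \<bullet> v))) (at x)" for x
  proof -
    have "((\<lambda>x::real^'d. a \<bullet> x + b) has_derivative (\<lambda>v. a \<bullet> v)) (at x)"
      by (auto intro!: derivative_eq_intros)
    from has_derivative_compose[OF this exp_bump_deriv[unfolded has_field_derivative_def]]
    show ?thesis by simp
  qed
  have eq: "partial_deriv i (\<lambda>x::real^'d. exp_bump P (a \<bullet> x + b)) = (\<lambda>x. exp_bump ?P' (a \<bullet> x + b) * (a \<bullet> axis i 1))" for i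
    by (intro ext partial_deriv_eqI D)
  have "C_k k (partial_deriv i (\<lambda>x::real^'d. exp_bump P (a \<bullet> x + b)))" for i
    unfolding eq by (intro C_k_mult C_k_const Suc)
  then show ?case using D by (auto simp: differentiable_def)
qed

text \<open>The shift by \<open>- 1\<close> keeps the support at distance \<open>1 / m\<close> from
  the sides of the box, hence compactly inside it. For growing \<open>m\<close> the arguments tend
  to infinity inside the box, where \<open>exp (- 1 / s)\<close> tends to \<open>1\<close>.\<close>

definition box_bump :: "nat \<Rightarrow> real^'d \<Rightarrow> real^'d \<Rightarrow> real^'d::finite \<Rightarrow> real" where
  "box_bump m a b x = (\<Prod>i\<in>UNIV. exp_bump 1 (real m * (x $ i - a $ i) - 1) * exp_bump 1 (real m * (b $ i - x $ i) - 1))"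

lemma exp_bump_1: "0 \<le> exp_bump 1 t" "exp_bump 1 t \<le> 1" "t \<le> 0 \<Longrightarrow> exp_bump 1 t = 0"
  by (auto simp: exp_bump_def)

lemma C_k_box_bump: "C_k k (box_bump m a b)"
proof -
  have "box_bump m a b = (\<lambda>x. \<Prod>i\<in>UNIV. exp_bump 1 ((real m *\<^sub>R axis i 1) \<bullet> x + (- real m * a $ i - 1))
      * exp_bump 1 ((- real m *\<^sub>R axis i 1) \<bullet> x + (real m * b $ i - 1)))"
    by (auto simp: box_bump_def fun_eq_iff inner_axis' algebra_simps)
  then show ?thesis by (simp only:) (intro C_k_prod C_k_mult C_k_exp_bump finite)
qed

lemma box_bump_bounds: "0 \<le> box_bump m a b x" "box_bump m a b x \<le> 1"
  unfolding box_bump_def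
  by (auto intro!: prod_nonneg prod_le_1 mult_nonneg_nonneg mult_le_one exp_bump_1)

lemma tendsto_box_bump:
  assumes "x \<in> box a b" shows "(\<lambda>m. box_bump m a b x) \<longlonglongrightarrow> 1"
proof -
  have 1: "(\<lambda>m. exp_bump 1 (real m * t - 1)) \<longlonglongrightarrow> 1" if "t > 0" for t
  proof -
    have "filterlim (\<lambda>m. - 1 + real m * t) at_top sequentially"
      by (intro filterlim_tendsto_add_at_top[OF tendsto_const] filterlim_real_sequentially
          filterlim_at_top_mult_tendsto_pos[OF tendsto_const that])
    then have lim: "filterlim (\<lambda>m. real m * t - 1) at_top sequentially" by simp
    have "((\<lambda>s::real. 1 / s) \<longlongrightarrow> 0) at_top"
      by (intro tendsto_divide_0[OF tendsto_const] filterlim_at_top_imp_at_infinity filterlim_ident)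
    from tendsto_exp[OF tendsto_minus[OF this]]
    have "((\<lambda>s::real. exp (- (1 / s))) \<longlongrightarrow> exp (- 0)) at_top" .
    moreover have "\<forall>\<^sub>F s in at_top. exp (- (1 / s)) = exp_bump 1 s"
      using eventually_gt_at_top[of 0] by eventually_elim (simp add: exp_bump_def)
    ultimately have "(exp_bump 1 \<longlongrightarrow> 1) at_top"
      using Lim_transform_eventually by fastforce
    then show ?thesis using lim by (rule filterlim_compose)
  qed
  have "(\<lambda>m. box_bump m a b x) \<longlonglongrightarrow> (\<Prod>i\<in>(UNIV::'a set). 1 * 1)"
    unfolding box_bump_def using assms by (intro tendsto_prod tendsto_mult 1) (auto simp: mem_box_cart)
  then show ?thesis by simp
qed

lemma box_bump_support:
  assumes "m > 0"
  shows "\<exists>c e. {x. box_bump m a b x \<noteq> 0} \<subseteq> cbox c e \<and> cbox c e \<subseteq> box a b"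
proof (intro exI conjI)
  let ?c = "\<chi> i. a $ i + 1 / real m" and ?e = "\<chi> i. b $ i - 1 / real m"
  show "cbox ?c ?e \<subseteq> box a b"
    using assms by (auto simp: mem_box_cart) (smt (verit) divide_pos_pos of_nat_0_less_iff)+
  show "{x. box_bump m a b x \<noteq> 0} \<subseteq> cbox ?c ?e"
  proof
    fix x assume "x \<in> {x. box_bump m a b x \<noteq> 0}"
    then have nz: "exp_bump 1 (real m * (x $ i - a $ i) - 1) \<noteq> 0" "exp_bump 1 (real m * (b $ i - x $ i) - 1) \<noteq> 0" for i
      by (auto simp: box_bump_def)
    have "real m * (x $ i - a $ i) > 1" "real m * (b $ i - x $ i) > 1" for i
      using nz[of i] exp_bump_1(3) by (meson diff_le_0_iff_le not_le)+
    then show "x \<in> cbox ?c ?e"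
      using assms by (auto simp: mem_box_cart field_simps) (smt (verit))+
  qed
qed

lemma prod_le_factor:
  fixes f :: "'i \<Rightarrow> real"
  assumes "finite I" "j \<in> I" "\<And>i. i \<in> I \<Longrightarrow> 0 \<le> f i" "\<And>i. i \<in> I \<Longrightarrow> f i \<le> 1"
  shows "prod f I \<le> f j"
proof -
  have "prod f I = f j * prod f (I - {j})" using assms by (simp add: prod.remove)
  also have "\<dots> \<le> f j * 1"
    using assms by (intro mult_left_mono prod_le_1) auto
  finally show ?thesis by simp
qed

text \<open>An open set is a countable union of open boxes. One minus the product of
  \<open>1 - bump\<close> over the first \<open>m\<close> boxes is supported in finitely many
  compact boxes, and at a point of box \<open>j\<close> the factor with index \<open>j\<close> tends
  to \<open>0\<close> and bounds the product. This needs neither mollification nor distance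
  functions.\<close>

lemma exhaustion_by_test_functions:
  fixes K :: "(real^'d::finite) set"
  assumes "open K" "K \<noteq> {}"
  obtains \<Phi> where "\<And>m::nat. test_function K (\<Phi> m)" "\<And>m x. 0 \<le> \<Phi> m x" "\<And>m x. \<Phi> m x \<le> 1"
    "\<And>x. x \<in> K \<Longrightarrow> (\<lambda>m. \<Phi> m x) \<longlonglongrightarrow> 1"
proof -
  obtain \<D> where \<D>: "countable \<D>" "\<D> \<subseteq> Pow K" "\<And>X. X \<in> \<D> \<Longrightarrow> \<exists>a b. X = box a b" "\<Union>\<D> = K"
    using open_countable_Union_open_box[OF \<open>open K\<close>] by metis
  have ne: "\<D> \<noteq> {}" using \<D>(4) assms by auto
  have "\<exists>a b. from_nat_into \<D> j = box a b" for j
    using \<D>(3) from_nat_into[OF ne] by blast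
  then obtain a b where ab: "\<And>j. from_nat_into \<D> j = box (a j) (b j)" by metis
  have sub: "box (a j) (b j) \<subseteq> K" for j
    using \<D>(2) from_nat_into[OF ne, of j] unfolding ab by blast
  have cover: "\<exists>j. x \<in> box (a j) (b j)" if x: "x \<in> K" for x
  proof -
    obtain X where "X \<in> \<D>" "x \<in> X" using x \<D>(4) by blast
    then show ?thesis using from_nat_into_surj[OF \<D>(1)] ab by metis
  qed
  \<comment> \<open>\<open>Suc m\<close> because the support of a bump is compact in its box only
    for a positive index.\<close>
  define \<psi> where "\<psi> m j x = 1 - box_bump (Suc m) (a j) (b j) x" for m j and x :: "real^'d"
  have \<psi>: "0 \<le> \<psi> m j x" "\<psi> m j x \<le> 1" for m j x
    using box_bump_bounds[of "Suc m" "a j" "b j" x] by (auto simp: \<psi>_def)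
  define \<Phi> where "\<Phi> m x = 1 - (\<Prod>j<m. \<psi> m j x)" for m :: nat and x
  show thesis
  proof (rule that[of \<Phi>])
    show "0 \<le> \<Phi> m x" for m x
      using \<psi> by (auto simp: \<Phi>_def intro!: prod_le_1)
    show "\<Phi> m x \<le> 1" for m x
      using \<psi> by (auto simp: \<Phi>_def intro!: prod_nonneg)
    show "test_function K (\<Phi> m)" for m
      unfolding test_function_def
    proof (intro conjI allI)
      have "\<Phi> m = (\<lambda>x. 1 + (- 1) * (\<Prod>j<m. 1 + (- 1) * box_bump (Suc m) (a j) (b j) x))"
        by (simp add: fun_eq_iff \<Phi>_def \<psi>_def)
      then show "C_k k (\<Phi> m)" for k
        by (simp only:) (intro C_k_add C_k_mult C_k_prod C_k_const C_k_box_bump finite_lessThan)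
      have "\<forall>j. \<exists>Q. {x. box_bump (Suc m) (a j) (b j) x \<noteq> 0} \<subseteq> cbox (fst Q) (snd Q) \<and>
          cbox (fst Q) (snd Q) \<subseteq> box (a j) (b j)"
      proof
        fix j
        obtain c e where "{x. box_bump (Suc m) (a j) (b j) x \<noteq> 0} \<subseteq> cbox c e \<and> cbox c e \<subseteq> box (a j) (b j)"
          using box_bump_support[of "Suc m" "a j" "b j"] by blast
        then show "\<exists>Q. {x. box_bump (Suc m) (a j) (b j) x \<noteq> 0} \<subseteq> cbox (fst Q) (snd Q) \<and>
          cbox (fst Q) (snd Q) \<subseteq> box (a j) (b j)"
          by (intro exI[of _ "(c, e)"]) simp
      qed
      from choice[OF this] obtain Q where
        ce: "\<And>j. {x. box_bump (Suc m) (a j) (b j) x \<noteq> 0} \<subseteq> cbox (fst (Q j)) (snd (Q j))"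
          "\<And>j. cbox (fst (Q j)) (snd (Q j)) \<subseteq> box (a j) (b j)"
        by blast
      let ?C = "\<Union>j<m. cbox (fst (Q j)) (snd (Q j))"
      have C: "compact ?C" by (intro compact_UN finite_lessThan compact_cbox)
      have CK: "?C \<subseteq> K" using ce(2) sub by blast
      have "{x. \<Phi> m x \<noteq> 0} \<subseteq> ?C"
      proof
        fix x assume "x \<in> {x. \<Phi> m x \<noteq> 0}"
        then have "\<exists>j<m. \<psi> m j x \<noteq> 1" by (auto simp: \<Phi>_def intro: ccontr)
        then show "x \<in> ?C" using ce(1) by (auto simp: \<psi>_def)
      qed
      then have cl: "closure {x. \<Phi> m x \<noteq> 0} \<subseteq> ?C"
        using C by (intro closure_minimal compact_imp_closed)
      then show "closure {x. \<Phi> m x \<noteq> 0} \<subseteq> K" using CK by blast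
      show "compact (closure {x. \<Phi> m x \<noteq> 0})"
        using bounded_subset[OF compact_imp_bounded[OF C] cl] by (simp add: compact_eq_bounded_closed)
    qed
    fix x assume "x \<in> K"
    then obtain j where j: "x \<in> box (a j) (b j)" using cover by blast
    have "(\<lambda>m. 1 - box_bump (Suc m) (a j) (b j) x) \<longlonglongrightarrow> 1 - 1"
      using LIMSEQ_Suc[OF tendsto_box_bump[OF j]] by (intro tendsto_diff tendsto_const)
    then have lim: "(\<lambda>m. \<psi> m j x) \<longlonglongrightarrow> 0" by (simp add: \<psi>_def)
    have "(\<lambda>m. \<Prod>j<m. \<psi> m j x) \<longlonglongrightarrow> 0"
    proof (rule tendsto_sandwich[OF _ _ tendsto_const lim])
      show "\<forall>\<^sub>F m in sequentially. 0 \<le> (\<Prod>j<m. \<psi> m j x)"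
        using \<psi> by (intro always_eventually allI prod_nonneg) auto
      show "\<forall>\<^sub>F m in sequentially. (\<Prod>j<m. \<psi> m j x) \<le> \<psi> m j x"
        using eventually_gt_at_top[of j]
        by eventually_elim (intro prod_le_factor \<psi>, auto)
    qed
    then have "(\<lambda>m. 1 - (\<Prod>j<m. \<psi> m j x)) \<longlonglongrightarrow> 1 - 0"
      by (intro tendsto_diff tendsto_const)
    then show "(\<lambda>m. \<Phi> m x) \<longlonglongrightarrow> 1" by (simp add: \<Phi>_def)
  qed
qed

lemma test_function_mult:
  assumes "test_function K \<phi>" "\<And>k. C_k k q"
  shows "test_function K (\<lambda>x. q x * \<phi> x)"
proof -
  have sub: "closure {x. q x * \<phi> x \<noteq> 0} \<subseteq> closure {x. \<phi> x \<noteq> 0}"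
    by (intro closure_mono) auto
  moreover have "compact (closure {x. \<phi> x \<noteq> 0})"
    using assms(1) by (simp add: test_function_def)
  then have "compact (closure {x. q x * \<phi> x \<noteq> 0})"
    using bounded_subset[OF compact_imp_bounded sub] by (simp add: compact_eq_bounded_closed)
  moreover have "\<forall>k. C_k k (\<lambda>x. q x * \<phi> x)"
    using assms C_k_mult unfolding test_function_def by blast
  ultimately show ?thesis
    using assms(1) unfolding test_function_def by blast
qed

subsection \<open>Gradients of test functions\<close>

lemma has_derivative_difference_quotient:
  fixes \<phi> :: "'a::real_normed_vector \<Rightarrow> real"
  assumes D: "(\<phi> has_derivative D) (at x)"
  shows "(\<lambda>m. (\<phi> (x + (1 / real (Suc m)) *\<^sub>R v) - \<phi> x) * real (Suc m)) \<longlonglongrightarrow> D v"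
proof -
  have "((\<lambda>t. x + t *\<^sub>R v) has_derivative (\<lambda>t. t *\<^sub>R v)) (at 0)"
    by (auto intro!: derivative_eq_intros)
  moreover have "(\<phi> has_derivative D) (at (x + 0 *\<^sub>R v))" using D by simp
  ultimately have "((\<lambda>t. \<phi> (x + t *\<^sub>R v)) has_derivative (\<lambda>t. D (t *\<^sub>R v))) (at 0)"
    by (rule has_derivative_compose)
  moreover have "D (t *\<^sub>R v) = D v * t" for t
    using has_derivative_linear[OF D] by (simp add: linear_cmul)
  ultimately have "((\<lambda>t. \<phi> (x + t *\<^sub>R v)) has_real_derivative D v) (at 0)"
    by (simp add: has_field_derivative_def)
  then have "((\<lambda>h. (\<phi> (x + h *\<^sub>R v) - \<phi> x) / h) \<longlongrightarrow> D v) (at 0)"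
    by (simp add: DERIV_def)
  moreover have "filterlim (\<lambda>m. 1 / real (Suc m)) (at 0) sequentially"
    using LIMSEQ_Suc[OF lim_1_over_n[where 'a=real]] by (intro filterlim_atI) auto
  ultimately have "(\<lambda>m. (\<phi> (x + (1 / real (Suc m)) *\<^sub>R v) - \<phi> x) / (1 / real (Suc m))) \<longlonglongrightarrow> D v"
    by (rule filterlim_compose)
  then show ?thesis by (simp del: of_nat_Suc)
qed

lemma test_function_has_derivative:
  assumes "test_function K \<phi>"
  shows "(\<phi> has_derivative (\<lambda>v. gradient \<phi> x \<bullet> v)) (at x)"
proof -
  have "C_k (Suc 0) \<phi>" using assms by (simp only: test_function_def)
  then have D: "(\<phi> has_derivative frechet_derivative \<phi> (at x)) (at x)"
    by (simp add: frechet_derivative_works[symmetric])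
  have "frechet_derivative \<phi> (at x) v = gradient \<phi> x \<bullet> v" for v
  proof -
    have "frechet_derivative \<phi> (at x) v = frechet_derivative \<phi> (at x) (\<Sum>i\<in>UNIV. v $ i *\<^sub>R axis i 1)"
      using basis_expansion[of v] by (simp add: scalar_mult_eq_scaleR)
    also have "\<dots> = (\<Sum>i\<in>UNIV. v $ i * frechet_derivative \<phi> (at x) (axis i 1))"
      using has_derivative_linear[OF D] by (simp add: linear_sum linear_cmul)
    finally show ?thesis
      by (simp add: inner_vec_def gradient_def partial_deriv_def mult.commute)
  qed
  then have "frechet_derivative \<phi> (at x) = (\<lambda>v. gradient \<phi> x \<bullet> v)" by blast
  then show ?thesis using D by simp
qed

lemma test_function_continuous:
  assumes "test_function K \<phi>" shows "continuous_on UNIV \<phi>" "continuous_on UNIV (gradient \<phi>)"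
proof -
  show "continuous_on UNIV \<phi>"
    using assms by (metis test_function_def C_k.simps(1))
  have "C_k (Suc 0) \<phi>" using assms by (simp only: test_function_def)
  then have "continuous_on UNIV (partial_deriv i \<phi>)" for i by simp
  then show "continuous_on UNIV (gradient \<phi>)"
    unfolding gradient_def by (rule continuous_on_vec_lambda)
qed

lemma gradient_outside_support:
  assumes "test_function K \<phi>" "x \<notin> closure {x. \<phi> x \<noteq> 0}"
  shows "gradient \<phi> x = 0"
proof -
  have "((\<lambda>_. 0) has_derivative (\<lambda>_. 0)) (at x)" by simp
  then have "(\<phi> has_derivative (\<lambda>_. 0)) (at x)"
  proof (rule has_derivative_transform_within_open)
    show "open (- closure {x. \<phi> x \<noteq> 0})" by (simp add: open_Compl)
    show "x \<in> - closure {x. \<phi> x \<noteq> 0}" using assms by simp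
    show "0 = \<phi> y" if "y \<in> - closure {x. \<phi> x \<noteq> 0}" for y
    proof -
      have "y \<notin> {x. \<phi> x \<noteq> 0}" using that closure_subset[of "{x. \<phi> x \<noteq> 0}"] by blast
      then show ?thesis by simp
    qed
  qed
  from has_derivative_unique[OF this test_function_has_derivative[OF assms(1)]]
  have "gradient \<phi> x \<bullet> gradient \<phi> x = 0" by metis
  then show ?thesis by simp
qed

lemma test_function_gradient_bounded:
  assumes t: "test_function K \<phi>"
  obtains b where "b \<ge> 0" "\<And>x. norm (gradient \<phi> x) \<le> b"
proof -
  let ?S = "closure {x. \<phi> x \<noteq> 0}"
  have "compact ?S" using t by (simp add: test_function_def)
  then have "bounded (gradient \<phi> ` ?S)"
    by (intro compact_imp_bounded compact_continuous_image continuous_on_subset[OF test_function_continuous(2)[OF t]]) auto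
  then obtain b where b: "\<forall>y\<in>gradient \<phi> ` ?S. norm y \<le> b" unfolding bounded_iff by blast
  have "norm (gradient \<phi> x) \<le> max b 0" for x
  proof (cases "x \<in> ?S")
    case True
    then have "norm (gradient \<phi> x) \<le> b" using b by blast
    then show ?thesis by simp
  qed (simp add: gradient_outside_support[OF t])
  then show thesis using that[of "max b 0"] by simp
qed

lemma test_function_Lipschitz:
  assumes t: "test_function K \<phi>"
  obtains L where "L-lipschitz_on UNIV \<phi>"
proof -
  obtain b where b: "b \<ge> 0" "\<And>x. norm (gradient \<phi> x) \<le> b" using test_function_gradient_bounded[OF t] by blast
  have "b-lipschitz_on UNIV \<phi>"
  proof (rule lipschitz_onI)
    fix x y
    have "norm (\<phi> x - \<phi> y) \<le> b * norm (x - y)"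
    proof (rule differentiable_bound[OF convex_UNIV])
      show "(\<phi> has_derivative (\<lambda>v. gradient \<phi> x \<bullet> v)) (at x within UNIV)" for x
        using test_function_has_derivative[OF t] by simp
      show "onorm (\<lambda>v. gradient \<phi> x \<bullet> v) \<le> b" for x
      proof (rule onorm_le)
        fix v
        show "norm (gradient \<phi> x \<bullet> v) \<le> b * norm v"
          using Cauchy_Schwarz_ineq2[of "gradient \<phi> x" v] mult_right_mono[OF b(2)[of x], of "norm v"] by simp
      qed
    qed auto
    then show "dist (\<phi> x) (\<phi> y) \<le> b * dist x y" by (simp add: dist_norm)
  qed (rule b(1))
  then show thesis using that by blast
qed

subsection \<open>Integration by parts by dilation\<close>

lemma integral_lborel_dilate:
  fixes f :: "'a::euclidean_space \<Rightarrow> real"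
  assumes [measurable]: "f \<in> borel_measurable borel" and s: "s > 0"
  shows "(LINT x|lborel. f (p + s *\<^sub>R (x - p))) = (LINT x|lborel. f x) / s ^ DIM('a)"
proof -
  have "(LINT x|lborel. f x)
      = (LINT x|density (distr lborel borel (\<lambda>x. (p - s *\<^sub>R p) + s *\<^sub>R x)) (\<lambda>_. \<bar>s\<bar>^DIM('a)). f x)"
    using s by (subst lborel_affine[of s "p - s *\<^sub>R p"]) auto
  also have "\<dots> = (LINT x|distr lborel borel (\<lambda>x. (p - s *\<^sub>R p) + s *\<^sub>R x). s ^ DIM('a) * f x)"
    using s by (subst integral_density) auto
  also have "\<dots> = (LINT x|lborel. s ^ DIM('a) * f ((p - s *\<^sub>R p) + s *\<^sub>R x))"
    by (subst integral_distr) auto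
  also have "\<dots> = s ^ DIM('a) * (LINT x|lborel. f (p + s *\<^sub>R (x - p)))"
    by (subst integral_mult_right_zero[symmetric]) (simp add: algebra_simps)
  finally show ?thesis using s by simp
qed

text \<open>By invariance of \<open>G\<close>, the dilated integral is exactly
  \<open>s^(-DIM('a))\<close> times the original one, so only this power is differentiated, giving
  \<open>- DIM('a)\<close>. Boundedness and measurability of \<open>G\<close> suffice: its jumps are
  never differentiated.\<close>

lemma integral_radial_derivative:
  fixes \<phi> \<phi>' G :: "'a::euclidean_space \<Rightarrow> real"
  assumes Lip: "L-lipschitz_on UNIV \<phi>" and S: "bounded S" "\<And>x. x \<notin> S \<Longrightarrow> \<phi> x = 0"
    and G[measurable]: "G \<in> borel_measurable borel" and B: "\<And>x. \<bar>G x\<bar> \<le> B"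
    and hom: "\<And>s x. s > 0 \<Longrightarrow> G (p + s *\<^sub>R (x - p)) = G x"
    and \<phi>'[measurable]: "\<phi>' \<in> borel_measurable borel"
    and lim: "\<And>x. (\<lambda>m. (\<phi> (x + (1 / real (Suc m)) *\<^sub>R (x - p)) - \<phi> x) * real (Suc m)) \<longlonglongrightarrow> \<phi>' x"
  shows "(LINT x|lborel. G x * \<phi>' x) = - real DIM('a) * (LINT x|lborel. G x * \<phi> x)"
proof -
  \<comment> \<open>Only factors above \<open>1\<close> occur: they push points outside
    \<open>cball p r\<close> further out, so all difference quotients share this ball as
    support.\<close>
  define s where "s m = 1 + 1 / real (Suc m)" for m
  have s: "s m > 0" "s m \<ge> 1" for m by (auto simp: s_def add_pos_nonneg)
  have xs: "x + (1 / real (Suc m)) *\<^sub>R (x - p) = p + s m *\<^sub>R (x - p)" for x m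
    by (simp add: s_def algebra_simps)
  have c\<phi>: "continuous_on UNIV \<phi>" using Lip by (rule lipschitz_on_continuous_on)
  then have [measurable]: "\<phi> \<in> borel_measurable borel" by (rule borel_measurable_continuous_onI)
  have L0: "L \<ge> 0" using Lip lipschitz_on_nonneg by blast
  have B0: "B \<ge> 0" using B[of p] by linarith
  obtain r where "\<forall>x\<in>(\<lambda>x. x - p) ` S. norm x \<le> r"
    using bounded_translation_minus[OF S(1), of p] unfolding bounded_iff by blast
  then have Sr: "norm (x - p) \<le> r" if "x \<in> S" for x using that by blast
  have R: "\<phi> x = 0" "\<phi> (p + s m *\<^sub>R (x - p)) = 0" if "x \<notin> cball p r" for x m
  proof -
    have x: "norm (x - p) > r" using that by (simp add: dist_norm norm_minus_commute)
    then show "\<phi> x = 0" using S(2) Sr by force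
    have "norm (x - p) \<le> norm (s m *\<^sub>R (x - p))"
      using s[of m] mult_right_mono[of 1 "s m" "norm (x - p)"] by simp
    then have "p + s m *\<^sub>R (x - p) \<notin> S" using Sr[of "p + s m *\<^sub>R (x - p)"] x by auto
    then show "\<phi> (p + s m *\<^sub>R (x - p)) = 0" by (rule S(2))
  qed
  have "bounded (\<phi> ` cball p r)"
    by (intro compact_imp_bounded compact_continuous_image continuous_on_subset[OF c\<phi>]) auto
  then obtain U where "\<forall>y\<in>\<phi> ` cball p r. norm y \<le> U" unfolding bounded_iff by blast
  then have U: "\<bar>\<phi> x\<bar> \<le> U" if "x \<in> cball p r" for x using that by auto
  have diff: "\<bar>\<phi> (p + s m *\<^sub>R (x - p)) - \<phi> x\<bar> * real (Suc m) \<le> L * r" if x: "x \<in> cball p r" for m x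
  proof -
    have "\<bar>\<phi> (p + s m *\<^sub>R (x - p)) - \<phi> x\<bar> \<le> L * norm ((1 / real (Suc m)) *\<^sub>R (x - p))"
      using lipschitz_onD[OF Lip, of "p + s m *\<^sub>R (x - p)" x] unfolding xs[symmetric] by (simp add: dist_norm)
    then have "\<bar>\<phi> (p + s m *\<^sub>R (x - p)) - \<phi> x\<bar> * real (Suc m)
        \<le> L * norm ((1 / real (Suc m)) *\<^sub>R (x - p)) * real (Suc m)"
      by (rule mult_right_mono) simp
    also have "\<dots> = L * norm (x - p)" by (simp del: of_nat_Suc)
    also have "\<dots> \<le> L * r" using x L0 by (intro mult_left_mono) (auto simp: dist_norm norm_minus_commute)
    finally show ?thesis .
  qed
  have [measurable]: "cball p r \<in> sets borel" by simp
  let ?q = "\<lambda>m x. G x * ((\<phi> (p + s m *\<^sub>R (x - p)) - \<phi> x) * real (Suc m))"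
  have i: "integrable lborel (\<lambda>x. G x * \<phi> x)"
  proof (rule integrable_lborel_bounded_support[of _ "cball p r" "B * U"])
    fix x assume "x \<in> cball p r"
    from U[OF this] show "norm (G x * \<phi> x) \<le> B * U"
      unfolding real_norm_def abs_mult using B[of x] B0 by (intro mult_mono) auto
  qed (auto simp: R)
  have iq: "norm (?q m x) \<le> B * (L * r)" if "x \<in> cball p r" for m x
    unfolding real_norm_def abs_mult abs_of_nat
    by (rule mult_mono[OF B diff[OF that] B0]) simp
  have intq: "integrable lborel (?q m)" for m
    by (rule integrable_lborel_bounded_support[of _ "cball p r" "B * (L * r)"]) (use iq R in auto)
  have "(LINT x|lborel. ?q m x) = (1 / s m ^ DIM('a) - 1) * real (Suc m) * (LINT x|lborel. G x * \<phi> x)" for m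
  proof -
    have q: "?q m x = real (Suc m) * ((\<lambda>x. G x * \<phi> x) (p + s m *\<^sub>R (x - p)) - G x * \<phi> x)" for x
      using hom[OF s(1)[of m]] by (simp add: algebra_simps)
    \<comment> \<open>The dilated product is recovered from the quotient \<open>?q m\<close>, whose
      integrability is already known.\<close>
    have i2: "integrable lborel (\<lambda>x. (\<lambda>x. G x * \<phi> x) (p + s m *\<^sub>R (x - p)))"
    proof -
      have "(\<lambda>x. (1 / real (Suc m)) * ?q m x + G x * \<phi> x) = (\<lambda>x. (\<lambda>x. G x * \<phi> x) (p + s m *\<^sub>R (x - p)))"
        using hom[OF s(1)[of m]] by (auto simp: fun_eq_iff algebra_simps simp del: of_nat_Suc)
      moreover have "integrable lborel (\<lambda>x. (1 / real (Suc m)) * ?q m x + G x * \<phi> x)"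
        using intq i by (intro Bochner_Integration.integrable_add integrable_mult_right)
      ultimately show ?thesis by simp
    qed
    have "(LINT x|lborel. ?q m x)
        = real (Suc m) * ((LINT x|lborel. (\<lambda>x. G x * \<phi> x) (p + s m *\<^sub>R (x - p))) - (LINT x|lborel. G x * \<phi> x))"
      unfolding q using Bochner_Integration.integral_diff[OF i2 i] by (simp del: of_nat_Suc)
    also have "(LINT x|lborel. (\<lambda>x. G x * \<phi> x) (p + s m *\<^sub>R (x - p))) = (LINT x|lborel. G x * \<phi> x) / s m ^ DIM('a)"
      by (rule integral_lborel_dilate[OF _ s(1)]) measurable
    finally show ?thesis by (simp add: algebra_simps)
  qed
  moreover have "(\<lambda>m. (1 / s m ^ DIM('a) - 1) * real (Suc m)) \<longlonglongrightarrow> - real DIM('a)"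
  proof -
    have "((\<lambda>x::real. 1 / x ^ DIM('a)) has_real_derivative - real DIM('a)) (at 1)"
      by (auto intro!: derivative_eq_intros)
    from has_derivative_difference_quotient[where v=1, OF this[unfolded has_field_derivative_def]]
    show ?thesis by (simp add: s_def del: of_nat_Suc)
  qed
  ultimately have 1: "(\<lambda>m. LINT x|lborel. ?q m x) \<longlonglongrightarrow> - real DIM('a) * (LINT x|lborel. G x * \<phi> x)"
    by (simp only:) (intro tendsto_mult tendsto_const)
  have "(\<lambda>m. LINT x|lborel. ?q m x) \<longlonglongrightarrow> (LINT x|lborel. G x * \<phi>' x)"
  proof (rule integral_dominated_convergence[where w="\<lambda>x. indicator (cball p r) x * (B * (L * r))"])
    show "AE x in lborel. (\<lambda>m. ?q m x) \<longlonglongrightarrow> G x * \<phi>' x"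
      using lim unfolding xs by (intro always_eventually allI tendsto_mult_left)
    show "integrable lborel (\<lambda>x. indicator (cball p r) x * (B * (L * r)))"
      by (rule integrable_lborel_bounded_support[of _ "cball p r" "\<bar>B * (L * r)\<bar>"]) auto
    have "norm (?q m x) \<le> indicator (cball p r) x * (B * (L * r))" for m x
      using iq[of x m] R(1)[of x] R(2)[of x m] by (cases "x \<in> cball p r") (simp_all del: of_nat_Suc)
    then show "AE x in lborel. norm (?q m x) \<le> indicator (cball p r) x * (B * (L * r))" for m by simp
  qed measurable
  from LIMSEQ_unique[OF this 1] show ?thesis .
qed

subsection \<open>Divergences in the sense of distributions\<close>

lemma L2_on_imp_set_integrable:
  fixes g :: "'a::euclidean_space \<Rightarrow> 'b::euclidean_space"
  assumes g: "L2_on K g" and K: "K \<in> sets lebesgue" "emeasure lebesgue K < \<infinity>"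
  shows "set_integrable lebesgue K g"
proof -
  have i: "set_integrable lebesgue K (\<lambda>x. 1 + (norm (g x))\<^sup>2)"
    using g K unfolding L2_on_def
    by (intro set_integral_add(1)) (simp_all add: set_integrable_def integrable_indicator_iff)
  show ?thesis unfolding set_integrable_def
  proof (rule Bochner_Integration.integrable_bound[OF i[unfolded set_integrable_def]])
    show "(\<lambda>x. indicator K x *\<^sub>R g x) \<in> borel_measurable lebesgue"
      using g by (simp add: L2_on_def set_borel_measurable_def)
    have "t \<le> 1 + t\<^sup>2" for t :: real
      using zero_le_power2[of "t - 1/2"] by (simp add: power2_eq_square algebra_simps)
    then show "AE x in lebesgue. norm (indicator K x *\<^sub>R g x) \<le> norm (indicator K x *\<^sub>R (1 + (norm (g x))\<^sup>2))"
      by (auto simp: indicator_def)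
  qed
qed

text \<open>A representative is arbitrary on a null set, so its measurability is only available for
  the completed measure.\<close>

lemma L2_on_AE_bounded:
  fixes f h :: "'a::euclidean_space \<Rightarrow> 'b::euclidean_space"
  assumes ae: "AE x in lebesgue. x \<in> K \<longrightarrow> f x = h x" and h[measurable]: "h \<in> borel_measurable borel"
    and b: "\<And>x. x \<in> K \<Longrightarrow> norm (h x) \<le> b" and K: "bounded K" and K'[measurable]: "K \<in> sets borel"
  shows "L2_on K f"
proof -
  have m: "(\<lambda>x. indicator K x *\<^sub>R h x) \<in> borel_measurable lebesgue"
    by (rule measurable_completion) measurable
  have ae1: "AE x in lebesgue. indicator K x *\<^sub>R h x = indicator K x *\<^sub>R f x"
    using ae by eventually_elim (auto simp: indicator_def)
  have mf: "(\<lambda>x. indicator K x *\<^sub>R f x) \<in> borel_measurable lebesgue"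
    by (rule borel_measurable_AE[OF m ae1])
  have "integrable lborel (\<lambda>x. indicator K x *\<^sub>R (norm (h x))\<^sup>2)"
  proof (rule integrable_lborel_bounded_support[OF _ K, where B="b\<^sup>2"])
    show "norm (indicator K x *\<^sub>R (norm (h x))\<^sup>2) \<le> b\<^sup>2" if "x \<in> K" for x
      using b[OF that] that by (simp add: power_mono)
  qed auto
  then have "integrable lebesgue (\<lambda>x. indicator K x *\<^sub>R (norm (h x))\<^sup>2)"
    by (subst integrable_completion) auto
  moreover have "(\<lambda>x. indicator K x *\<^sub>R (norm (f x))\<^sup>2) = (\<lambda>x. (norm (indicator K x *\<^sub>R f x))\<^sup>2)"
    by (auto simp: indicator_def fun_eq_iff)
  then have "(\<lambda>x. indicator K x *\<^sub>R (norm (f x))\<^sup>2) \<in> borel_measurable lebesgue"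
    using borel_measurable_power[OF measurable_compose[OF mf borel_measurable_norm], of 2] by (simp only:)
  moreover have "AE x in lebesgue. indicator K x *\<^sub>R (norm (h x))\<^sup>2 = indicator K x *\<^sub>R (norm (f x))\<^sup>2"
    using ae by eventually_elim (auto simp: indicator_def)
  ultimately have "integrable lebesgue (\<lambda>x. indicator K x *\<^sub>R (norm (f x))\<^sup>2)"
    by (rule integrable_cong_AE_imp)
  then show ?thesis using mf by (simp add: L2_on_def set_borel_measurable_def set_integrable_def)
qed

lemma set_integrable_bounded_mult:
  fixes g :: "'a::euclidean_space \<Rightarrow> real" and q :: "'a \<Rightarrow> 'b::euclidean_space"
  assumes g: "set_integrable lebesgue K g" and q[measurable]: "q \<in> borel_measurable borel"
    and b: "\<And>x. x \<in> K \<Longrightarrow> norm (q x) \<le> b"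
  shows "set_integrable lebesgue K (\<lambda>x. g x *\<^sub>R q x)"
  unfolding set_integrable_def
proof (rule Bochner_Integration.integrable_bound)
  show "integrable lebesgue (\<lambda>x. b * (indicator K x *\<^sub>R g x))"
    using g unfolding set_integrable_def by (rule integrable_mult_right)
  have q': "q \<in> borel_measurable lebesgue" by (rule measurable_completion) simp
  have "(\<lambda>x. (indicator K x *\<^sub>R g x) *\<^sub>R q x) \<in> borel_measurable lebesgue"
    using g unfolding set_integrable_def
    by (intro borel_measurable_scaleR q' borel_measurable_integrable)
  then show "(\<lambda>x. indicator K x *\<^sub>R g x *\<^sub>R q x) \<in> borel_measurable lebesgue" by simp
  show "AE x in lebesgue. norm (indicator K x *\<^sub>R g x *\<^sub>R q x) \<le> norm (b * (indicator K x *\<^sub>R g x))"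
  proof (rule AE_I2)
    fix x
    show "norm (indicator K x *\<^sub>R g x *\<^sub>R q x) \<le> norm (b * (indicator K x *\<^sub>R g x))"
    proof (cases "x \<in> K")
      case True
      have "norm (q x) \<le> \<bar>b\<bar>" using b[OF True] by linarith
      then have "\<bar>g x\<bar> * norm (q x) \<le> \<bar>g x\<bar> * \<bar>b\<bar>" by (rule mult_left_mono) simp
      then show ?thesis using True by (simp add: abs_mult mult.commute)
    qed simp
  qed
qed

lemma affine_bounded_on:
  fixes K :: "'a::real_inner set" assumes "bounded K"
  obtains B where "\<And>x. x \<in> K \<Longrightarrow> \<bar>a \<bullet> x + b\<bar> \<le> B"
proof -
  obtain r where r: "\<And>x. x \<in> K \<Longrightarrow> norm x \<le> r" using assms unfolding bounded_iff by blast
  have "\<bar>a \<bullet> x + b\<bar> \<le> norm a * r + \<bar>b\<bar>" if "x \<in> K" for x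
    using Cauchy_Schwarz_ineq2[of a x] mult_left_mono[OF r[OF that], of "norm a"] by simp
  then show thesis using that by blast
qed

text \<open>Affine functions are not test functions, but they are bounded limits of test functions on \<open>K\<close>.\<close>

lemma integral_affine_divergence_unique:
  fixes K :: "(real^'d::finite) set"
  assumes K: "open K" "bounded K"
    and g: "has_L2_divergence K f g" and g': "has_L2_divergence K f g'"
  shows "(LINT x:K|lebesgue. (a \<bullet> x + b) * g x) = (LINT x:K|lebesgue. (a \<bullet> x + b) * g' x)"
proof (cases "K = {}")
  case False
  define q where "q x = a \<bullet> x + b" for x
  obtain B where B: "\<And>x. x \<in> K \<Longrightarrow> \<bar>q x\<bar> \<le> B"
    using affine_bounded_on[OF K(2), of a b] unfolding q_def by blast
  have Kl: "K \<in> sets lebesgue" "emeasure lebesgue K < \<infinity>"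
    using K emeasure_bounded_finite[of K] by (simp_all add: less_top)
  have qm: "q \<in> borel_measurable borel"
    unfolding q_def by (intro borel_measurable_continuous_onI continuous_intros)
  obtain \<Phi> where \<Phi>: "\<And>m::nat. test_function K (\<Phi> m)" "\<And>m x. 0 \<le> \<Phi> m x" "\<And>m x. \<Phi> m x \<le> 1"
    "\<And>x. x \<in> K \<Longrightarrow> (\<lambda>m. \<Phi> m x) \<longlonglongrightarrow> 1"
    using exhaustion_by_test_functions[OF K(1) False] by blast
  have t: "test_function K (\<lambda>x. q x * \<Phi> m x)" for m
    unfolding q_def by (rule test_function_mult[OF \<Phi>(1) C_k_affine])
  have lim: "(\<lambda>m. LINT x:K|lebesgue. h x * (q x * \<Phi> m x)) \<longlonglongrightarrow> (LINT x:K|lebesgue. q x * h x)"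
    if h: "L2_on K h" for h :: "real^'d \<Rightarrow> real"
    unfolding set_lebesgue_integral_def
  proof (rule integral_dominated_convergence)
    have i: "set_integrable lebesgue K (\<lambda>x. h x *\<^sub>R q x)"
      by (rule set_integrable_bounded_mult[OF L2_on_imp_set_integrable[OF h Kl] qm, of B]) (simp add: B)
    then have i': "integrable lebesgue (\<lambda>x. indicator K x *\<^sub>R (q x * h x))"
      by (simp add: set_integrable_def mult.commute)
    then show "integrable lebesgue (\<lambda>x. norm (indicator K x *\<^sub>R (q x * h x)))"
      by (rule integrable_norm)
    show m: "(\<lambda>x. indicator K x *\<^sub>R (q x * h x)) \<in> borel_measurable lebesgue"
      using i' by (rule borel_measurable_integrable)
    have "(\<lambda>x. (indicator K x *\<^sub>R (q x * h x)) * \<Phi> m x) \<in> borel_measurable lebesgue" for m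
      using test_function_continuous(1)[OF \<Phi>(1)]
      by (intro borel_measurable_times m measurable_completion) (simp add: borel_measurable_continuous_onI)
    then show "(\<lambda>x. indicator K x *\<^sub>R (h x * (q x * \<Phi> m x))) \<in> borel_measurable lebesgue" for m
      by (simp add: mult_ac)
    show "AE x in lebesgue. (\<lambda>m. indicator K x *\<^sub>R (h x * (q x * \<Phi> m x))) \<longlonglongrightarrow> indicator K x *\<^sub>R (q x * h x)"
    proof (rule AE_I2)
      fix x
      show "(\<lambda>m. indicator K x *\<^sub>R (h x * (q x * \<Phi> m x))) \<longlonglongrightarrow> indicator K x *\<^sub>R (q x * h x)"
      proof (cases "x \<in> K")
        case True
        have "(\<lambda>m. h x * (q x * \<Phi> m x)) \<longlonglongrightarrow> h x * (q x * 1)"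
          by (intro tendsto_mult tendsto_const \<Phi>(4)[OF True])
        then show ?thesis using True by (simp add: mult.commute)
      qed simp
    qed
    show "AE x in lebesgue. norm (indicator K x *\<^sub>R (h x * (q x * \<Phi> m x))) \<le> norm (indicator K x *\<^sub>R (q x * h x))" for m
    proof (rule AE_I2)
      fix x
      have "\<bar>q x * h x\<bar> * \<bar>\<Phi> m x\<bar> \<le> \<bar>q x * h x\<bar> * 1"
        using \<Phi>(2,3)[of m x] by (intro mult_left_mono) auto
      then show "norm (indicator K x *\<^sub>R (h x * (q x * \<Phi> m x))) \<le> norm (indicator K x *\<^sub>R (q x * h x))"
        by (simp add: indicator_def abs_mult mult_ac)
    qed
  qed
  have "(LINT x:K|lebesgue. g x * (q x * \<Phi> m x)) = (LINT x:K|lebesgue. g' x * (q x * \<Phi> m x))" for m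
  proof -
    have "(LINT x:K|lebesgue. h x * (q x * \<Phi> m x)) = - (LINT x:K|lebesgue. f x \<bullet> gradient (\<lambda>x. q x * \<Phi> m x) x)"
      if "has_L2_divergence K f h" for h
      using that t[of m] unfolding has_L2_divergence_def by blast
    from this[OF g] this[OF g'] show ?thesis by simp
  qed
  note eq = this
  have L2: "L2_on K g" "L2_on K g'" using g g' unfolding has_L2_divergence_def by blast+
  have "(LINT x:K|lebesgue. q x * g x) = (LINT x:K|lebesgue. q x * g' x)"
    by (rule LIMSEQ_unique[OF lim[OF L2(1), unfolded eq] lim[OF L2(2)]])
  then show ?thesis by (simp add: q_def)
qed (simp add: set_lebesgue_integral_def)

text \<open>The translation identity with constant weight; it shows that the constant part of the
  field has no divergence.\<close>

lemma integral_gradient_zero: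
  assumes t: "test_function K \<phi>"
  shows "(LINT x|lborel. gradient \<phi> x \<bullet> e) = 0"
proof -
  obtain L where L: "L-lipschitz_on UNIV \<phi>" using test_function_Lipschitz[OF t] by blast
  let ?S = "closure {x. \<phi> x \<noteq> 0}"
  have S: "bounded ?S" "\<And>x. x \<notin> ?S \<Longrightarrow> \<phi> x = 0"
    using t closure_subset[of "{x. \<phi> x \<noteq> 0}"] by (auto simp: test_function_def compact_imp_bounded)
  have m: "(\<lambda>x. gradient \<phi> x \<bullet> e) \<in> borel_measurable borel"
    by (intro borel_measurable_continuous_onI continuous_intros test_function_continuous(2)[OF t])
  have "(LINT x|lborel. (1 + 0 \<bullet> (x - 0)) * (gradient \<phi> x \<bullet> e)) = - (0 \<bullet> e) * (LINT x|lborel. \<phi> x)"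
    by (rule integral_affine_mult_directional_derivative[OF L S m AE_I2])
       (simp, rule has_derivative_difference_quotient[OF test_function_has_derivative[OF t]])
  then show ?thesis by simp
qed

subsection \<open>The flux reconstruction\<close>

locale flux_cell = star_cell K \<E> n p
  for K :: "(real^'d::finite) set" and \<E> n p +
  fixes \<Lambda> :: "real^'d^'d"
  assumes \<Lambda>_pos: "\<And>v. v \<noteq> 0 \<Longrightarrow> v \<bullet> (\<Lambda> *v v) > 0"
begin

abbreviation V where "V F \<equiv> \<Lambda> *v flux_gradient K \<E> p \<Lambda> F"
abbreviation R where "R F \<equiv> flux_residual K \<E> p \<Lambda> n F"
abbreviation vol where "vol \<equiv> measure lborel K"

lemma measure_lebesgue_K: "measure lebesgue K = vol"
  by simp

lemma vol_pos: "vol > 0"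
proof -
  have "measure lebesgue K \<noteq> 0"
    using open_not_negligible[OF open_K K_ne] open_K bounded_K
    by (simp add: negligible_iff_measure lmeasurable_open)
  then show ?thesis using measure_nonneg[of lborel K] by (simp add: less_le)
qed

lemma \<Lambda>_bij: "bij ((*v) \<Lambda>)"
proof -
  have "inj ((*v) \<Lambda>)"
    unfolding linear_injective_0[OF matrix_vector_mul_linear]
    using \<Lambda>_pos by (metis inner_zero_right less_irrefl)
  then show ?thesis
    by (simp add: bij_def linear_injective_imp_surjective)
qed

text \<open>Bijectivity of \<open>\<Lambda>\<close> and positive volume make the definite
  description meaningful. From here on \<open>\<Lambda>\<close> enters only through the vector
  \<open>V F\<close>.\<close>

lemma V_eq: "vol *\<^sub>R V F = - (\<Sum>\<sigma>\<in>\<E>. (face_measure \<sigma> * F \<sigma>) *\<^sub>R (face_center \<sigma> - p))" (is "_ = ?r")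
proof -
  obtain v where v: "(1 / vol) *\<^sub>R ?r = \<Lambda> *v v" using bij_is_surj[OF \<Lambda>_bij] by (rule surjE)
  have "\<exists>!v. measure lebesgue K *\<^sub>R (\<Lambda> *v v) = ?r"
  proof
    show "measure lebesgue K *\<^sub>R (\<Lambda> *v v) = ?r"
      unfolding v[symmetric] measure_lebesgue_K using vol_pos by simp
    fix u assume "measure lebesgue K *\<^sub>R (\<Lambda> *v u) = ?r"
    then have "measure lebesgue K *\<^sub>R (\<Lambda> *v u) = measure lebesgue K *\<^sub>R (\<Lambda> *v v)"
      unfolding v[symmetric] measure_lebesgue_K using vol_pos by simp
    then have "\<Lambda> *v u = \<Lambda> *v v" using vol_pos unfolding measure_lebesgue_K by simp
    then show "u = v" using \<Lambda>_bij by (simp add: bij_def inj_eq)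
  qed
  from theI'[OF this] show ?thesis
    unfolding flux_gradient_def measure_lebesgue_K .
qed

lemma V_inner: "vol * (a \<bullet> V F) = - (\<Sum>\<sigma>\<in>\<E>. face_measure \<sigma> * F \<sigma> * (a \<bullet> (face_center \<sigma> - p)))"
  using arg_cong[OF V_eq[of F], of "(\<bullet>) a"] by (simp add: inner_sum_right inner_diff_right)

text \<open>On the face, \<open>(x - p) \<bullet> n \<sigma>\<close> is the constant
  \<open>d \<sigma>\<close>, so the normal component is the residual minus
  \<open>V F \<bullet> n \<sigma>\<close>, which is \<open>F \<sigma>\<close> by definition of the
  residual.\<close>

lemma flux_affine_normal:
  assumes \<sigma>: "\<sigma> \<in> \<E>" and x: "x \<in> \<sigma>"
  shows "flux_affine K \<E> p \<Lambda> n F \<sigma> x \<bullet> n \<sigma> = F \<sigma>"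
proof -
  have "(x - p) \<bullet> n \<sigma> = d \<sigma>" using face_dist_eq[OF \<sigma> x] by (simp add: inner_commute)
  then show ?thesis
    using d_pos[OF \<sigma>] by (simp add: flux_affine_def flux_residual_def inner_add_left inner_diff_left)
qed

lemma sum_residual: "(\<Sum>\<sigma>\<in>\<E>. face_measure \<sigma> * R F \<sigma>) = (\<Sum>\<sigma>\<in>\<E>. face_measure \<sigma> * F \<sigma>)"
  using sum_normals[of "V F"]
  by (simp add: flux_residual_def distrib_left sum.distrib inner_commute)

text \<open>This cancellation is the purpose of the definition of \<open>V\<close>: the moment of
  the fluxes is \<open>- |K| (a \<bullet> V F)\<close>, while the second face identity contributes
  \<open>+ |K| (a \<bullet> V F)\<close>.\<close>

lemma sum_residual_moment: "(\<Sum>\<sigma>\<in>\<E>. face_measure \<sigma> * R F \<sigma> * (a \<bullet> (face_center \<sigma> - p))) = 0"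
proof -
  have "(\<Sum>\<sigma>\<in>\<E>. face_measure \<sigma> * R F \<sigma> * (a \<bullet> (face_center \<sigma> - p)))
    = (\<Sum>\<sigma>\<in>\<E>. face_measure \<sigma> * F \<sigma> * (a \<bullet> (face_center \<sigma> - p)))
      + (\<Sum>\<sigma>\<in>\<E>. face_measure \<sigma> * (n \<sigma> \<bullet> V F) * (a \<bullet> (face_center \<sigma> - p)))"
    by (simp add: flux_residual_def distrib_left distrib_right sum.distrib inner_commute)
  then show ?thesis using V_inner[of a F] sum_normals_moment[of "V F" a] by (simp add: mult.commute)
qed

text \<open>Full cones make this invariant under all dilations about \<open>p\<close>, on the whole
  space; on the truncated cones it is the residual over the distance.\<close>

definition slope :: "((real^'d) set \<Rightarrow> real) \<Rightarrow> real^'d \<Rightarrow> real" where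
  "slope F x = (\<Sum>\<sigma>\<in>\<E>. indicator (full_cone \<sigma>) x * (R F \<sigma> / d \<sigma>))"

text \<open>A Borel representative defined everywhere; statements about arbitrary representatives
  are reduced to it almost everywhere.\<close>

definition field :: "((real^'d) set \<Rightarrow> real) \<Rightarrow> real^'d \<Rightarrow> real^'d" where
  "field F x = - V F + slope F x *\<^sub>R (x - p)"

lemma slope_cone:
  assumes \<sigma>: "\<sigma> \<in> \<E>" and x: "x \<in> open_cone p \<sigma>"
  shows "slope F x = R F \<sigma> / d \<sigma>"
proof -
  have "x \<in> K" using open_cone_subset[OF \<sigma>] x by blast
  then have "slope F x = (\<Sum>\<sigma>\<in>\<E>. indicator (open_cone p \<sigma>) x *\<^sub>R (R F \<sigma> / d \<sigma>))"
    unfolding slope_def by (intro sum.cong refl) (simp add: open_cone_eq indicator_def)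
  then show ?thesis by (simp only: sum_cones_at[OF \<sigma> x])
qed

lemma field_cone:
  "\<sigma> \<in> \<E> \<Longrightarrow> x \<in> open_cone p \<sigma> \<Longrightarrow> field F x = flux_affine K \<E> p \<Lambda> n F \<sigma> x"
  by (simp add: field_def slope_cone flux_affine_def)

lemma slope_dilate: "s > 0 \<Longrightarrow> slope F (p + s *\<^sub>R (x - p)) = slope F x"
  by (simp add: slope_def indicator_def full_cone_scale)

lemma slope_borel [measurable]: "slope F \<in> borel_measurable borel"
  unfolding slope_def
  using borel_full_cone by (intro borel_measurable_sum borel_measurable_times borel_measurable_indicator) auto

lemma field_borel [measurable]: "field F \<in> borel_measurable borel"
  unfolding field_def by measurable

lemma slope_bounded: "\<bar>slope F x\<bar> \<le> (\<Sum>\<sigma>\<in>\<E>. \<bar>R F \<sigma> / d \<sigma>\<bar>)"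
  unfolding slope_def
  by (rule order_trans[OF sum_abs]) (intro sum_mono, simp add: indicator_def)

lemma AE_cones_K: "AE x in lebesgue. x \<in> K \<longrightarrow> (\<exists>\<sigma>\<in>\<E>. x \<in> open_cone p \<sigma>)"
  using AE_completion[OF AE_cones]
proof eventually_elim
  case (elim x)
  then show ?case using closure_subset[of K] by blast
qed

lemma is_flux_reconstruction_field: "is_flux_reconstruction K \<E> p \<Lambda> n F (field F)"
  unfolding is_flux_reconstruction_def using field_cone by (intro ballI AE_I2 impI) blast

lemma reconstruction_AE:
  assumes "is_flux_reconstruction K \<E> p \<Lambda> n F f"
  shows "AE x in lebesgue. x \<in> K \<longrightarrow> f x = field F x"
proof -
  have "AE x in lebesgue. \<forall>\<sigma>\<in>\<E>. x \<in> open_cone p \<sigma> \<longrightarrow> f x = flux_affine K \<E> p \<Lambda> n F \<sigma> x"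
    using assms unfolding is_flux_reconstruction_def by (intro AE_finite_allI finite_E) blast
  with AE_cones_K show ?thesis
    by eventually_elim (metis field_cone)
qed

lemma field_bounded: "\<exists>b. \<forall>x\<in>K. norm (field F x) \<le> b"
proof -
  obtain r where r: "\<And>x. x \<in> K \<Longrightarrow> norm (x - p) \<le> r"
    using bounded_K unfolding bounded_any_center[where a=p] by (metis dist_norm norm_minus_commute)
  let ?B = "\<Sum>\<sigma>\<in>\<E>. \<bar>R F \<sigma> / d \<sigma>\<bar>"
  have "norm (field F x) \<le> norm (V F) + ?B * r" if "x \<in> K" for x
  proof -
    have "norm (field F x) \<le> norm (- V F) + norm (slope F x *\<^sub>R (x - p))"
      unfolding field_def by (rule norm_triangle_ineq)
    also have "norm (slope F x *\<^sub>R (x - p)) \<le> ?B * r"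
      unfolding norm_scaleR using slope_bounded r[OF that]
      by (rule mult_mono) (auto intro: sum_nonneg)
    finally show ?thesis by simp
  qed
  then show ?thesis by blast
qed

lemma L2_on_reconstruction:
  assumes "is_flux_reconstruction K \<E> p \<Lambda> n F f" shows "L2_on K f"
proof -
  obtain b where "\<forall>x\<in>K. norm (field F x) \<le> b" using field_bounded by blast
  then show ?thesis
    by (intro L2_on_AE_bounded[OF reconstruction_AE[OF assms] field_borel _ bounded_K K_borel, of b]) blast
qed

text \<open>The constant part disappears by translation invariance; in the radial part, the
  derivative of the test function along \<open>x - p\<close> is what dilation integrates by
  parts.\<close>

lemma integral_field_gradient:
  assumes t: "test_function K \<phi>"
  shows "(LINT x|lborel. field F x \<bullet> gradient \<phi> x) = - real CARD('d) * (LINT x|lborel. slope F x * \<phi> x)"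
proof -
  let ?S = "closure {x. \<phi> x \<noteq> 0}"
  have S: "bounded ?S" "\<And>x. x \<notin> ?S \<Longrightarrow> \<phi> x = 0"
    using t closure_subset[of "{x. \<phi> x \<noteq> 0}"] by (auto simp: test_function_def compact_imp_bounded)
  obtain L where L: "L-lipschitz_on UNIV \<phi>" using test_function_Lipschitz[OF t] by blast
  have c: "continuous_on UNIV (gradient \<phi>)" by (rule test_function_continuous(2)[OF t])
  have gm[measurable]: "gradient \<phi> \<in> borel_measurable borel" using c by (rule borel_measurable_continuous_onI)
  obtain b where b: "b \<ge> 0" "\<And>x. norm (gradient \<phi> x) \<le> b"
    using test_function_gradient_bounded[OF t] by blast
  obtain r where r: "\<And>x. x \<in> ?S \<Longrightarrow> norm (x - p) \<le> r"
    using S(1) unfolding bounded_any_center[where a=p] by (metis dist_norm norm_minus_commute)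
  let ?B = "\<Sum>\<sigma>\<in>\<E>. \<bar>R F \<sigma> / d \<sigma>\<bar>"
  have i1: "integrable lborel (\<lambda>x. gradient \<phi> x \<bullet> V F)"
  proof (rule integrable_lborel_bounded_support[OF _ S(1), where B="b * norm (V F)"])
    show "norm (gradient \<phi> x \<bullet> V F) \<le> b * norm (V F)" for x
      using Cauchy_Schwarz_ineq2[of "gradient \<phi> x" "V F"] mult_right_mono[OF b(2)[of x], of "norm (V F)"] by simp
  qed (auto simp: gradient_outside_support[OF t])
  have i2: "integrable lborel (\<lambda>x. slope F x * (gradient \<phi> x \<bullet> (x - p)))"
  proof (rule integrable_lborel_bounded_support[OF _ S(1), where B="?B * (b * r)"])
    fix x assume x: "x \<in> ?S"
    have "\<bar>gradient \<phi> x \<bullet> (x - p)\<bar> \<le> norm (gradient \<phi> x) * norm (x - p)" by (rule Cauchy_Schwarz_ineq2)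
    also have "\<dots> \<le> b * r" using b r[OF x] by (intro mult_mono) auto
    finally show "norm (slope F x * (gradient \<phi> x \<bullet> (x - p))) \<le> ?B * (b * r)"
      unfolding real_norm_def abs_mult using slope_bounded by (intro mult_mono) (auto intro: sum_nonneg)
  qed (auto simp: gradient_outside_support[OF t])
  have "(LINT x|lborel. field F x \<bullet> gradient \<phi> x)
      = (LINT x|lborel. slope F x * (gradient \<phi> x \<bullet> (x - p)) - gradient \<phi> x \<bullet> V F)"
    by (intro Bochner_Integration.integral_cong refl)
       (simp add: field_def inner_add_left inner_diff_left inner_commute[of _ "gradient \<phi> _"]
          inner_diff_right inner_add_right)
  also have "\<dots> = (LINT x|lborel. slope F x * (gradient \<phi> x \<bullet> (x - p)))"
    using i1 i2 by (simp add: integral_gradient_zero[OF t])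
  also have "\<dots> = - real DIM(real^'d) * (LINT x|lborel. slope F x * \<phi> x)"
  proof (rule integral_radial_derivative[OF L S slope_borel slope_bounded slope_dilate])
    show "(\<lambda>x. gradient \<phi> x \<bullet> (x - p)) \<in> borel_measurable borel" by measurable
    show "(\<lambda>m. (\<phi> (x + (1 / real (Suc m)) *\<^sub>R (x - p)) - \<phi> x) * real (Suc m))
        \<longlonglongrightarrow> gradient \<phi> x \<bullet> (x - p)" for x
      by (rule has_derivative_difference_quotient[OF test_function_has_derivative[OF t]])
  qed
  finally show ?thesis by simp
qed

text \<open>Formally the divergence of \<open>c (x - p)\<close> is \<open>c\<close> times the
  dimension. As test functions and their gradients vanish off \<open>K\<close>, integrals over
  \<open>K\<close> can be taken over the whole space, where \<open>field\<close> and
  \<open>slope\<close> live.\<close>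

lemma has_L2_divergence_reconstruction:
  assumes f: "is_flux_reconstruction K \<E> p \<Lambda> n F f"
  shows "has_L2_divergence K f (\<lambda>x. real CARD('d) * slope F x)"
  unfolding has_L2_divergence_def
proof (intro conjI allI impI L2_on_reconstruction[OF f])
  show "L2_on K (\<lambda>x. real CARD('d) * slope F x)"
  proof (rule L2_on_AE_bounded[OF _ _ _ bounded_K K_borel])
    show "norm (real CARD('d) * slope F x) \<le> real CARD('d) * (\<Sum>\<sigma>\<in>\<E>. \<bar>R F \<sigma> / d \<sigma>\<bar>)" for x
      using slope_bounded[of F x] by (simp add: abs_mult)
  qed auto
  fix \<phi> assume t: "test_function K \<phi>"
  have \<phi>0: "\<phi> x = 0" "gradient \<phi> x = 0" if "x \<notin> K" for x
  proof -
    have x: "x \<notin> closure {x. \<phi> x \<noteq> 0}" using t that by (auto simp: test_function_def)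
    then show "gradient \<phi> x = 0" by (rule gradient_outside_support[OF t])
    show "\<phi> x = 0" using x closure_subset[of "{x. \<phi> x \<noteq> 0}"] by blast
  qed
  have [measurable]: "gradient \<phi> \<in> borel_measurable borel" "\<phi> \<in> borel_measurable borel"
    using test_function_continuous[OF t] by (auto intro: borel_measurable_continuous_onI)
  have ae: "AE x in lebesgue. indicator K x *\<^sub>R (f x \<bullet> gradient \<phi> x) = field F x \<bullet> gradient \<phi> x"
    using reconstruction_AE[OF f] by eventually_elim (auto simp: indicator_def \<phi>0)
  have fm: "(\<lambda>x. field F x \<bullet> gradient \<phi> x) \<in> borel_measurable lebesgue"
    by (rule measurable_completion) measurable
  have "AE x in lebesgue. field F x \<bullet> gradient \<phi> x = indicator K x *\<^sub>R (f x \<bullet> gradient \<phi> x)"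
    using ae by eventually_elim simp
  note m = borel_measurable_AE[OF fm this]
  have "(LINT x:K|lebesgue. f x \<bullet> gradient \<phi> x) = (LINT x|lebesgue. field F x \<bullet> gradient \<phi> x)"
    unfolding set_lebesgue_integral_def by (rule integral_cong_AE[OF m fm ae])
  also have "\<dots> = - real CARD('d) * (LINT x|lborel. slope F x * \<phi> x)"
    by (subst integral_completion) (measurable, rule integral_field_gradient[OF t])
  finally have "- (LINT x:K|lebesgue. f x \<bullet> gradient \<phi> x) = real CARD('d) * (LINT x|lborel. slope F x * \<phi> x)"
    by simp
  also have "\<dots> = (LINT x|lborel. real CARD('d) * slope F x * \<phi> x)"
    by (simp add: mult.assoc)
  also have "\<dots> = (LINT x|lebesgue. real CARD('d) * slope F x * \<phi> x)"
    by (rule integral_completion[symmetric]) measurable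
  also have "\<dots> = (LINT x:K|lebesgue. real CARD('d) * slope F x * \<phi> x)"
    unfolding set_lebesgue_integral_def
    by (intro Bochner_Integration.integral_cong refl) (use \<phi>0(1) in \<open>auto simp: indicator_def\<close>)
  finally show "(LINT x:K|lebesgue. real CARD('d) * slope F x * \<phi> x) = - (LINT x:K|lebesgue. f x \<bullet> gradient \<phi> x)" ..
qed

text \<open>Splitting \<open>q\<close> into its value at \<open>p\<close> and a linear part, the
  value meets the total of the residuals, equal to that of the fluxes, and the linear part meets
  their vanishing first moment.\<close>

lemma integral_affine_slope:
  "(LINT x:K|lebesgue. (a \<bullet> x + b) * (real CARD('d) * slope F x))
    = (a \<bullet> p + b) * (\<Sum>\<sigma>\<in>\<E>. face_measure \<sigma> * F \<sigma>)"
proof -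
  let ?D = "real CARD('d)"
  have D: "?D > 0" by simp
  \<comment> \<open>\<open>N\<close> is the dimension, \<open>\<delta>\<close> the distance,
    \<open>A\<close> the face measure, \<open>r\<close> the residual, \<open>c\<close> the value of
    \<open>q\<close> at \<open>p\<close>, and \<open>m\<close> the moment of the face
    center.\<close>
  have arith: "(N * r / \<delta>) * (\<delta> / N * A * c + \<delta> / (N + 1) * (A * m)) = c * (A * r) + (N / (N + 1)) * (A * r * m)"
    if "N > 0" "\<delta> > 0" for N r \<delta> A c m :: real
    using that by (simp add: distrib_left mult_ac)
  let ?q = "\<lambda>x. a \<bullet> x + b"
  have "(LINT x:K|lebesgue. (a \<bullet> x + b) * (?D * slope F x)) = (LINT x:K|lborel. ?q x * (?D * slope F x))"
    unfolding set_lebesgue_integral_def by (rule integral_completion) measurable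
  also have "\<dots> = (\<Sum>\<sigma>\<in>\<E>. LINT x:open_cone p \<sigma>|lborel. ?q x * (?D * slope F x))"
  proof (rule set_integral_K_cones(1))
    obtain B where B: "\<And>x. x \<in> K \<Longrightarrow> \<bar>a \<bullet> x + b\<bar> \<le> B" using affine_bounded_on[OF bounded_K, of a b] by blast
    let ?S = "\<Sum>\<sigma>\<in>\<E>. \<bar>R F \<sigma> / d \<sigma>\<bar>"
    show "set_integrable lborel K (\<lambda>x. ?q x * (?D * slope F x))"
      unfolding set_integrable_def
    proof (rule integrable_lborel_bounded_support[OF _ bounded_K, where B="B * (?D * ?S)"])
      fix x assume x: "x \<in> K"
      have "\<bar>a \<bullet> x + b\<bar> * \<bar>?D * slope F x\<bar> \<le> B * (?D * ?S)"
        using slope_bounded[of F x] B[OF x] by (intro mult_mono) (auto simp: abs_mult)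
      then show "norm (indicator K x *\<^sub>R ((a \<bullet> x + b) * (?D * slope F x))) \<le> B * (?D * ?S)"
        using x by (simp add: abs_mult)
    qed auto
  qed
  also have "\<dots> = (\<Sum>\<sigma>\<in>\<E>. (a \<bullet> p + b) * (face_measure \<sigma> * R F \<sigma>)
      + (?D / (?D + 1)) * (face_measure \<sigma> * R F \<sigma> * (a \<bullet> (face_center \<sigma> - p))))"
  proof (intro sum.cong refl)
    fix \<sigma> assume \<sigma>: "\<sigma> \<in> \<E>"
    have i1: "set_integrable lborel (open_cone p \<sigma>) (\<lambda>x. a \<bullet> p + b)"
      and i2: "set_integrable lborel (open_cone p \<sigma>) (\<lambda>x. a \<bullet> (x - p))"
      by (intro set_integrable_lborel_continuous bounded_cone borel_cone \<sigma> continuous_intros)+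
    have "(LINT x:open_cone p \<sigma>|lborel. ?q x * (?D * slope F x))
        = (LINT x:open_cone p \<sigma>|lborel. (?D * R F \<sigma> / d \<sigma>) * ?q x)"
      unfolding set_lebesgue_integral_def
      by (intro Bochner_Integration.integral_cong refl) (simp add: indicator_def slope_cone[OF \<sigma>] mult_ac)
    also have "\<dots> = (?D * R F \<sigma> / d \<sigma>) * (LINT x:open_cone p \<sigma>|lborel. ?q x)"
      by (rule set_integral_mult_right)
    also have "(LINT x:open_cone p \<sigma>|lborel. ?q x) = (LINT x:open_cone p \<sigma>|lborel. (a \<bullet> p + b) + a \<bullet> (x - p))"
      by (simp add: inner_diff_right add.commute)
    also have "\<dots> = (LINT x:open_cone p \<sigma>|lborel. a \<bullet> p + b) + (LINT x:open_cone p \<sigma>|lborel. a \<bullet> (x - p))"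
      by (rule set_integral_add(2)[OF i1 i2])
    also have "(LINT x:open_cone p \<sigma>|lborel. a \<bullet> p + b) = d \<sigma> / ?D * face_measure \<sigma> * (a \<bullet> p + b)"
      using borel_cone[OF \<sigma>] measure_cone(1)[OF \<sigma>] by (simp add: set_lebesgue_integral_def)
    also have "(LINT x:open_cone p \<sigma>|lborel. a \<bullet> (x - p))
        = d \<sigma> / (?D + 1) * (face_measure \<sigma> * (a \<bullet> (face_center \<sigma> - p)))"
      using integral_cone_moment[OF \<sigma>, of a] by simp
    finally show "(LINT x:open_cone p \<sigma>|lborel. ?q x * (?D * slope F x))
      = (a \<bullet> p + b) * (face_measure \<sigma> * R F \<sigma>)
      + (?D / (?D + 1)) * (face_measure \<sigma> * R F \<sigma> * (a \<bullet> (face_center \<sigma> - p)))"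
      by (simp only: arith[OF D d_pos[OF \<sigma>]])
  qed
  also have "\<dots> = (a \<bullet> p + b) * (\<Sum>\<sigma>\<in>\<E>. face_measure \<sigma> * F \<sigma>)"
    by (simp only: sum.distrib sum_distrib_left[symmetric] sum_residual sum_residual_moment mult_zero_right add_0_right)
  finally show ?thesis .
qed

text \<open>The two conditions say that \<open>w\<close> has the zeroth and first moments of a point
  mass \<open>vol\<close> at \<open>p\<close>, so affine functions cannot tell them apart.\<close>

lemma integral_affine_weight:
  assumes w: "set_integrable lebesgue K w" and w0: "(LINT x:K|lebesgue. w x) = vol"
    and w1: "(LINT x:K|lebesgue. w x *\<^sub>R x) = vol *\<^sub>R p"
  shows "(LINT x:K|lebesgue. (a \<bullet> x + b) * c * w x) = c * vol * (a \<bullet> p + b)"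
proof -
  obtain r where r: "\<And>x. x \<in> K \<Longrightarrow> norm x \<le> r" using bounded_K unfolding bounded_iff by blast
  \<comment> \<open>Integrability of the first moment follows from that of \<open>w\<close> because
    \<open>K\<close> is bounded.\<close>
  have i: "set_integrable lebesgue K (\<lambda>x. w x *\<^sub>R x)"
    by (rule set_integrable_bounded_mult[OF w _ r]) auto
  then have i': "integrable lebesgue (\<lambda>x. a \<bullet> (indicator K x *\<^sub>R (w x *\<^sub>R x)))"
    unfolding set_integrable_def by (intro integrable_inner_right)
  have "(LINT x:K|lebesgue. (a \<bullet> x + b) * c * w x)
    = (LINT x|lebesgue. c * (a \<bullet> (indicator K x *\<^sub>R (w x *\<^sub>R x)) + b * (indicator K x *\<^sub>R w x)))"
    unfolding set_lebesgue_integral_def by (intro Bochner_Integration.integral_cong refl) (simp add: algebra_simps)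
  also have "\<dots> = c * ((LINT x|lebesgue. a \<bullet> (indicator K x *\<^sub>R (w x *\<^sub>R x))) + b * (LINT x:K|lebesgue. w x))"
    using i' w unfolding set_integrable_def set_lebesgue_integral_def by simp
  also have "(LINT x|lebesgue. a \<bullet> (indicator K x *\<^sub>R (w x *\<^sub>R x))) = a \<bullet> (LINT x:K|lebesgue. w x *\<^sub>R x)"
    unfolding set_lebesgue_integral_def using i unfolding set_integrable_def by (intro integral_inner_right)
  finally show ?thesis by (simp add: w0 w1 algebra_simps)
qed

text \<open>Inserting the fluxes of \<open>H\<close> into the definition of \<open>V\<close>
  reproduces the second face identity, so \<open>V F = - H\<close>; then every residual is
  \<open>H \<bullet> n \<sigma> - H \<bullet> n \<sigma> = 0\<close>.\<close>

lemma field_constant: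
  assumes F: "\<forall>\<sigma>\<in>\<E>. F \<sigma> = H \<bullet> n \<sigma>" shows "field F x = H"
proof -
  have "vol * (a \<bullet> V F) = vol * (a \<bullet> (- H))" for a
  proof -
    have "vol * (a \<bullet> V F) = - (\<Sum>\<sigma>\<in>\<E>. face_measure \<sigma> * (n \<sigma> \<bullet> H) * (a \<bullet> (face_center \<sigma> - p)))"
      unfolding V_inner using F by (simp add: inner_commute)
    then show ?thesis by (simp add: sum_normals_moment)
  qed
  then have "a \<bullet> V F = a \<bullet> (- H)" for a using vol_pos by (metis less_irrefl mult_cancel_left)
  then have V: "V F = - H" by (metis vector_eq_ldot)
  have "slope F x = 0"
    unfolding slope_def using F by (intro sum.neutral) (simp add: flux_residual_def V)
  then show ?thesis by (simp add: field_def V)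
qed

end

text \<open>The reconstruction is a predicate on almost everywhere representatives: existence keeps
  the other statements from being vacuous, and the existence of \<open>g\<close> expresses
  membership in the space of fields with square integrable divergence. The weighted identity then
  holds for every representative \<open>f\<close> and \<open>g\<close>.\<close>

theorem proposition5p1:
  fixes K :: "(real^'d::finite) set"
    and \<E> :: "(real^'d) set set"
    and n :: "(real^'d) set \<Rightarrow> real^'d"
    and x\<^sub>K :: "real^'d"
    and \<Lambda> :: "real^'d^'d"
  assumes cell: "polytopal_cell K \<E>"
    and normals: "\<forall>\<sigma>\<in>\<E>. outward_unit_normal K \<sigma> (n \<sigma>)"
    and star: "star_shaped_wrt x\<^sub>K K"
    and dist_pos: "\<forall>\<sigma>\<in>\<E>. face_dist x\<^sub>K \<sigma> > 0"
    and cones: "negligible (K - (\<Union>\<sigma>\<in>\<E>. open_cone x\<^sub>K \<sigma>))"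
    and \<Lambda>_sym: "transpose \<Lambda> = \<Lambda>"
    and \<Lambda>_pos: "\<forall>v. v \<noteq> 0 \<longrightarrow> v \<bullet> (\<Lambda> *v v) > 0"
  shows
    "(\<forall>F. \<exists>f. is_flux_reconstruction K \<E> x\<^sub>K \<Lambda> n F f)
     \<and> (\<forall>F f. is_flux_reconstruction K \<E> x\<^sub>K \<Lambda> n F f \<longrightarrow>
          L2_on K f \<and> (\<exists>g. has_L2_divergence K f g))
     \<and> (\<forall>F. \<forall>\<sigma>\<in>\<E>. \<forall>x\<in>\<sigma>. flux_affine K \<E> x\<^sub>K \<Lambda> n F \<sigma> x \<bullet> n \<sigma> = F \<sigma>)
     \<and> (\<forall>F f g q w.
          is_flux_reconstruction K \<E> x\<^sub>K \<Lambda> n F f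
          \<and> has_L2_divergence K f g
          \<and> (\<exists>a b. \<forall>x. q x = a \<bullet> x + b)
          \<and> set_integrable lebesgue K w
          \<and> (LINT x:K|lebesgue. w x) = measure lebesgue K
          \<and> (LINT x:K|lebesgue. w x *\<^sub>R x) = measure lebesgue K *\<^sub>R x\<^sub>K
          \<longrightarrow> (LINT x:K|lebesgue. q x * g x)
              = (LINT x:K|lebesgue. q x * discrete_div K \<E> F * w x))
     \<and> (\<forall>G F f.
          (\<forall>\<sigma>\<in>\<E>. F \<sigma> = G \<bullet> n \<sigma>)
          \<and> is_flux_reconstruction K \<E> x\<^sub>K \<Lambda> n F f
          \<longrightarrow> (AE x in lebesgue. x \<in> K \<longrightarrow> f x = G))"
proof -
  interpret flux_cell K \<E> n x\<^sub>K \<Lambda>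
    using cell normals star dist_pos cones \<Lambda>_pos by unfold_locales blast+
  have weighted: "(LINT x:K|lebesgue. q x * g x) = (LINT x:K|lebesgue. q x * discrete_div K \<E> F * w x)"
    if f: "is_flux_reconstruction K \<E> x\<^sub>K \<Lambda> n F f" and g: "has_L2_divergence K f g"
      and q: "\<forall>x. q x = a \<bullet> x + b" and w: "set_integrable lebesgue K w"
      and w0: "(LINT x:K|lebesgue. w x) = measure lebesgue K"
      and w1: "(LINT x:K|lebesgue. w x *\<^sub>R x) = measure lebesgue K *\<^sub>R x\<^sub>K"
    for F f g q w a b
  proof -
    \<comment> \<open>The given divergence is exchanged for the explicit one; both sides of the
      claim then equal the total flux times the value of \<open>q\<close> at
      \<open>x\<^sub>K\<close>.\<close>
    have "(LINT x:K|lebesgue. q x * g x) = (LINT x:K|lebesgue. (a \<bullet> x + b) * (real CARD('d) * slope F x))"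
      using integral_affine_divergence_unique[OF open_K bounded_K g has_L2_divergence_reconstruction[OF f]] q
      by simp
    also have "\<dots> = discrete_div K \<E> F * vol * (a \<bullet> x\<^sub>K + b)"
      using vol_pos unfolding integral_affine_slope discrete_div_def measure_lebesgue_K by simp
    also have "\<dots> = (LINT x:K|lebesgue. q x * discrete_div K \<E> F * w x)"
      using integral_affine_weight[OF w w0[unfolded measure_lebesgue_K] w1[unfolded measure_lebesgue_K]] q by simp
    finally show ?thesis .
  qed
  have constant_flux: "AE x in lebesgue. x \<in> K \<longrightarrow> f x = G"
    if "\<forall>\<sigma>\<in>\<E>. F \<sigma> = G \<bullet> n \<sigma>" "is_flux_reconstruction K \<E> x\<^sub>K \<Lambda> n F f" for G F f
    using reconstruction_AE[OF that(2)] unfolding field_constant[OF that(1)] .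
  show ?thesis
    using is_flux_reconstruction_field L2_on_reconstruction has_L2_divergence_reconstruction
      flux_affine_normal weighted constant_flux by blast
qed

end
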